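(* Let $\eta\in\mathbb{R}^n$ and let $x_0 \in W^{1,1}(\mathbb{R}_+,\mu_r;\mathbb{R}^n)\cap\overline{P_T^0}^{1}(\mathbb{R}_+,\mu_r;\mathbb{R}^n)$ satisfy $x_0(0)=\eta$. Let $L:\mathbb{R}_+\times\mathbb{R}^n\times\mathbb{R}^n\to\mathbb{R}_+$ be a function which satisfies the following conditions. (a) $L$ is a Carathéodory function. (b) For a.e. $t\in\mathbb{R}_+$, for all $x\in\mathbb{R}^n$, $L(t,x,\cdot)$ is convex on $\mathbb{R}^n$. (c) There exists $\rho:\mathbb{R}^n\to\mathbb{R}_+$ such that $\lim_{|y|\to+\infty}\frac{\rho(y)}{|y|}=+\infty$ and, for all $(t,x,y)\in\mathbb{R}_+\times\mathbb{R}^n\times\mathbb{R}^n$, $L(t,x,y)\ge\rho(y)$. (d) There exists $\tilde x\in x_0+W^{1,1}_{T,0}(\mathbb{R}_+,\mu_r;\mathbb{R}^n)$ such that $\int_0^{+\infty}e^{-rt}L(t,\tilde x(t),\tilde x'(t))\,dt<+\infty$. Then the problem of minimizing $$\int_0^{+\infty}e^{-rt}L(t,x(t),x'(t))\,dt$$ over $x\in x_0+W^{1,1}_{T,0}(\mathbb{R}_+,\mu_r;\mathbb{R}^n)$ possesses a solution.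
   Context: Fix $n\ge1$ an integer, and real numbers $r>0$, $T>0$. $\mathbb{R}_+=[0,+\infty)$, $|\cdot|$ is the Euclidean norm, and $\mu_r$ is the measure on $\mathbb{R}_+$ with density $t\mapsto e^{-rt}$ with respect to Lebesgue measure. $L^1(\mathbb{R}_+,\mu_r;\mathbb{R}^n)$ is the Lebesgue space for $\mu_r$. $W^{1,1}(\mathbb{R}_+,\mu_r;\mathbb{R}^n)$ is the space of $f\in L^1(\mathbb{R}_+,\mu_r;\mathbb{R}^n)$ whose distributional derivative $f'$ lies in $L^1(\mathbb{R}_+,\mu_r;\mathbb{R}^n)$, with norm $\|f\|_{L^1(\mathbb{R}_+,\mu_r;\mathbb{R}^n)}+\|f'\|_{L^1(\mathbb{R}_+,\mu_r;\mathbb{R}^n)}$; its elements are identified with their continuous representatives. $P_T^0(\mathbb{R}_+,\mathbb{R}^n)$ is the space of continuous $T$-periodic functions $\mathbb{R}_+\to\mathbb{R}^n$, and $\overline{P_T^0}^{1}(\mathbb{R}_+,\mu_r;\mathbb{R}^n)$ is its closure in $L^1(\mathbb{R}_+,\mu_r;\mathbb{R}^n)$. $P_{T,0}^1(\mathbb{R}_+,\mathbb{R}^n)$ is the space of $T$-periodic functions $u\in C^1(\mathbb{R}_+,\mathbb{R}^n)$ with $u(0)=0$, and $W^{1,1}_{T,0}(\mathbb{R}_+,\mu_r;\mathbb{R}^n)$ is its closure in $W^{1,1}(\mathbb{R}_+,\mu_r;\mathbb{R}^n)$. $L$ is a Carathéodory function if $L(\cdot,x,y)$ is measurable for all $(x,y)\in\mathbb{R}^n\times\mathbb{R}^n$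 and $L(t,\cdot,\cdot)$ is continuous for a.e. $t\in\mathbb{R}_+$. *)

theory Defs
  imports "HOL-Analysis.Analysis"
begin

text \<open>
  A function on the half-line \<open>[0, \<infinity>)\<close> is represented by a total function on \<open>real\<close>; none of the
  definitions below depends on its values at negative arguments. Elements of \<open>L\<^sup>1\<close> are represented
  by functions rather than by equivalence classes.
\<close>

definition mu :: "real \<Rightarrow> real measure" where
  "mu r = density (lebesgue_on {0..}) (\<lambda>t. ennreal (exp (- r * t)))"

definition L1 :: "real \<Rightarrow> (real \<Rightarrow> real ^ 'n) set" where
  "L1 r = {f. integrable (mu r) f}"

definition L1_norm :: "real \<Rightarrow> (real \<Rightarrow> real ^ 'n) \<Rightarrow> real" where
  "L1_norm r f = (\<integral>t. norm (f t) \<partial>mu r)"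

definition test_function :: "(real \<Rightarrow> real) \<Rightarrow> bool" where
  "test_function \<phi> \<longleftrightarrow>
     (\<forall>k. (deriv ^^ k) \<phi> differentiable_on UNIV) \<and>
     compact (closure {t. \<phi> t \<noteq> 0}) \<and> closure {t. \<phi> t \<noteq> 0} \<subseteq> {0<..}"

definition locally_integrable :: "(real \<Rightarrow> real ^ 'n) \<Rightarrow> bool" where
  "locally_integrable f \<longleftrightarrow> (\<forall>K. compact K \<and> K \<subseteq> {0<..} \<longrightarrow> f absolutely_integrable_on K)"

definition has_distr_deriv :: "(real \<Rightarrow> real ^ 'n) \<Rightarrow> (real \<Rightarrow> real ^ 'n) \<Rightarrow> bool" where
  "has_distr_deriv f g \<longleftrightarrow>
     locally_integrable f \<and> locally_integrable g \<and>
     (\<forall>\<phi>. test_function \<phi> \<longrightarrow>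
        (\<integral>t. deriv \<phi> t *\<^sub>R f t \<partial>lebesgue_on {0<..}) =
        - (\<integral>t. \<phi> t *\<^sub>R g t \<partial>lebesgue_on {0<..}))"

text \<open>
  The distributional derivative is unique up to a null set; a representative is chosen, and
  all uses below are insensitive to the choice.
\<close>

definition distr_deriv :: "(real \<Rightarrow> real ^ 'n) \<Rightarrow> real \<Rightarrow> real ^ 'n" where
  "distr_deriv f = (SOME g. has_distr_deriv f g)"

text \<open>Elements of \<open>W\<^sup>1\<^sup>,\<^sup>1\<close> are identified with their continuous representatives.\<close>

definition W11 :: "real \<Rightarrow> (real \<Rightarrow> real ^ 'n) set" where
  "W11 r = {f \<in> L1 r. continuous_on {0..} f \<and> (\<exists>g \<in> L1 r. has_distr_deriv f g)}"

definition W11_norm :: "real \<Rightarrow> (real \<Rightarrow> real ^ 'n) \<Rightarrow> real" where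
  "W11_norm r f = L1_norm r f + L1_norm r (distr_deriv f)"

definition periodic :: "real \<Rightarrow> (real \<Rightarrow> real ^ 'n) \<Rightarrow> bool" where
  "periodic T f \<longleftrightarrow> (\<forall>t\<ge>0. f (t + T) = f t)"

definition P0 :: "real \<Rightarrow> (real \<Rightarrow> real ^ 'n) set" where
  "P0 T = {f. continuous_on {0..} f \<and> periodic T f}"

definition P0_closure :: "real \<Rightarrow> real \<Rightarrow> (real \<Rightarrow> real ^ 'n) set" where
  "P0_closure r T = {f \<in> L1 r. \<forall>\<epsilon>>0. \<exists>p \<in> P0 T. L1_norm r (\<lambda>t. f t - p t) < \<epsilon>}"

text \<open>The derivative at \<open>0\<close> in \<open>C1_halfline\<close> is one-sided.\<close>

definition C1_halfline :: "(real \<Rightarrow> real ^ 'n) \<Rightarrow> bool" where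
  "C1_halfline u \<longleftrightarrow>
     (\<exists>u'. continuous_on {0..} u' \<and>
        (\<forall>t\<ge>0. (u has_vector_derivative u' t) (at t within {0..})))"

definition P1_0 :: "real \<Rightarrow> (real \<Rightarrow> real ^ 'n) set" where
  "P1_0 T = {u. C1_halfline u \<and> periodic T u \<and> u 0 = 0}"

definition W11_0 :: "real \<Rightarrow> real \<Rightarrow> (real \<Rightarrow> real ^ 'n) set" where
  "W11_0 r T = {f \<in> W11 r. \<forall>\<epsilon>>0. \<exists>u \<in> P1_0 T. W11_norm r (\<lambda>t. f t - u t) < \<epsilon>}"

definition admissible ::
    "real \<Rightarrow> real \<Rightarrow> (real \<Rightarrow> real ^ 'n) \<Rightarrow> (real \<Rightarrow> real ^ 'n) set" where
  "admissible r T x0 = (\<lambda>h t. x0 t + h t) ` W11_0 r T"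

definition caratheodory :: "(real \<Rightarrow> real ^ 'n \<Rightarrow> real ^ 'n \<Rightarrow> real) \<Rightarrow> bool" where
  "caratheodory L \<longleftrightarrow>
     (\<forall>x y. (\<lambda>t. L t x y) \<in> borel_measurable (lebesgue_on {0..})) \<and>
     (AE t in lebesgue_on {0..}. continuous_on UNIV (\<lambda>(x, y). L t x y))"

text \<open>
  For a nonnegative integrand the functional is well defined with values in \<open>[0, \<infinity>]\<close>.
\<close>

definition cost ::
    "real \<Rightarrow> (real \<Rightarrow> real ^ 'n \<Rightarrow> real ^ 'n \<Rightarrow> real) \<Rightarrow> (real \<Rightarrow> real ^ 'n) \<Rightarrow> ennreal" where
  "cost r L x =
     (\<integral>\<^sup>+ t. ennreal (exp (- r * t) * L t (x t) (distr_deriv x t)) \<partial>lebesgue_on {0..})"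

end

(*
  Tonelli's direct method.  Functions in W^{1,1} are exactly the primitives f(t) = f(0) + int_0^t g with
  g in L^1(mu_r), by testing against smooth approximations of indicators of intervals and by Fubini, and
  |int_0^. g| is bounded in L^1(mu_r) by |g| / r.

  Superlinear growth makes the derivatives of a minimizing sequence uniformly integrable.  A subsequence
  of the functions x_i then converges pointwise.  Weak compactness of the derivatives v_i is replaced by
  strong convergence of convex combinations of the tails: minimizing the strictly convex functional
  int sqrt(1 + |V|^2) over increasingly late tail hulls yields a sequence that is Cauchy in L^1.  The same
  convex combinations are taken of the x_i and of the values L(t, x_i, v_i).

  Lower semicontinuity is then pointwise in t.  An affine minorant of L(t, x(t), .) that is almost exact at
  v(t) remains, up to epsilon, a minorant of L(t, x', .) for all x' near x(t), because L is continuous and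
  superlinear (Cesari's property (Q)); affine inequalities survive convex combinations.  Fatou's lemma
  concludes.
*)

theory Submission
  imports Defs "HOL-Complex_Analysis.Great_Picard"
begin

text \<open>\<open>L\<close> is convex only in the velocity, so convex combinations of states are
  harmless only once the states converge at each fixed \<open>t\<close>. This is why a pointwise
  convergent subsequence is extracted before anything is combined. Averaging preserves the limit,
  because a ball containing a tail contains its combinations; the limit is then identified with the
  primitive of the strong limit of the averaged derivatives.

  The integrand \<open>sqrt(1 + |V|^2)\<close> is a compromise: the integral of \<open>|V|\<close>
  is not strictly convex, and that of \<open>|V|^2\<close> may be infinite on \<open>L^1\<close>.
  The square root is the norm of \<open>(1, V)\<close>. It grows linearly, yet its midpoint deficit
  controls \<open>|a - b|^2\<close> on bounded sets, and uniform integrability covers large values.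

  Explicit weights never appear. Hulls are replaced by families closed under midpoints, and the
  coupling of states, derivatives and values survives only through the inequalities that averaging
  preserves.\<close>

section \<open>Smooth steps\<close>

text \<open>The family is closed under differentiation, so its members are smooth.\<close>

definition bump :: "nat \<Rightarrow> real poly \<Rightarrow> real \<Rightarrow> real" where
  "bump k p t = (if 0 < t \<and> t < 1 then exp (- 1 / (t * (1 - t))) * poly p t / (t * (1 - t)) ^ k else 0)"

lemma power_le_fact_exp:
  fixes s :: real assumes "s \<ge> 0" shows "s ^ n \<le> fact n * exp s"
proof -
  have "(\<Sum>i\<in>{n}. s ^ i /\<^sub>R fact i) \<le> (\<Sum>i. s ^ i /\<^sub>R fact i)"
    by (rule sum_le_suminf[OF summable_exp_generic]) (use assms in auto)
  then show ?thesis by (simp add: exp_def field_simps)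
qed

text \<open>The exponential beats every pole: \<open>(1 / q) ^ (k + 2)\<close> is at most a constant
  times \<open>exp (1 / q)\<close>. The two extra powers leave a quadratic zero at both ends of the
  unit interval, which yields derivative 0 there.\<close>

lemma bump_bound: "\<exists>C\<ge>0. \<forall>t. \<bar>bump k p t\<bar> \<le> (if 0 < t \<and> t < 1 then C * (t * (1 - t))\<^sup>2 else 0)"
proof -
  have "bounded (poly p ` {0..1})"
    by (intro compact_imp_bounded compact_continuous_image continuous_intros compact_Icc)
  then obtain B where B: "B > 0" "\<And>t. t \<in> {0..1} \<Longrightarrow> \<bar>poly p t\<bar> \<le> B"
    unfolding bounded_pos by auto
  have "\<bar>bump k p t\<bar> \<le> (fact (k + 2) * B) * (t * (1 - t))\<^sup>2" if t: "0 < t" "t < 1" for t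
  proof -
    define q where "q = t * (1 - t)"
    have q: "q > 0" unfolding q_def using t by simp
    have "(1 / q) ^ (k + 2) \<le> fact (k + 2) * exp (1 / q)"
      by (rule power_le_fact_exp) (use q in simp)
    then have e: "exp (- 1 / q) \<le> fact (k + 2) * q ^ (k + 2)"
      using q by (simp add: exp_minus field_simps)
    have "\<bar>bump k p t\<bar> = exp (- 1 / q) * \<bar>poly p t\<bar> / q ^ k"
      unfolding bump_def q_def[symmetric] using t q by (simp add: abs_mult)
    also have "\<dots> \<le> (fact (k + 2) * q ^ (k + 2)) * B / q ^ k"
      by (intro divide_right_mono mult_mono e B) (use t q B in auto)
    also have "\<dots> = (fact (k + 2) * B) * q\<^sup>2"
      using q by (simp add: power_add power2_eq_square)
    finally show ?thesis unfolding q_def .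
  qed
  then show ?thesis using B(1)
    by (intro exI[of _ "fact (k + 2) * B"]) (auto simp: bump_def)
qed

text \<open>With \<open>Q t = t * (1 - t)\<close>, this is the numerator of the derivative over the
  common denominator \<open>Q t ^ (k + 2)\<close>. The summands come from the exponential, from
  \<open>p\<close> and from the power of \<open>Q\<close>; the coefficient lists are
  \<open>Q'\<close> and \<open>Q\<close>.\<close>

definition bump_step :: "nat \<Rightarrow> real poly \<Rightarrow> real poly" where
  "bump_step k p = [:1, -2:] * p + pderiv p * [:0, 1, -1:]\<^sup>2 - smult (real k) (p * [:1, -2:] * [:0, 1, -1:])"

lemma bump_DERIV: "(bump k p has_real_derivative bump (k + 2) (bump_step k p) t) (at t)"
proof (cases "0 < t \<and> t < 1")
  case True
  \<comment> \<open>\<open>Q n\<close> stands in for the convex hull of the tail from \<open>n\<close>: each of its conditions is stable under midpoints.\<close>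
  define Q where "Q = (\<lambda>t::real. t * (1 - t))"
  have q: "Q t \<noteq> 0" using True by (auto simp: Q_def)
  have Q': "(Q has_real_derivative 1 - 2 * t) (at t)"
    unfolding Q_def by (auto intro!: derivative_eq_intros)
  have "((\<lambda>t. exp (- 1 / Q t) * poly p t / Q t ^ k) has_real_derivative
      ((exp (- 1 / Q t) * ((1 - 2 * t) / (Q t)\<^sup>2) * poly p t + exp (- 1 / Q t) * poly (pderiv p) t) * Q t ^ k
        - exp (- 1 / Q t) * poly p t * (real k * Q t ^ (k - 1) * (1 - 2 * t))) / (Q t ^ k * Q t ^ k)) (at t)"
    using q by (auto intro!: derivative_eq_intros Q' simp: power2_eq_square field_simps)
  also have "((exp (- 1 / Q t) * ((1 - 2 * t) / (Q t)\<^sup>2) * poly p t + exp (- 1 / Q t) * poly (pderiv p) t) * Q t ^ k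
        - exp (- 1 / Q t) * poly p t * (real k * Q t ^ (k - 1) * (1 - 2 * t))) / (Q t ^ k * Q t ^ k)
      = exp (- 1 / Q t) * ((1 - 2 * t) * poly p t + poly (pderiv p) t * (Q t)\<^sup>2
          - real k * (poly p t * (1 - 2 * t) * Q t)) / Q t ^ (k + 2)"
    using q by (cases k) (simp_all add: field_simps power2_eq_square)
  also have "\<dots> = bump (k + 2) (bump_step k p) t"
    using True by (simp add: bump_def bump_step_def Q_def algebra_simps)
  finally have "((\<lambda>t. exp (- 1 / (t * (1 - t))) * poly p t / (t * (1 - t)) ^ k) has_real_derivative
      bump (k + 2) (bump_step k p) t) (at t)" by (simp only: Q_def)
  then show ?thesis
    by (rule DERIV_cong_ev[THEN iffD1, OF refl _ refl, rotated])
       (use True in \<open>auto simp: bump_def eventually_at_topological intro!: eventually_nhds[THEN iffD2] exI[of _ "{0<..<1}"]\<close>)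
next
  case False
  obtain C where C: "C \<ge> 0" "\<And>s. \<bar>bump k p s\<bar> \<le> (if 0 < s \<and> s < 1 then C * (s * (1 - s))\<^sup>2 else 0)"
    using bump_bound by blast
  \<comment> \<open>A point \<open>t\<close> outside the open unit interval has distance at least
    \<open>s * (1 - s)\<close> from each \<open>s\<close> inside, so the quadratic zero is also
    quadratic in \<open>s - t\<close>, and the difference quotient tends to 0.\<close>
  have b: "\<bar>bump k p s\<bar> \<le> C * (s - t)\<^sup>2" for s
  proof (cases "0 < s \<and> s < 1")
    case True
    have "\<bar>s * (1 - s)\<bar> \<le> \<bar>s - t\<bar>"
    proof (cases "t \<le> 0")
      case t: True
      have "s * (1 - s) \<le> s * 1" using True by (intro mult_left_mono) auto
      then have "s * (1 - s) \<le> s - t" using t by linarith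
      then show ?thesis using True t by (simp add: abs_mult)
    next
      case t: False
      have "s * (1 - s) \<le> 1 * (1 - s)" using True by (intro mult_right_mono) auto
      also have "\<dots> \<le> t - s" using t False by auto
      finally have "s * (1 - s) \<le> t - s" .
      then show ?thesis using True t False by (simp add: abs_mult)
    qed
    then have "(s * (1 - s))\<^sup>2 \<le> (s - t)\<^sup>2" by (simp add: abs_le_square_iff)
    then show ?thesis using C(2)[of s] True C(1) by (auto intro: order_trans mult_left_mono)
  qed (use C(2)[of s] C(1) in auto)
  have z: "bump k p t = 0" "bump (k + 2) (bump_step k p) t = 0" using False by (auto simp: bump_def)
  have "((\<lambda>s. (bump k p s - bump k p t) / (s - t)) \<longlongrightarrow> 0) (at t)"
  proof (rule Lim_null_comparison)
    show "\<forall>\<^sub>F s in at t. norm ((bump k p s - bump k p t) / (s - t)) \<le> C * \<bar>s - t\<bar>"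
      unfolding eventually_at_filter
    proof (rule always_eventually, intro allI impI)
      fix s assume "s \<noteq> t"
      then show "norm ((bump k p s - bump k p t) / (s - t)) \<le> C * \<bar>s - t\<bar>"
        using b[of s] z by (simp add: divide_le_eq power2_eq_square abs_mult mult.assoc abs_mult_self_eq)
    qed
    show "((\<lambda>s. C * \<bar>s - t\<bar>) \<longlongrightarrow> 0) (at t)" by (rule tendsto_eq_intros refl | simp)+
  qed
  then show ?thesis using z by (simp add: has_field_derivative_iff)
qed

lemma bump_smult: "bump k (smult c p) t = c * bump k p t"
  by (simp add: bump_def)

text \<open>Smoothness without a formula for the \<open>k\<close>-th derivative: a family that
  differentiation never leaves is enough.\<close>

lemma iterated_deriv_closed:
  fixes F :: "(real \<Rightarrow> real) set"
  assumes "\<And>f. f \<in> F \<Longrightarrow> \<exists>f'\<in>F. \<forall>t. (f has_real_derivative f' t) (at t)" and "f \<in> F"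
  shows "(deriv ^^ k) f \<in> F"
proof (induction k)
  case (Suc k)
  obtain f' where "f' \<in> F" "\<forall>t. ((deriv ^^ k) f has_real_derivative f' t) (at t)"
    using assms(1)[OF Suc] by auto
  then have "deriv ((deriv ^^ k) f) = f'" by (auto intro!: DERIV_imp_deriv)
  then show ?case using \<open>f' \<in> F\<close> by simp
qed (use assms in simp)

text \<open>The closed family consists of differences of two scaled translates, the shape of the
  derivative of a test function built from two steps. The chain-rule factor \<open>1 / e\<close> is
  absorbed into the polynomial.\<close>

lemma bump_diff_smooth:
  assumes "e > 0"
  shows "(deriv ^^ k) (\<lambda>t. bump j p ((t - a) / e) - bump j p ((t - b) / e)) differentiable_on UNIV"
proof -
  define F where "F = {(\<lambda>t. bump j p ((t - a) / e) - bump j p ((t - b) / e)) | j p. True}"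
  have D: "\<exists>f'\<in>F. \<forall>t. (f has_real_derivative f' t) (at t)" if f: "f \<in> F" for f
  proof -
    obtain j p where f: "f = (\<lambda>t. bump j p ((t - a) / e) - bump j p ((t - b) / e))"
      using f unfolding F_def by blast
    define q where "q = smult (1 / e) (bump_step j p)"
    have 1: "((\<lambda>t. bump j p ((t - c) / e)) has_real_derivative bump (j + 2) q ((t - c) / e)) (at t)" for c t
      unfolding q_def bump_smult
      by (rule DERIV_chain'[OF _ bump_DERIV, THEN DERIV_cong]) (use assms in \<open>auto intro!: derivative_eq_intros\<close>)
    let ?f' = "\<lambda>t. bump (j + 2) q ((t - a) / e) - bump (j + 2) q ((t - b) / e)"
    have "?f' \<in> F" unfolding F_def by blast
    moreover have "\<forall>t. (f has_real_derivative ?f' t) (at t)" unfolding f by (intro allI DERIV_diff 1)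
    ultimately show ?thesis by (intro bexI[of _ ?f'])
  qed
  have "(\<lambda>t. bump j p ((t - a) / e) - bump j p ((t - b) / e)) \<in> F" unfolding F_def by blast
  from iterated_deriv_closed[of F, OF D this, of k]
  have "(deriv ^^ k) (\<lambda>t. bump j p ((t - a) / e) - bump j p ((t - b) / e)) \<in> F" .
  from D[OF this] show ?thesis
    by (meson differentiable_on_def field_differentiable_def field_differentiable_imp_differentiable differentiable_at_withinI)
qed

text \<open>An antiderivative of \<open>bump 0 [:1:]\<close>, shifted and divided by its increment
  over the unit interval. The normalizing constant enters the polynomial, so the derivative stays in
  the bump family.\<close>

lemma smooth_step_exists:
  obtains S :: "real \<Rightarrow> real" and c where
    "\<And>t. (S has_real_derivative bump 0 [:c:] t) (at t)" "c > 0"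
    "\<And>t. t \<le> 0 \<Longrightarrow> S t = 0" "\<And>t. t \<ge> 1 \<Longrightarrow> S t = 1" "\<And>t. 0 \<le> S t" "\<And>t. S t \<le> 1"
proof -
  let ?w = "bump 0 [:1:]"
  have cont: "isCont ?w t" for t using bump_DERIV by (rule DERIV_isCont)
  have "\<exists>F. \<forall>x::real. -\<infinity> < ereal x \<longrightarrow> ereal x < \<infinity> \<longrightarrow> (F has_vector_derivative ?w x) (at x)"
    by (rule einterval_antiderivative) (auto simp: cont)
  then obtain F where F: "\<And>x. (F has_real_derivative ?w x) (at x)"
    by (auto simp: has_real_derivative_iff_has_vector_derivative)
  have w0: "?w t \<ge> 0" for t by (simp add: bump_def)
  have mono: "F s \<le> F t" if "s \<le> t" for s t
    by (rule DERIV_nonneg_imp_nondecreasing[OF that]) (use F w0 in blast)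
  have lt: "F 0 < F 1"
  proof -
    obtain z where "0 < z" "z < 1" "F 1 - F 0 = (1 - 0) * ?w z"
      using MVT2[of 0 1 F ?w] F by auto
    moreover have "?w z > 0" using \<open>0 < z\<close> \<open>z < 1\<close> by (simp add: bump_def)
    ultimately show ?thesis by simp
  qed
  have out: "F s = F t" if "s \<le> t" "t \<le> 0 \<or> s \<ge> 1" for s t
  proof (cases "s = t")
    case False
    then have "s < t" using that by simp
    obtain z where "s < z" "z < t" "F t - F s = (t - s) * ?w z"
      using MVT2[of s t F ?w] F \<open>s < t\<close> by auto
    moreover have "?w z = 0" using that \<open>s < z\<close> \<open>z < t\<close> by (auto simp: bump_def)
    ultimately show ?thesis by simp
  qed simp
  define d where "d = F 1 - F 0"
  have d: "d > 0" using lt d_def by simp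
  show ?thesis
  proof (rule that[of "\<lambda>t. (F t - F 0) / d" "1 / d"])
    fix t
    have "bump 0 [:1/d:] t = ?w t / d" using bump_smult[of 0 "1/d" "[:1:]" t] by simp
    with d show "((\<lambda>t. (F t - F 0) / d) has_real_derivative bump 0 [:1/d:] t) (at t)"
      by (simp only:) (auto intro!: derivative_eq_intros F)
    show "0 \<le> (F t - F 0) / d" using out[of t 0] mono[of 0 t] d by (cases "t \<le> 0") auto
    show "(F t - F 0) / d \<le> 1" using out[of 1 t] mono[of t 1] d by (cases "t \<le> 1") (auto simp: d_def)
    show "(F t - F 0) / d = 0" if "t \<le> 0" using out[of t 0] that by simp
    show "(F t - F 0) / d = 1" if "t \<ge> 1" using out[of 1 t] that d d_def by simp
  qed (use d in simp)
qed

text \<open>One copy of \<open>S\<close> climbs on \<open>[a, a + e]\<close>, a second one is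
  subtracted and climbs on \<open>[b, b + e]\<close>, so the support stays away from 0. As
  \<open>e\<close> tends to 0 the difference approaches the indicator of \<open>{a<..b}\<close>, and
  its derivative acts as a difference of point evaluations.\<close>

lemma test_function_step:
  fixes S :: "real \<Rightarrow> real"
  assumes S: "\<And>t. (S has_real_derivative bump 0 [:c:] t) (at t)" "\<And>t. t \<le> 0 \<Longrightarrow> S t = 0" "\<And>t. t \<ge> 1 \<Longrightarrow> S t = 1"
    and "0 < e" "0 < a" "a \<le> b"
  defines "\<phi> \<equiv> \<lambda>t. S ((t - a) / e) - S ((t - b) / e)"
  shows "deriv \<phi> = (\<lambda>t. bump 0 [:c / e:] ((t - a) / e) - bump 0 [:c / e:] ((t - b) / e))" (is "_ = ?d")
    and "test_function \<phi>"
proof -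
  have sm: "bump 0 [:c / e:] t = bump 0 [:c:] t / e" for t using bump_smult[of 0 "1/e" "[:c:]" t] by simp
  have D: "(\<phi> has_real_derivative ?d t) (at t)" for t
    unfolding \<phi>_def sm
    by (intro DERIV_diff; rule DERIV_chain'[OF _ S(1), THEN DERIV_cong])
       (use assms in \<open>auto intro!: derivative_eq_intros\<close>)
  then show d: "deriv \<phi> = ?d" by (auto intro!: DERIV_imp_deriv)
  have sub: "closure {t. \<phi> t \<noteq> 0} \<subseteq> {a..b + e}"
  proof (rule closure_minimal)
    show "{t. \<phi> t \<noteq> 0} \<subseteq> {a..b + e}"
    proof safe
      fix t assume t: "\<phi> t \<noteq> 0"
      have "t \<ge> a" 
      proof (rule ccontr)
        assume "\<not> t \<ge> a" then have "(t - a) / e \<le> 0" "(t - b) / e \<le> 0" using assms(4-6) by (auto simp: divide_le_0_iff)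
        then show False using t S(2) by (simp add: \<phi>_def)
      qed
      moreover have "t \<le> b + e" 
      proof (rule ccontr)
        assume "\<not> t \<le> b + e" then have "(t - a) / e \<ge> 1" "(t - b) / e \<ge> 1" using assms(4-6) by auto
        then show False using t S(3) by (simp add: \<phi>_def)
      qed
      ultimately show "t \<in> {a..b+e}" by simp
    qed
  qed simp
  have "(deriv ^^ k) \<phi> differentiable_on UNIV" for k
  proof (cases k)
    case 0
    then show ?thesis using D
      by (simp add: differentiable_on_def) (meson field_differentiable_def field_differentiable_imp_differentiable differentiable_at_withinI)
  next
    case (Suc m)
    have "(deriv ^^ k) \<phi> = (deriv ^^ m) ?d" using Suc d by (simp add: funpow_Suc_right del: funpow.simps)
    then show ?thesis using bump_diff_smooth[OF \<open>0 < e\<close>] by simp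
  qed
  moreover have "compact (closure {t. \<phi> t \<noteq> 0})" using sub
    by (meson bounded_closed_interval bounded_subset closed_closure compact_eq_bounded_closed)
  moreover have "closure {t. \<phi> t \<noteq> 0} \<subseteq> {0<..}" using sub assms(5) by fastforce
  ultimately show "test_function \<phi>" unfolding test_function_def by blast
qed

section \<open>Distributional derivatives and primitives\<close>

text \<open>The bridge between Lebesgue integrals over a half-line, in which distributional
  derivatives are stated, and gauge integrals over intervals, for which the fundamental theorem of
  calculus is available.\<close>

lemma lebesgue_on_integral_eq_on_Icc:
  fixes F :: "real \<Rightarrow> 'b::euclidean_space"
  assumes "F absolutely_integrable_on {a..b}" "{a..b} \<subseteq> S" "S \<in> sets lebesgue"
    and "\<And>t. t \<in> S \<Longrightarrow> t \<notin> {a..b} \<Longrightarrow> F t = 0"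
  shows "integrable (lebesgue_on S) F" "integral\<^sup>L (lebesgue_on S) F = integral {a..b} F"
proof -
  have eq: "indicator S t *\<^sub>R F t = indicator {a..b} t *\<^sub>R F t" for t
    using assms(2,4) by (auto simp: indicator_def)
  show "integrable (lebesgue_on S) F"
    using assms(1,3) by (simp add: integrable_restrict_space eq set_integrable_def)
  show "integral\<^sup>L (lebesgue_on S) F = integral {a..b} F"
    using assms(1,3) set_lebesgue_integral_eq_integral(2)[OF assms(1)]
    by (simp add: integral_restrict_space eq set_lebesgue_integral_def)
qed

lemma absolutely_integrable_continuous_scaleR:
  fixes \<phi> :: "real \<Rightarrow> real" and g :: "real \<Rightarrow> 'b::euclidean_space"
  assumes "continuous_on {a..b} \<phi>" "g absolutely_integrable_on {a..b}"
  shows "(\<lambda>t. \<phi> t *\<^sub>R g t) absolutely_integrable_on {a..b}"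
proof (rule absolutely_integrable_bounded_measurable_product[where h="(*\<^sub>R)"])
  show "bilinear ((*\<^sub>R) :: real \<Rightarrow> 'b \<Rightarrow> 'b)" by (simp add: bilinear_conv_bounded_bilinear bounded_bilinear_scaleR)
  show "\<phi> \<in> borel_measurable (lebesgue_on {a..b})"
    by (rule continuous_imp_measurable_on_sets_lebesgue[OF assms(1)]) simp
  show "bounded (\<phi> ` {a..b})" by (intro compact_imp_bounded compact_continuous_image assms compact_Icc)
qed (use assms in auto)

text \<open>The kernel has mass 1 and lives just to the right of \<open>a\<close>, so the integrals
  are averages of \<open>h\<close> over a shrinking right neighbourhood. One-sidedness is what
  allows \<open>a = A\<close>.\<close>

lemma bump_approx_identity:
  fixes h :: "real \<Rightarrow> 'b::euclidean_space" and S :: "real \<Rightarrow> real"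
  assumes S: "\<And>t. (S has_real_derivative bump 0 [:c:] t) (at t)" "\<And>t. t \<le> 0 \<Longrightarrow> S t = 0" "\<And>t. t \<ge> 1 \<Longrightarrow> S t = 1"
    and "c > 0" and h: "continuous_on {A..B} h" and A: "A \<le> a" "a < B"
  shows "(\<lambda>n. integral {A..B} (\<lambda>t. bump 0 [:c / (1 / real (Suc n)):] ((t - a) / (1 / real (Suc n))) *\<^sub>R h t)) \<longlonglongrightarrow> h a"
proof (rule LIMSEQ_I)
  fix \<epsilon> :: real assume "\<epsilon> > 0"
  then obtain d where d: "d > 0" "\<And>t. t \<in> {A..B} \<Longrightarrow> \<bar>t - a\<bar> < d \<Longrightarrow> norm (h t - h a) < \<epsilon> / 2"
    using h A unfolding continuous_on_iff dist_norm by (metis atLeastAtMost_iff half_gt_zero less_eq_real_def real_norm_def)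
  \<comment> \<open>\<open>d\<close> serves the continuity estimate, while \<open>B - a\<close>
    keeps the whole mass of the kernel inside \<open>{A..B}\<close>.\<close>
  obtain N where N: "1 / real (Suc N) < min d (B - a)"
    using reals_Archimedean[of "min d (B - a)"] d A by (auto simp: inverse_eq_divide)
  show "\<exists>no. \<forall>n\<ge>no. norm (integral {A..B} (\<lambda>t. bump 0 [:c / (1 / real (Suc n)):] ((t - a) / (1 / real (Suc n))) *\<^sub>R h t) - h a) < \<epsilon>"
  proof (intro exI allI impI)
    fix n assume "n \<ge> N"
    define e where "e = 1 / real (Suc n)"
    have "e \<le> 1 / real (Suc N)" using \<open>n \<ge> N\<close> by (simp add: e_def frac_le)
    then have e: "0 < e" "e < d" "e < B - a" using N by (auto simp: e_def)
    let ?w = "\<lambda>t. bump 0 [:c / e:] ((t - a) / e)"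
    have sm: "bump 0 [:c / e:] t = bump 0 [:c:] t / e" for t using bump_smult[of 0 "1/e" "[:c:]" t] by simp
    have D: "((\<lambda>t. S ((t - a) / e)) has_real_derivative ?w t) (at t)" for t
      unfolding sm by (rule DERIV_chain'[OF _ S(1), THEN DERIV_cong])
         (use e in \<open>auto intro!: derivative_eq_intros\<close>)
    have "(?w has_integral (S ((B - a) / e) - S ((A - a) / e))) {A..B}"
      using A D by (intro fundamental_theorem_of_calculus)
        (auto simp: has_real_derivative_iff_has_vector_derivative intro: has_vector_derivative_at_within)
    moreover have "S ((B - a) / e) = 1" "S ((A - a) / e) = 0"
      using e A by (auto intro!: S simp: divide_le_0_iff)
    ultimately have w1: "(?w has_integral 1) {A..B}" by simp
    have wcont: "continuous_on {A..B} ?w"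
    proof -
      have "continuous_on UNIV (bump 0 [:c/e:])"
        using bump_DERIV by (intro DERIV_continuous_on) (auto intro: has_field_derivative_at_within)
      then show ?thesis
        by (rule continuous_on_compose2) (use e in \<open>auto intro!: continuous_intros\<close>)
    qed
    have w0: "?w t \<ge> 0" for t using \<open>c > 0\<close> e by (simp add: bump_def)
    have "(\<lambda>t. ?w t *\<^sub>R (h t - h a)) integrable_on {A..B}"
      by (intro integrable_continuous_real continuous_intros wcont h)
    moreover have "(\<lambda>t. \<epsilon> / 2 * ?w t) integrable_on {A..B}"
      by (intro integrable_continuous_real continuous_intros wcont h)
    moreover have "norm (?w t *\<^sub>R (h t - h a)) \<le> \<epsilon> / 2 * ?w t" if t: "t \<in> {A..B}" for t
    proof (cases "?w t = 0")
      case False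
      then have "0 < (t - a) / e" "(t - a) / e < 1" by (auto simp: bump_def split: if_splits)
      then have "\<bar>t - a\<bar> < d" using e by (auto simp: field_simps)
      then have "norm (h t - h a) * ?w t \<le> \<epsilon> / 2 * ?w t"
        by (intro mult_right_mono w0) (use d(2)[OF t] in auto)
      then show ?thesis using w0[of t] by (simp add: mult.commute)
    qed simp
    ultimately have "norm (integral {A..B} (\<lambda>t. ?w t *\<^sub>R (h t - h a))) \<le> integral {A..B} (\<lambda>t. \<epsilon> / 2 * ?w t)"
      by (rule integral_norm_bound_integral)
    also have "\<dots> = \<epsilon> / 2" using integral_unique[OF w1] by simp
    also have "integral {A..B} (\<lambda>t. ?w t *\<^sub>R (h t - h a)) = integral {A..B} (\<lambda>t. ?w t *\<^sub>R h t - ?w t *\<^sub>R h a)"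
      by (simp add: scaleR_diff_right)
    also have "\<dots> = integral {A..B} (\<lambda>t. ?w t *\<^sub>R h t) - integral {A..B} (\<lambda>t. ?w t *\<^sub>R h a)"
      by (intro Henstock_Kurzweil_Integration.integral_diff integrable_continuous_real continuous_intros wcont h)
    also have "integral {A..B} (\<lambda>t. ?w t *\<^sub>R h a) = h a"
      using has_integral_scaleR_left[OF w1, of "h a"] by (simp add: integral_unique)
    finally show "norm (integral {A..B} (\<lambda>t. bump 0 [:c / (1 / real (Suc n)):] ((t - a) / (1 / real (Suc n))) *\<^sub>R h t) - h a) < \<epsilon>"
      using \<open>\<epsilon> > 0\<close> unfolding e_def by simp
  qed
qed

text \<open>Test against differences of steps: one side is a difference of mollifications and tends
  to \<open>f a - f b\<close>, the other tends by dominated convergence to minus the integral of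
  \<open>g\<close>. The widths \<open>e n\<close> are at most 1, so everything takes place on
  \<open>{a..b + 1}\<close>.\<close>

lemma has_distr_deriv_imp_integral:
  fixes f g :: "real \<Rightarrow> real ^ 'n"
  assumes f: "continuous_on {0<..} f" and fg: "has_distr_deriv f g" and ab: "0 < a" "a \<le> b"
  shows "f b - f a = integral {a..b} g"
proof -
  obtain S :: "real \<Rightarrow> real" and c where
    S: "\<And>t. (S has_real_derivative bump 0 [:c:] t) (at t)"  "\<And>t. t \<le> 0 \<Longrightarrow> S t = 0" "\<And>t. t \<ge> 1 \<Longrightarrow> S t = 1"
    and c: "c > 0" and S01: "\<And>t. 0 \<le> S t" "\<And>t. S t \<le> 1"
    using smooth_step_exists by metis
  define e where "e = (\<lambda>n. 1 / real (Suc n))"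
  have e: "0 < e n" "e n \<le> 1" for n by (auto simp: e_def)
  define w where "w = (\<lambda>a n t. bump 0 [:c / e n:] ((t - a) / e n))"
  define \<phi> where "\<phi> = (\<lambda>n t. S ((t - a) / e n) - S ((t - b) / e n))"
  have d: "deriv (\<phi> n) = (\<lambda>t. w a n t - w b n t)" and tf: "test_function (\<phi> n)" for n
    unfolding \<phi>_def w_def using test_function_step[OF S e(1) ab] by auto
  have sub: "{a..b + 1} \<subseteq> {0<..}" using ab by auto
  have gi: "g absolutely_integrable_on {a..b+1}"
    using fg sub unfolding has_distr_deriv_def locally_integrable_def by (meson compact_Icc)
  have fc: "continuous_on {a..b+1} f" using f sub continuous_on_subset by blast
  have Scont: "continuous_on UNIV S"
    using S(1) by (intro DERIV_continuous_on) (auto intro: has_field_derivative_at_within)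
  have \<phi>cont: "continuous_on X (\<phi> n)" for n X
    unfolding \<phi>_def by (intro continuous_intros continuous_on_compose2[OF Scont]) (use e(1)[of n] in auto)
  have wcont: "continuous_on X (w s n)" for s n X
  proof -
    have "continuous_on UNIV (bump 0 [:c/e n:])"
      using bump_DERIV by (intro DERIV_continuous_on) (auto intro: has_field_derivative_at_within)
    then show ?thesis unfolding w_def
      by (rule continuous_on_compose2) (use e(1)[of n] in \<open>auto intro!: continuous_intros\<close>)
  qed
  have S0: "S ((t - s) / e n) = 0" if "t \<le> s" for t s n
    using that e(1)[of n] by (auto intro!: S simp: divide_le_0_iff)
  have S1: "S ((t - s) / e n) = 1" if "t \<ge> s + e n" for t s n
    using that e(1)[of n] by (auto intro!: S)
  have w0: "w s n t = 0" if "t \<le> s \<or> t \<ge> s + 1" for s n t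
    using that e[of n] by (auto simp: w_def bump_def field_simps)
  have L: "(\<integral>t. deriv (\<phi> n) t *\<^sub>R f t \<partial>lebesgue_on {0<..})
     = integral {a..b+1} (\<lambda>t. w a n t *\<^sub>R f t) - integral {a..b+1} (\<lambda>t. w b n t *\<^sub>R f t)" for n
  proof -
    have "(\<integral>t. deriv (\<phi> n) t *\<^sub>R f t \<partial>lebesgue_on {0<..}) = integral {a..b+1} (\<lambda>t. (w a n t - w b n t) *\<^sub>R f t)"
      unfolding d
    proof (rule lebesgue_on_integral_eq_on_Icc)
      show "(\<lambda>t. (w a n t - w b n t) *\<^sub>R f t) absolutely_integrable_on {a..b + 1}"
        by (intro absolutely_integrable_continuous_real continuous_intros wcont fc)
    qed (use sub w0 ab in auto)
    also have "\<dots> = integral {a..b+1} (\<lambda>t. w a n t *\<^sub>R f t - w b n t *\<^sub>R f t)" by (simp add: scaleR_diff_left)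
    also have "\<dots> = integral {a..b+1} (\<lambda>t. w a n t *\<^sub>R f t) - integral {a..b+1} (\<lambda>t. w b n t *\<^sub>R f t)"
      by (intro Henstock_Kurzweil_Integration.integral_diff integrable_continuous_real continuous_intros wcont fc)
    finally show ?thesis .
  qed
  have \<phi>i: "(\<lambda>t. \<phi> n t *\<^sub>R g t) absolutely_integrable_on {a..b+1}" for n
    by (intro absolutely_integrable_continuous_scaleR \<phi>cont gi)
  have R: "(\<integral>t. \<phi> n t *\<^sub>R g t \<partial>lebesgue_on {0<..}) = integral {a..b+1} (\<lambda>t. \<phi> n t *\<^sub>R g t)" for n
  proof (rule lebesgue_on_integral_eq_on_Icc)
    show "\<phi> n t *\<^sub>R g t = 0" if "t \<notin> {a..b+1}" for t
      using that S0[of t a n] S0[of t b n] S1[of a n t] S1[of b n t] e[of n] ab by (cases "t \<le> a") (auto simp: \<phi>_def)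
  qed (use \<phi>i sub in auto)
  have "(\<lambda>n. - integral {a..b+1} (\<lambda>t. \<phi> n t *\<^sub>R g t)) \<longlonglongrightarrow> f a - f b"
  proof -
    have "(\<lambda>n. integral {a..b+1} (\<lambda>t. w a n t *\<^sub>R f t) - integral {a..b+1} (\<lambda>t. w b n t *\<^sub>R f t)) \<longlonglongrightarrow> f a - f b"
      unfolding w_def e_def by (intro tendsto_diff bump_approx_identity[OF S c fc]) (use ab in auto)
    then show ?thesis using fg tf unfolding has_distr_deriv_def by (simp flip: L R)
  qed
  moreover have "(\<lambda>n. integral {a..b+1} (\<lambda>t. \<phi> n t *\<^sub>R g t)) \<longlonglongrightarrow> integral {a..b+1} (\<lambda>t. if t \<in> {a<..b} then g t else 0)"
  proof (rule dominated_convergence)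
    show "(\<lambda>t. \<phi> n t *\<^sub>R g t) integrable_on {a..b + 1}" for n
      using \<phi>i set_lebesgue_integral_eq_integral(1) by blast
    show "(\<lambda>t. norm (g t)) integrable_on {a..b + 1}" using gi absolutely_integrable_on_def by blast
    show "norm (\<phi> n t *\<^sub>R g t) \<le> norm (g t)" for n t
    proof -
      have "\<bar>\<phi> n t\<bar> \<le> 1"
        using S01(1)[of "(t - a) / e n"] S01(2)[of "(t - a) / e n"] S01(1)[of "(t - b) / e n"] S01(2)[of "(t - b) / e n"]
        unfolding \<phi>_def by linarith
      then show ?thesis by (simp add: mult_left_le_one_le)
    qed
    show "(\<lambda>n. \<phi> n t *\<^sub>R g t) \<longlonglongrightarrow> (if t \<in> {a<..b} then g t else 0)" for t
    proof -
      \<comment> \<open>At \<open>t = s\<close> the step is still 0, hence the limit of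
        \<open>\<phi> n\<close> is the indicator of the half-open interval \<open>{a<..b}\<close>;
        the lost endpoint is negligible.\<close>
      have ev: "\<forall>\<^sub>F n in sequentially. S ((t - s) / e n) = (if t \<le> s then 0 else 1)" for s
      proof (cases "t \<le> s")
        case False
        then obtain N where N: "1 / real (Suc N) < t - s"
          using reals_Archimedean[of "t - s"] by (auto simp: inverse_eq_divide)
        have "S ((t - s) / e n) = 1" if "n \<ge> N" for n
        proof -
          have "e n \<le> 1 / real (Suc N)" using that by (simp add: e_def frac_le)
          then show ?thesis using N by (intro S1) auto
        qed
        then show ?thesis using False by (auto simp: eventually_sequentially)
      qed (use S0 in auto)
      have "\<forall>\<^sub>F n in sequentially. \<phi> n t *\<^sub>R g t = (if t \<in> {a<..b} then g t else 0)"
        using ev[of a] ev[of b] by eventually_elim (use ab in \<open>auto simp: \<phi>_def\<close>)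
      then show ?thesis by (rule tendsto_eventually)
    qed
  qed
  ultimately have "f a - f b = - integral {a..b+1} (\<lambda>t. if t \<in> {a<..b} then g t else 0)"
    using LIMSEQ_unique tendsto_minus by blast
  also have "integral {a..b+1} (\<lambda>t. if t \<in> {a<..b} then g t else 0) = integral ({a<..b} \<inter> {a..b+1}) g"
    by (simp add: Henstock_Kurzweil_Integration.integral_restrict_Int[symmetric] Int_commute if_distrib cong: if_cong)
  also have "{a<..b} \<inter> {a..b+1} = {a<..b}" by auto
  also have "integral {a<..b} g = integral {a..b} g"
    by (rule integral_subset_negligible[symmetric, THEN sym]) (auto intro: negligible_subset[of "{a}"])
  finally show ?thesis by (simp add: algebra_simps)
qed

text \<open>Lebesgue differentiation recovers \<open>d x\<close> from integrals over
  \<open>[x, x + h]\<close>. Integrability is known only away from 0, so \<open>d\<close> is cut off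
  below \<open>1 / (n + 1)\<close> and the exceptional null sets are united over
  \<open>n\<close>.\<close>

lemma AE_eq_0_if_integrals_0:
  fixes d :: "real \<Rightarrow> 'b::euclidean_space"
  assumes int: "\<And>a b. 0 < a \<Longrightarrow> a \<le> b \<Longrightarrow> d absolutely_integrable_on {a..b}"
    and zero: "\<And>a b. 0 < a \<Longrightarrow> a \<le> b \<Longrightarrow> integral {a..b} d = 0"
  shows "AE t in lebesgue_on {0..}. d t = 0"
proof -
  have "\<exists>N. negligible N \<and> (\<forall>x. x \<notin> N \<longrightarrow> 1 / real (Suc n) \<le> x \<longrightarrow> d x = 0)" for n
  proof -
    let ?a = "1 / real (Suc n)"
    define f where "f = (\<lambda>x. if x \<ge> ?a then d x else 0)"
    have "f integrable_on {a..b}" for a b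
    proof -
      have "d integrable_on {max ?a a..b}"
        using int[of "max ?a a" b] set_lebesgue_integral_eq_integral(1)
        by (cases "max ?a a \<le> b") (auto simp: less_max_iff_disj integrable_on_empty)
      moreover have "{?a..} \<inter> {a..b} = {max ?a a..b}" by auto
      ultimately show ?thesis unfolding f_def
        using Henstock_Kurzweil_Integration.integrable_restrict_Int[of "{?a..}" d "{a..b}"] by simp
    qed
    then obtain N where "negligible N"
      and N: "\<And>x e. \<lbrakk>x \<notin> N; 0 < e\<rbrakk> \<Longrightarrow>
             \<exists>d>0. \<forall>h. 0 < h \<and> h < d \<longrightarrow> norm (integral (cbox x (x + h *\<^sub>R One)) f /\<^sub>R h ^ DIM(real) - f x) < e"
      using integrable_ccontinuous_explicit[of f] by (auto simp: box_real)
    have "d x = 0" if x: "x \<notin> N" "?a \<le> x" for x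
    proof (rule ccontr)
      assume "d x \<noteq> 0"
      then obtain k where k: "k > 0" "\<And>h. 0 < h \<and> h < k \<Longrightarrow> norm (integral {x..x + h} f /\<^sub>R h - f x) < norm (d x)"
        using N[OF x(1), of "norm (d x)"] by (auto simp: cbox_interval)
      have "integral {x..x + k / 2} f = integral {x..x + k / 2} d"
        using x by (intro Henstock_Kurzweil_Integration.integral_cong) (auto simp: f_def)
      also have "\<dots> = 0"
        using x k(1) by (intro zero) (auto intro: less_le_trans[of 0 ?a])
      finally show False using k(2)[of "k/2"] k(1) x by (simp add: f_def)
    qed
    then show ?thesis using \<open>negligible N\<close> by blast
  qed
  then obtain N where N: "\<And>n. negligible (N n)" "\<And>n x. x \<notin> N n \<Longrightarrow> 1 / real (Suc n) \<le> x \<Longrightarrow> d x = 0"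
    by metis
  have neg: "negligible ({0} \<union> (\<Union>n. N n))" by (intro negligible_Un negligible_countable_Union) (auto intro: N)
  have z: "d x = 0" if "x \<ge> 0" "x \<notin> {0} \<union> (\<Union>n. N n)" for x
  proof -
    have "x > 0" using that by auto
    then obtain n where "1 / real (Suc n) < x" using reals_Archimedean[of x] by (auto simp: inverse_eq_divide)
    then show ?thesis using N(2)[of x n] that by auto
  qed
  have "AE t in lebesgue. t \<notin> {0} \<union> (\<Union>n. N n)"
    using neg by (intro AE_not_in) (simp add: negligible_iff_null_sets)
  then have "AE t in lebesgue. t \<in> {0..} \<longrightarrow> d t = 0"
    by (rule eventually_mono) (use z in auto)
  then show ?thesis by (subst AE_restrict_space_iff) simp_all
qed

text \<open>Completeness of Lebesgue measure. It makes the chosen distributional derivative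
  measurable, and also limits known only almost everywhere.\<close>

lemma borel_measurable_lebesgue_on_AE:
  fixes f g :: "'a::euclidean_space \<Rightarrow> 'b::euclidean_space"
  assumes "f \<in> borel_measurable (lebesgue_on S)" "S \<in> sets lebesgue" "AE t in lebesgue_on S. f t = g t"
  shows "g \<in> borel_measurable (lebesgue_on S)"
proof -
  have "(\<lambda>t. if t \<in> S then f t else 0) \<in> borel_measurable lebesgue"
    using assms(1,2) borel_measurable_if[of S f] by simp
  moreover have "AE t in lebesgue. (if t \<in> S then f t else 0) = (if t \<in> S then g t else 0)"
    using assms(2,3) by (subst (asm) AE_restrict_space_iff) (auto elim: eventually_mono)
  ultimately have "(\<lambda>t. if t \<in> S then g t else 0) \<in> borel_measurable lebesgue"
    by (rule borel_measurable_AE)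
  then show ?thesis using assms(2) borel_measurable_if[of S g] by simp
qed

section \<open>Integration against the weighted measure \<open>mu r\<close>\<close>

lemma space_mu [simp]: "space (mu r) = {0..}" by (simp add: mu_def)
lemma sets_mu [simp, measurable_cong]: "sets (mu r) = sets (lebesgue_on {0..})" by (simp add: mu_def)

lemma exp_measurable_lebesgue_on [measurable]: "(\<lambda>t. exp (- r * t)) \<in> borel_measurable (lebesgue_on S)"
  for r :: real
  by (intro measurable_restrict_space1 measurable_completion) simp

lemma AE_mu_iff: "(AE t in mu r. P t) \<longleftrightarrow> (AE t in lebesgue_on {0..}. P t)"
proof -
  have "(\<lambda>t. ennreal (exp (- r * t))) \<in> borel_measurable (lebesgue_on {0..})" by measurable
  from AE_density[OF this, of P] show ?thesis unfolding mu_def by simp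
qed

lemma integrable_mu_iff:
  fixes f :: "real \<Rightarrow> 'b::euclidean_space"
  assumes "f \<in> borel_measurable (mu r)"
  shows "integrable (mu r) f \<longleftrightarrow> integrable (lebesgue_on {0..}) (\<lambda>t. exp (- r * t) *\<^sub>R f t)"
proof -
  have "f \<in> borel_measurable (lebesgue_on {0..})" using assms by (simp only: measurable_cong_sets[OF sets_mu refl])
  then show ?thesis unfolding mu_def using exp_measurable_lebesgue_on[of r] by (intro integrable_density) auto
qed

lemma nn_integral_mu:
  assumes "f \<in> borel_measurable (mu r)"
  shows "(\<integral>\<^sup>+t. f t \<partial>mu r) = (\<integral>\<^sup>+t. ennreal (exp (- r * t)) * f t \<partial>lebesgue_on {0..})"
proof -
  have "f \<in> borel_measurable (lebesgue_on {0..})" using assms by (simp only: measurable_cong_sets[OF sets_mu refl])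
  then show ?thesis unfolding mu_def using exp_measurable_lebesgue_on[of r] by (intro nn_integral_density) auto
qed

text \<open>By an explicit antiderivative. The case \<open>s = 0\<close> gives the total mass
  \<open>1 / r\<close>; the general tail is the source of the factor \<open>1 / r\<close> in the
  bound for primitives.\<close>

lemma nn_integral_mu_atLeast:
  assumes "r > 0" "s \<ge> 0"
  shows "(\<integral>\<^sup>+t. indicator {s..} t \<partial>mu r) = ennreal (exp (- r * s) / r)"
proof -
  have "(\<integral>\<^sup>+t. indicator {s..} t \<partial>mu r) = (\<integral>\<^sup>+t. ennreal (exp (- r * t)) * indicator {s..} t \<partial>lebesgue_on {0..})"
    by (intro nn_integral_mu borel_measurable_indicator) (use assms in \<open>auto simp: sets_restrict_space_iff\<close>)
  also have "\<dots> = (\<integral>\<^sup>+t. ennreal (exp (- r * t)) * indicator {s..} t \<partial>lebesgue)"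
    using assms by (subst nn_integral_restrict_space) (auto intro!: nn_integral_cong simp: indicator_def)
  also have "\<dots> = (\<integral>\<^sup>+t. ennreal (exp (- r * t)) * indicator {s..} t \<partial>lborel)"
    by (simp add: nn_integral_completion)
  also have "\<dots> = ennreal (0 - (- exp (- r * s) / r))"
  proof (rule nn_integral_FTC_atLeast)
    fix x assume "s \<le> x"
    show "((\<lambda>x. - exp (- r * x) / r) has_real_derivative exp (- r * x)) (at x)"
      using assms by (auto intro!: derivative_eq_intros)
  next
    have "LIM x at_top. - r * x :> at_bot"
      using assms by (simp add: filterlim_uminus_at_bot filterlim_tendsto_pos_mult_at_top[OF tendsto_const _ filterlim_ident])
    then have "((\<lambda>x. exp (- r * x)) \<longlongrightarrow> 0) at_top"
      by (rule filterlim_compose[OF exp_at_bot])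
    then show "((\<lambda>x. - exp (- r * x) / r) \<longlongrightarrow> 0) at_top"
      using tendsto_minus[OF tendsto_divide[OF _ tendsto_const[of r]]] assms by fastforce
  qed auto
  finally show ?thesis by simp
qed

lemma finite_measure_mu: "r > 0 \<Longrightarrow> finite_measure (mu r)"
proof (rule finite_measureI)
  assume "r > 0"
  have "emeasure (mu r) (space (mu r)) = (\<integral>\<^sup>+t. indicator {0..} t \<partial>mu r)"
    by (subst nn_integral_indicator) (auto simp: sets_restrict_space_iff)
  then show "emeasure (mu r) (space (mu r)) \<noteq> \<infinity>" using nn_integral_mu_atLeast[of r 0] \<open>r > 0\<close> by simp
qed

lemma continuous_on_measurable_mu:
  fixes f :: "real \<Rightarrow> 'b::euclidean_space"
  shows "continuous_on {0..} f \<Longrightarrow> f \<in> borel_measurable (mu r)"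
  by (subst measurable_cong_sets[OF sets_mu refl]) (simp add: continuous_imp_measurable_on_sets_lebesgue)

text \<open>On a bounded interval the weight stays away from 0, so unweighted integrability follows;
  the factor \<open>exp (r * t)\<close> undoes the weight exactly.\<close>

lemma set_integrable_mu_imp:
  fixes g :: "real \<Rightarrow> 'b::euclidean_space"
  assumes "integrable (mu r) g" "0 \<le> a" 
  shows "g absolutely_integrable_on {a..b}"
    and "integral {a..b} (\<lambda>t. norm (g t)) = (\<integral>t. indicator {a..b} t * (exp (r * t) * norm (g t)) \<partial>mu r)"
    and "integrable (mu r) (\<lambda>t. indicator {a..b} t * (exp (r * t) * norm (g t)))"
proof -
  have m [measurable]: "g \<in> borel_measurable (lebesgue_on {0..})"
    using borel_measurable_integrable[OF assms(1)] by (simp only: measurable_cong_sets[OF sets_mu refl])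
  have gm [measurable]: "g \<in> borel_measurable (mu r)" using assms(1) by auto
  have em [measurable]: "(\<lambda>t. exp (r * t)) \<in> borel_measurable (lebesgue_on {0..})"
    using exp_measurable_lebesgue_on[of "-r"] by simp
  have im [measurable]: "{a..b} \<inter> {0..} \<in> sets (lebesgue_on {0..})" by (simp add: sets_restrict_space_iff)
  have [measurable]: "(\<lambda>t. indicator {a..b} t :: real) \<in> borel_measurable (lebesgue_on {0..})"
    by (intro measurable_restrict_space1 borel_measurable_indicator) simp
  have gexp: "integrable (lebesgue_on {0..}) (\<lambda>t. exp (- r * t) *\<^sub>R g t)"
    using assms(1) integrable_mu_iff[OF gm] by simp
  have i1: "integrable (lebesgue_on {0..}) (\<lambda>t. indicator {a..b} t *\<^sub>R g t)"
  proof (rule Bochner_Integration.integrable_bound)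
    \<comment> \<open>The constant bounds \<open>exp (r * t)\<close> on \<open>{a..b}\<close> for
      either sign of \<open>r\<close>.\<close>
    show "integrable (lebesgue_on {0..}) (\<lambda>t. exp (\<bar>r\<bar> * \<bar>b\<bar>) *\<^sub>R (exp (- r * t) *\<^sub>R g t))"
      using gexp by (rule integrable_scaleR_right)
    have "norm (indicator {a..b} t *\<^sub>R g t) \<le> norm (exp (\<bar>r\<bar> * \<bar>b\<bar>) *\<^sub>R (exp (- r * t) *\<^sub>R g t))" for t
    proof (cases "t \<in> {a..b}")
      case True
      then have "r * t \<le> \<bar>r\<bar> * \<bar>b\<bar>" using assms(2) by (intro mult_mono) (auto intro: order_trans)
      then have "1 \<le> exp (\<bar>r\<bar> * \<bar>b\<bar>) * exp (- r * t)" by (simp flip: exp_add)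
      then have "1 * norm (g t) \<le> (exp (\<bar>r\<bar> * \<bar>b\<bar>) * exp (- r * t)) * norm (g t)" by (intro mult_right_mono) auto
      then show ?thesis using True by (simp add: mult.assoc)
    qed simp
    then show "AE t in lebesgue_on {0..}. norm (indicator {a..b} t *\<^sub>R g t) \<le> norm (exp (\<bar>r\<bar> * \<bar>b\<bar>) *\<^sub>R (exp (- r * t) *\<^sub>R g t))"
      by simp
  qed measurable
  have eq: "(indicator {0..} t * indicator {a..b} t) *\<^sub>R g t = indicator {a..b} t *\<^sub>R g t" for t
    using assms(2) by (auto simp: indicator_def)
  show ab: "g absolutely_integrable_on {a..b}"
    using i1 by (simp add: integrable_restrict_space set_integrable_def eq)
  have c: "exp (- r * t) *\<^sub>R (indicator {a..b} t * (exp (r * t) * norm (g t))) = indicator {a..b} t * norm (g t)" for t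
    by (simp add: exp_minus)
  have i2: "integrable (lebesgue_on {0..}) (\<lambda>t. indicator {a..b} t * norm (g t))"
    using integrable_norm[OF i1] by simp
  show "integrable (mu r) (\<lambda>t. indicator {a..b} t * (exp (r * t) * norm (g t)))"
  proof (subst integrable_mu_iff)
    have [measurable]: "(\<lambda>t. exp (r * t)) \<in> borel_measurable (mu r)"
      by (intro continuous_on_measurable_mu continuous_intros)
    have [measurable]: "(\<lambda>t. indicator {a..b} t :: real) \<in> borel_measurable (mu r)"
      using assms(2) by (intro borel_measurable_indicator) (auto simp: sets_restrict_space_iff)
    show "(\<lambda>t. indicator {a..b} t * (exp (r * t) * norm (g t))) \<in> borel_measurable (mu r)"
      by measurable
  qed (simp only: c i2)
  have "(\<integral>t. indicator {a..b} t * (exp (r * t) * norm (g t)) \<partial>mu r)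
     = (\<integral>t. exp (- r * t) *\<^sub>R (indicator {a..b} t * (exp (r * t) * norm (g t))) \<partial>lebesgue_on {0..})"
    unfolding mu_def
  proof (rule integral_density)
    show "(\<lambda>t. indicator {a..b} t * (exp (r * t) * norm (g t))) \<in> borel_measurable (lebesgue_on {0..})" by measurable
    show "(\<lambda>t. exp (- r * t)) \<in> borel_measurable (lebesgue_on {0..})" by (rule exp_measurable_lebesgue_on)
  qed simp
  also have "\<dots> = (\<integral>t. indicator {a..b} t * norm (g t) \<partial>lebesgue_on {0..})" by (simp only: c)
  also have "\<dots> = integral {a..b} (\<lambda>t. indicator {a..b} t * norm (g t))"
    using ab assms(2)
    by (intro lebesgue_on_integral_eq_on_Icc)
       (auto intro!: set_integrable_cong[THEN iffD2, OF refl refl _ set_integrable_norm[OF ab]])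
  also have "\<dots> = integral {a..b} (\<lambda>t. norm (g t))"
    by (intro Henstock_Kurzweil_Integration.integral_cong) auto
  finally show "integral {a..b} (\<lambda>t. norm (g t)) = (\<integral>t. indicator {a..b} t * (exp (r * t) * norm (g t)) \<partial>mu r)" ..
qed

lemma continuous_on_atLeast_0I:
  fixes f :: "real \<Rightarrow> 'b::topological_space"
  assumes "\<And>b. continuous_on {0..b} f"
  shows "continuous_on {0..} f"
  unfolding continuous_on_eq_continuous_within
proof
  fix x :: real assume "x \<in> {0..}"
  then have "continuous (at x within {0..x+1}) f" 
    using assms[of "x+1"] unfolding continuous_on_eq_continuous_within by simp
  moreover have "at x within {0..x+1} = at x within {0..}"
    by (rule at_within_nhd[of x "{..<x+1}"]) auto
  ultimately show "continuous (at x within {0..}) f" by simp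
qed

lemma continuous_on_integral_mu:
  fixes g :: "real \<Rightarrow> 'b::euclidean_space"
  assumes "integrable (mu r) g"
  shows "continuous_on {0..} (\<lambda>t. integral {0..t} g)"
  using set_integrable_mu_imp(1)[OF assms, of 0]
  by (intro continuous_on_atLeast_0I indefinite_integral_continuous_1 set_lebesgue_integral_eq_integral(1)) simp

lemma id_measurable_mu [measurable]: "(\<lambda>x. x) \<in> borel_measurable (mu r)"
  by (simp add: continuous_on_measurable_mu)

text \<open>Fubini on the triangle \<open>s \<le> t\<close>: the factor \<open>exp (r * s)\<close>
  turns the unweighted inner integral into one against \<open>mu r\<close>, and then cancels against
  the tail mass \<open>exp (- r * s) / r\<close>.\<close>

lemma L1_primitive:
  fixes g :: "real \<Rightarrow> 'b::euclidean_space"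
  assumes r: "r > 0" and g: "integrable (mu r) g"
  shows "integrable (mu r) (\<lambda>t. integral {0..t} g)"
    and "(\<integral>t. norm (integral {0..t} g) \<partial>mu r) \<le> (\<integral>t. norm (g t) \<partial>mu r) / r"
proof -
  interpret M: finite_measure "mu r" by (rule finite_measure_mu[OF r])
  interpret pair_sigma_finite "mu r" "mu r" ..
  have gm [measurable]: "g \<in> borel_measurable (mu r)" using g by auto
  have em [measurable]: "(\<lambda>t. exp (r * t)) \<in> borel_measurable (mu r)"
    by (intro continuous_on_measurable_mu continuous_intros)
  define F where "F = (\<lambda>(t, s). if 0 \<le> s \<and> s \<le> t then ennreal (exp (r * s) * norm (g s)) else 0)"
  have Fm: "F \<in> borel_measurable (mu r \<Otimes>\<^sub>M mu r)"
    unfolding F_def by measurable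
  have cont: "(\<lambda>t. integral {0..t} g) \<in> borel_measurable (mu r)"
    by (intro continuous_on_measurable_mu continuous_on_integral_mu[OF g])
  have "(\<integral>\<^sup>+t. ennreal (norm (integral {0..t} g)) \<partial>mu r) \<le> (\<integral>\<^sup>+t. (\<integral>\<^sup>+s. F (t, s) \<partial>mu r) \<partial>mu r)"
  proof (intro nn_integral_mono)
    fix t
    have "norm (integral {0..t} g) \<le> integral {0..t} (\<lambda>s. norm (g s))"
      using set_integrable_mu_imp(1)[OF g, of 0 t]
      by (intro integral_norm_bound_integral) (auto simp: absolutely_integrable_on_def)
    also have "\<dots> = (\<integral>s. indicator {0..t} s * (exp (r * s) * norm (g s)) \<partial>mu r)"
      by (rule set_integrable_mu_imp(2)[OF g]) simp
    finally have "ennreal (norm (integral {0..t} g)) \<le> ennreal (\<integral>s. indicator {0..t} s * (exp (r * s) * norm (g s)) \<partial>mu r)"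
      by (rule ennreal_leI)
    also have "\<dots> = (\<integral>\<^sup>+s. ennreal (indicator {0..t} s * (exp (r * s) * norm (g s))) \<partial>mu r)"
      by (rule nn_integral_eq_integral[symmetric]) (use set_integrable_mu_imp(3)[OF g] in auto)
    also have "\<dots> = (\<integral>\<^sup>+s. F (t, s) \<partial>mu r)"
      by (intro nn_integral_cong) (auto simp: F_def indicator_def)
    finally show "ennreal (norm (integral {0..t} g)) \<le> (\<integral>\<^sup>+s. F (t, s) \<partial>mu r)" .
  qed
  also have "\<dots> = (\<integral>\<^sup>+s. (\<integral>\<^sup>+t. F (t, s) \<partial>mu r) \<partial>mu r)"
    using Fubini[OF Fm] by simp
  also have "\<dots> = (\<integral>\<^sup>+s. ennreal (norm (g s) / r) \<partial>mu r)"
  proof (intro nn_integral_cong)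
    fix s assume "s \<in> space (mu r)"
    then have s: "s \<ge> 0" by simp
    have "(\<integral>\<^sup>+t. F (t, s) \<partial>mu r) = (\<integral>\<^sup>+t. ennreal (exp (r * s) * norm (g s)) * indicator {s..} t \<partial>mu r)"
      by (intro nn_integral_cong) (use s in \<open>auto simp: F_def indicator_def\<close>)
    also have "\<dots> = ennreal (exp (r * s) * norm (g s)) * (\<integral>\<^sup>+t. indicator {s..} t \<partial>mu r)"
      using s by (intro nn_integral_cmult borel_measurable_indicator) (auto simp: sets_restrict_space_iff)
    also have "\<dots> = ennreal (exp (r * s) * norm (g s)) * ennreal (exp (- r * s) / r)"
      by (simp only: nn_integral_mu_atLeast[OF r s])
    also have "\<dots> = ennreal (norm (g s) / r)"
      using r by (simp add: ennreal_mult[symmetric] exp_minus field_simps)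
    finally show "(\<integral>\<^sup>+t. F (t, s) \<partial>mu r) = ennreal (norm (g s) / r)" .
  qed
  also have "\<dots> = ennreal ((\<integral>t. norm (g t) \<partial>mu r) / r)"
    using g r by (subst nn_integral_eq_integral) auto
  finally have *: "(\<integral>\<^sup>+t. ennreal (norm (integral {0..t} g)) \<partial>mu r) \<le> ennreal ((\<integral>t. norm (g t) \<partial>mu r) / r)" .
  then show i: "integrable (mu r) (\<lambda>t. integral {0..t} g)"
    using cont by (intro integrableI_bounded) (auto intro: le_less_trans)
  show "(\<integral>t. norm (integral {0..t} g) \<partial>mu r) \<le> (\<integral>t. norm (g t) \<partial>mu r) / r"
    using * r by (subst (asm) nn_integral_eq_integral) (auto intro!: integrable_norm i)
qed

text \<open>Since \<open>g\<close> is merely integrable, the formula comes from Fubini on the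
  triangle \<open>s \<le> t\<close> instead of a product rule. It becomes the usual integration by
  parts when \<open>\<phi> b = 0\<close>.\<close>

lemma integral_by_parts_indefinite:
  fixes g :: "real \<Rightarrow> 'b::euclidean_space" and \<phi> \<phi>' :: "real \<Rightarrow> real"
  assumes g: "g absolutely_integrable_on {0..b}"
    and \<phi>: "\<And>t. (\<phi> has_real_derivative \<phi>' t) (at t)" and cont: "continuous_on {0..b} \<phi>'"
  shows "integral {0..b} (\<lambda>t. \<phi>' t *\<^sub>R integral {0..t} g) = integral {0..b} (\<lambda>s. (\<phi> b - \<phi> s) *\<^sub>R g s)"
proof -
  let ?N = "lebesgue_on {0..b}"
  interpret N: finite_measure ?N by (rule finite_measure_lebesgue_on) simp
  interpret pair_sigma_finite ?N ?N ..
  have gi: "integrable ?N g"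
    using g by (rule lebesgue_on_integral_eq_on_Icc) auto
  then have gm [measurable]: "g \<in> borel_measurable ?N" by auto
  have [measurable]: "\<phi>' \<in> borel_measurable ?N"
    by (rule continuous_imp_measurable_on_sets_lebesgue[OF cont]) simp
  have idm [measurable]: "(\<lambda>x. x) \<in> borel_measurable ?N"
    by (rule continuous_imp_measurable_on_sets_lebesgue) auto
  have "bounded (\<phi>' ` {0..b})" by (intro compact_imp_bounded compact_continuous_image cont compact_Icc)
  then obtain C where C: "C > 0" "\<And>t. t \<in> {0..b} \<Longrightarrow> \<bar>\<phi>' t\<bar> \<le> C" unfolding bounded_pos by auto
  define F where "F = (\<lambda>t s. (if s \<le> t then \<phi>' t else 0) *\<^sub>R g s)"
  \<comment> \<open>The dominating function does not depend on \<open>t\<close>, so it is integrable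
    on the product because the interval has finite measure.\<close>
  have "integrable (?N \<Otimes>\<^sub>M ?N) (\<lambda>(t, s). g s)"
    by (rule Fubini_integrable) (use gi in auto)
  then have "integrable (?N \<Otimes>\<^sub>M ?N) (\<lambda>x. C *\<^sub>R (case x of (t, s) \<Rightarrow> g s))" by (rule integrable_scaleR_right)
  then have Fi: "integrable (?N \<Otimes>\<^sub>M ?N) (\<lambda>(t, s). F t s)"
  proof (rule Bochner_Integration.integrable_bound)
    show "(\<lambda>(t, s). F t s) \<in> borel_measurable (?N \<Otimes>\<^sub>M ?N)" unfolding F_def by measurable
    show "AE x in ?N \<Otimes>\<^sub>M ?N. norm (case x of (t, s) \<Rightarrow> F t s) \<le> norm (C *\<^sub>R (case x of (t, s) \<Rightarrow> g s))"
      using C by (intro AE_I2) (auto simp: F_def space_pair_measure intro!: mult_right_mono)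
  qed
  have 1: "(\<integral>s. F t s \<partial>?N) = \<phi>' t *\<^sub>R integral {0..t} g" if t: "t \<in> {0..b}" for t
  proof -
    have "(\<integral>s. F t s \<partial>?N) = \<phi>' t *\<^sub>R (\<integral>s. indicator {..t} s *\<^sub>R g s \<partial>?N)"
      unfolding F_def by (subst integral_scaleR_right[symmetric]) (auto simp: indicator_def intro!: Bochner_Integration.integral_cong)
    also have "(\<integral>s. indicator {..t} s *\<^sub>R g s \<partial>?N) = integral {0..t} (\<lambda>s. indicator {..t} s *\<^sub>R g s)"
    proof (rule lebesgue_on_integral_eq_on_Icc)
      have "g absolutely_integrable_on {0..t}" using g t by (intro set_integrable_subset[OF g]) auto
      then show "(\<lambda>s. indicator {..t} s *\<^sub>R g s) absolutely_integrable_on {0..t}"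
        by (rule set_integrable_cong[THEN iffD1, rotated -1]) auto
    qed (use t in auto)
    also have "\<dots> = integral {0..t} g" by (intro Henstock_Kurzweil_Integration.integral_cong) auto
    finally show ?thesis .
  qed
  have 2: "(\<integral>t. F t s \<partial>?N) = (\<phi> b - \<phi> s) *\<^sub>R g s" if s: "s \<in> {0..b}" for s
  proof -
    have I: "(\<phi>' has_integral (\<phi> b - \<phi> s)) {s..b}"
      using s by (intro fundamental_theorem_of_calculus)
        (auto simp: has_real_derivative_iff_has_vector_derivative[symmetric] intro: \<phi> has_field_derivative_at_within)
    have "\<phi>' absolutely_integrable_on {s..b}"
      using s by (intro absolutely_integrable_continuous_real continuous_on_subset[OF cont]) auto
    then have "(\<lambda>t. indicator {s..} t * \<phi>' t) absolutely_integrable_on {s..b}"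
      by (rule set_integrable_cong[THEN iffD1, rotated -1]) auto
    then have iabs: "integrable ?N (\<lambda>t. indicator {s..} t * \<phi>' t)"
        "(\<integral>t. indicator {s..} t * \<phi>' t \<partial>?N) = integral {s..b} (\<lambda>t. indicator {s..} t * \<phi>' t)"
      by (rule lebesgue_on_integral_eq_on_Icc; use s in auto)+
    have "(\<integral>t. F t s \<partial>?N) = (\<integral>t. (indicator {s..} t * \<phi>' t) *\<^sub>R g s \<partial>?N)"
      unfolding F_def by (intro Bochner_Integration.integral_cong) (auto simp: indicator_def)
    also have "\<dots> = (\<integral>t. indicator {s..} t * \<phi>' t \<partial>?N) *\<^sub>R g s"
      by (intro integral_scaleR_left iabs(1))
    also have "(\<integral>t. indicator {s..} t * \<phi>' t \<partial>?N) = integral {s..b} (\<lambda>t. indicator {s..} t * \<phi>' t)"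
      by (rule iabs(2))
    also have "\<dots> = integral {s..b} \<phi>'" by (intro Henstock_Kurzweil_Integration.integral_cong) auto
    finally show ?thesis using integral_unique[OF I] by simp
  qed
  have \<phi>c: "continuous_on {0..b} \<phi>"
    using \<phi> by (meson DERIV_continuous_on has_field_derivative_at_within)
  have gabs: "(\<lambda>s. (\<phi> b - \<phi> s) *\<^sub>R g s) absolutely_integrable_on {0..b}"
    by (intro absolutely_integrable_continuous_scaleR continuous_intros g \<phi>c)
  have Gabs: "(\<lambda>t. \<phi>' t *\<^sub>R integral {0..t} g) absolutely_integrable_on {0..b}"
    by (intro absolutely_integrable_continuous_real continuous_intros cont indefinite_integral_continuous_1)
       (use g set_lebesgue_integral_eq_integral(1) in blast)
  have "integral {0..b} (\<lambda>t. \<phi>' t *\<^sub>R integral {0..t} g) = (\<integral>t. \<phi>' t *\<^sub>R integral {0..t} g \<partial>?N)"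
    by (rule lebesgue_on_integral_eq_on_Icc(2)[symmetric, OF Gabs]) auto
  also have "\<dots> = (\<integral>t. (\<integral>s. F t s \<partial>?N) \<partial>?N)"
    by (intro Bochner_Integration.integral_cong refl) (simp add: 1)
  also have "\<dots> = (\<integral>s. (\<integral>t. F t s \<partial>?N) \<partial>?N)"
    by (rule Fubini_integral[symmetric, OF Fi])
  also have "\<dots> = (\<integral>s. (\<phi> b - \<phi> s) *\<^sub>R g s \<partial>?N)"
    by (intro Bochner_Integration.integral_cong refl) (simp add: 2)
  also have "\<dots> = integral {0..b} (\<lambda>s. (\<phi> b - \<phi> s) *\<^sub>R g s)"
    by (rule lebesgue_on_integral_eq_on_Icc(2)[OF gabs]) auto
  finally show ?thesis .
qed

section \<open>Primitives of functions in \<open>L1\<close> and distributional derivatives\<close>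

lemma test_functionE:
  assumes "test_function \<phi>"
  obtains a b where "0 < a" "a \<le> b" "\<And>t. t \<notin> {a..b} \<Longrightarrow> \<phi> t = 0" "\<And>t. t \<notin> {a..b} \<Longrightarrow> deriv \<phi> t = 0"
    "\<And>t. (\<phi> has_real_derivative deriv \<phi> t) (at t)" "continuous_on UNIV (deriv \<phi>)"
proof -
  let ?K = "closure {t. \<phi> t \<noteq> 0}"
  have diff: "(deriv ^^ k) \<phi> differentiable_on UNIV" for k using assms unfolding test_function_def by blast
  have K: "compact ?K" "?K \<subseteq> {0<..}" using assms unfolding test_function_def by auto
  have D: "(\<phi> has_real_derivative deriv \<phi> t) (at t)" for t
    using diff[of 0] by (simp add: differentiable_on_def field_differentiable_derivI real_differentiable_def field_differentiable_def DERIV_deriv_iff_real_differentiable)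
  have c: "continuous_on UNIV (deriv \<phi>)"
    using diff[of 1] by (simp add: differentiable_imp_continuous_on)
  obtain a b where ab: "0 < a" "a \<le> b" "?K \<subseteq> {a..b}"
  proof (cases "?K = {}")
    case True then show ?thesis using that[of 1 1] by auto
  next
    case False
    obtain a where "a \<in> ?K" "\<And>x. x \<in> ?K \<Longrightarrow> a \<le> x" using compact_attains_inf[OF K(1) False] by blast
    moreover obtain b where "b \<in> ?K" "\<And>x. x \<in> ?K \<Longrightarrow> x \<le> b" using compact_attains_sup[OF K(1) False] by blast
    ultimately show ?thesis using K(2) by (intro that[of a b]) auto
  qed
  have z: "\<phi> t = 0" if "t \<notin> {a..b}" for t
  proof (rule ccontr)
    assume "\<phi> t \<noteq> 0"
    then have "t \<in> ?K" using closure_subset by fastforce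
    then show False using ab that by auto
  qed
  have "deriv \<phi> t = 0" if "t \<notin> {a..b}" for t
  proof -
    have "((\<lambda>_. 0) has_real_derivative 0) (at t)" by simp
    then have "(\<phi> has_real_derivative 0) (at t)"
      by (rule has_field_derivative_transform_within_open[where S="- {a..b}"]) (use that z in auto)
    then show ?thesis by (rule DERIV_imp_deriv)
  qed
  then show thesis using that[OF ab(1,2)] z D c by blast
qed

text \<open>The working form of \<open>W11\<close>. The derivative is an explicit argument, so the
  choice inside \<open>distr_deriv\<close> has to be dealt with only in a few conversion
  lemmas.\<close>

definition primitive :: "real \<Rightarrow> (real \<Rightarrow> 'b::euclidean_space) \<Rightarrow> (real \<Rightarrow> 'b) \<Rightarrow> bool" where
  "primitive r f g \<longleftrightarrow> integrable (mu r) g \<and> (\<forall>t\<ge>0. f t = f 0 + integral {0..t} g)"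

lemma primitive_integrable: "primitive r f g \<Longrightarrow> integrable (mu r) g" unfolding primitive_def by blast

lemma primitive_eq: "primitive r f g \<Longrightarrow> t \<ge> 0 \<Longrightarrow> f t = f 0 + integral {0..t} g" unfolding primitive_def by blast

lemma primitive_integrable_on:
  "primitive r f g \<Longrightarrow> 0 \<le> a \<Longrightarrow> g integrable_on {a..b}"
  using set_integrable_mu_imp(1)[OF primitive_integrable] set_lebesgue_integral_eq_integral(1) by blast

lemma primitive_scaleR:
  assumes "primitive r f g" shows "primitive r (\<lambda>t. c *\<^sub>R f t) (\<lambda>t. c *\<^sub>R g t)"
  unfolding primitive_def
proof (intro conjI allI impI)
  fix t :: real assume "t \<ge> 0"
  then show "c *\<^sub>R f t = c *\<^sub>R f 0 + integral {0..t} (\<lambda>t. c *\<^sub>R g t)"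
    unfolding integral_cmul scaleR_add_right[symmetric] by (intro arg_cong[where f="(*\<^sub>R) c"] primitive_eq[OF assms])
qed (intro integrable_scaleR_right primitive_integrable[OF assms])

lemma primitive_add:
  assumes "primitive r f g" "primitive r f' g'"
  shows "primitive r (\<lambda>t. f t + f' t) (\<lambda>t. g t + g' t)"
  unfolding primitive_def
proof (intro conjI allI impI)
  fix t :: real assume t: "t \<ge> 0"
  have "f t + f' t = (f 0 + integral {0..t} g) + (f' 0 + integral {0..t} g')"
    by (rule arg_cong2[OF primitive_eq[OF assms(1) t] primitive_eq[OF assms(2) t]])
  also have "\<dots> = f 0 + f' 0 + (integral {0..t} g + integral {0..t} g')" by (simp only: ac_simps)
  also have "integral {0..t} g + integral {0..t} g' = integral {0..t} (\<lambda>t. g t + g' t)"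
    by (intro Henstock_Kurzweil_Integration.integral_add[symmetric] primitive_integrable_on[OF assms(1)] primitive_integrable_on[OF assms(2)]) auto
  finally show "f t + f' t = f 0 + f' 0 + integral {0..t} (\<lambda>t. g t + g' t)" .
qed (intro Bochner_Integration.integrable_add primitive_integrable[OF assms(1)] primitive_integrable[OF assms(2)])

lemma primitive_diff:
  assumes "primitive r f g" "primitive r f' g'"
  shows "primitive r (\<lambda>t. f t - f' t) (\<lambda>t. g t - g' t)"
  using primitive_add[OF assms(1) primitive_scaleR[OF assms(2), of "-1"]] by (simp only: scaleR_minus1_left add_uminus_conv_diff)

lemma primitive_continuous:
  assumes "primitive r f g" shows "continuous_on {0..} f"
proof -
  have "continuous_on {0..} (\<lambda>t. f 0 + integral {0..t} g)"
    by (intro continuous_intros continuous_on_integral_mu[OF primitive_integrable[OF assms]])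
  then show ?thesis
    by (rule continuous_on_eq) (intro primitive_eq[OF assms, symmetric], simp)
qed

lemma primitive_L1:
  assumes r: "r > 0" and p: "primitive r f g"
  shows "integrable (mu r) f"
    and "(\<integral>t. norm (f t - f 0) \<partial>mu r) \<le> (\<integral>t. norm (g t) \<partial>mu r) / r"
proof -
  interpret finite_measure "mu r" by (rule finite_measure_mu[OF r])
  note G = L1_primitive[OF r primitive_integrable[OF p]]
  have "integrable (mu r) (\<lambda>t. f 0 + integral {0..t} g)" using G(1) by simp
  also have "?this \<longleftrightarrow> integrable (mu r) f"
    by (intro Bochner_Integration.integrable_cong refl primitive_eq[OF p, symmetric]) simp
  finally show "integrable (mu r) f" .
  have "(\<integral>t. norm (f t - f 0) \<partial>mu r) = (\<integral>t. norm (integral {0..t} g) \<partial>mu r)"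
  proof (intro Bochner_Integration.integral_cong refl)
    fix t assume "t \<in> space (mu r)"
    then have "f t = f 0 + integral {0..t} g" by (intro primitive_eq[OF p]) simp
    then show "norm (f t - f 0) = norm (integral {0..t} g)" by (metis add_diff_cancel_left')
  qed
  then show "(\<integral>t. norm (f t - f 0) \<partial>mu r) \<le> (\<integral>t. norm (g t) \<partial>mu r) / r" using G(2) by simp
qed

lemma measure_mu: "r > 0 \<Longrightarrow> measure (mu r) {0..} = 1 / r"
  using nn_integral_mu_atLeast[of r 0] by (simp add: measure_def sets_restrict_space_iff)

text \<open>Evaluation at 0 is continuous for the \<open>W11\<close> norm: average the constant
  \<open>norm (f 0)\<close> over \<open>mu r\<close>, whose mass is \<open>1 / r\<close>, and bound
  the deviation \<open>f t - f 0\<close> by the derivative.\<close>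

lemma primitive_norm_0:
  assumes r: "r > 0" and p: "primitive r f g"
  shows "norm (f 0) \<le> r * (\<integral>t. norm (f t) \<partial>mu r) + (\<integral>t. norm (g t) \<partial>mu r)"
proof -
  interpret finite_measure "mu r" by (rule finite_measure_mu[OF r])
  note f = primitive_L1[OF r p]
  have "norm (f 0) / r = (\<integral>t. norm (f 0) \<partial>mu r)" using measure_mu[OF r] by simp
  also have "\<dots> \<le> (\<integral>t. norm (f t) + norm (f t - f 0) \<partial>mu r)"
    using f(1) by (intro integral_mono) (auto intro: norm_triangle_sub[of "f 0", simplified norm_minus_commute])
  also have "\<dots> = (\<integral>t. norm (f t) \<partial>mu r) + (\<integral>t. norm (f t - f 0) \<partial>mu r)" using f(1) by simp
  also have "\<dots> \<le> (\<integral>t. norm (f t) \<partial>mu r) + (\<integral>t. norm (g t) \<partial>mu r) / r" using f(2) by simp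
  finally show ?thesis using r by (simp add: field_simps)
qed

lemma integrable_mu_imp_locally_integrable:
  fixes g :: "real \<Rightarrow> real ^ 'n"
  assumes "integrable (mu r) g"
  shows "locally_integrable g"
  unfolding locally_integrable_def
proof safe
  fix K :: "real set" assume K: "compact K" "K \<subseteq> {0<..}"
  obtain B where "\<And>x. x \<in> K \<Longrightarrow> \<bar>x\<bar> \<le> B" using compact_imp_bounded[OF K(1)] unfolding bounded_iff by auto
  then have "K \<subseteq> {0..B}" using K(2) by fastforce
  then show "g absolutely_integrable_on K"
    by (intro set_integrable_subset[OF set_integrable_mu_imp(1)[OF assms]] fmeasurableD lmeasurable_compact[OF K(1)]) simp_all
qed

text \<open>Integration by parts on \<open>{0..b + 1}\<close>, at whose endpoints the test function
  vanishes. The constant \<open>f 0\<close> drops out because \<open>deriv \<phi>\<close> has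
  integral 0.\<close>

lemma primitive_has_distr_deriv:
  fixes f g :: "real \<Rightarrow> real ^ 'n"
  assumes r: "r > 0" and p: "primitive r f g"
  shows "has_distr_deriv f g"
  unfolding has_distr_deriv_def
proof (intro conjI allI impI)
  show "locally_integrable f" by (rule integrable_mu_imp_locally_integrable[OF primitive_L1(1)[OF r p]])
  show "locally_integrable g" by (rule integrable_mu_imp_locally_integrable[OF primitive_integrable[OF p]])
  fix \<phi> assume "test_function \<phi>"
  then obtain a b where ab: "0 < a" "a \<le> b" and z: "\<And>t. t \<notin> {a..b} \<Longrightarrow> \<phi> t = 0" "\<And>t. t \<notin> {a..b} \<Longrightarrow> deriv \<phi> t = 0"
    and D: "\<And>t. (\<phi> has_real_derivative deriv \<phi> t) (at t)" and c: "continuous_on UNIV (deriv \<phi>)"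
    using test_functionE by metis
  have \<phi>c: "continuous_on X \<phi>" for X using D by (meson DERIV_continuous_on has_field_derivative_at_within)
  have dc: "continuous_on X (deriv \<phi>)" for X using c continuous_on_subset by blast
  have fc: "continuous_on {0..b+1} f" using primitive_continuous[OF p] continuous_on_subset by fastforce
  have ga: "g absolutely_integrable_on {0..b+1}" by (rule set_integrable_mu_imp(1)[OF primitive_integrable[OF p]]) simp
  have ext: "(\<integral>t. \<psi> t *\<^sub>R h t \<partial>lebesgue_on {0<..}) = integral {0..b+1} (\<lambda>t. \<psi> t *\<^sub>R h t)"
    if "(\<lambda>t. \<psi> t *\<^sub>R h t) absolutely_integrable_on {0..b+1}" "\<And>t. t \<notin> {a..b} \<Longrightarrow> \<psi> t = 0" for \<psi> and h :: "real \<Rightarrow> real ^ 'n"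
  proof -
    have "(\<integral>t. \<psi> t *\<^sub>R h t \<partial>lebesgue_on {0<..}) = integral {a..b+1} (\<lambda>t. \<psi> t *\<^sub>R h t)"
      using ab that by (intro lebesgue_on_integral_eq_on_Icc set_integrable_subset[OF that(1)]) auto
    also have "\<dots> = integral {0..b+1} (\<lambda>t. if t \<in> {a..b+1} then \<psi> t *\<^sub>R h t else 0)"
      using ab by (subst Henstock_Kurzweil_Integration.integral_restrict_Int) (simp add: Int_absorb2)
    also have "\<dots> = integral {0..b+1} (\<lambda>t. \<psi> t *\<^sub>R h t)"
      by (intro Henstock_Kurzweil_Integration.integral_cong) (use that(2) in auto)
    finally show ?thesis .
  qed
  have I1: "(deriv \<phi> has_integral 0) {0..b+1}"
  proof -
    have "(deriv \<phi> has_integral (\<phi> (b+1) - \<phi> 0)) {0..b+1}"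
      using ab by (intro fundamental_theorem_of_calculus)
        (auto simp: has_real_derivative_iff_has_vector_derivative[symmetric] intro: D has_field_derivative_at_within)
    then show ?thesis using z(1)[of "b+1"] z(1)[of 0] ab by simp
  qed
  have "(\<integral>t. deriv \<phi> t *\<^sub>R f t \<partial>lebesgue_on {0<..}) = integral {0..b+1} (\<lambda>t. deriv \<phi> t *\<^sub>R f t)"
    by (intro ext absolutely_integrable_continuous_real continuous_intros dc fc z(2))
  also have "\<dots> = integral {0..b+1} (\<lambda>t. deriv \<phi> t *\<^sub>R f 0 + deriv \<phi> t *\<^sub>R integral {0..t} g)"
  proof (intro Henstock_Kurzweil_Integration.integral_cong)
    fix t assume "t \<in> {0..b+1}"
    then have "f t = f 0 + integral {0..t} g" by (intro primitive_eq[OF p]) simp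
    then show "deriv \<phi> t *\<^sub>R f t = deriv \<phi> t *\<^sub>R f 0 + deriv \<phi> t *\<^sub>R integral {0..t} g"
      by (metis scaleR_add_right)
  qed
  also have "\<dots> = integral {0..b+1} (\<lambda>t. deriv \<phi> t *\<^sub>R f 0) + integral {0..b+1} (\<lambda>t. deriv \<phi> t *\<^sub>R integral {0..t} g)"
    by (intro Henstock_Kurzweil_Integration.integral_add integrable_continuous_real continuous_intros dc
          indefinite_integral_continuous_1 primitive_integrable_on[OF p]) auto
  also have "integral {0..b+1} (\<lambda>t. deriv \<phi> t *\<^sub>R f 0) = 0"
    using has_integral_scaleR_left[OF I1, of "f 0"] by (simp add: integral_unique)
  also have "integral {0..b+1} (\<lambda>t. deriv \<phi> t *\<^sub>R integral {0..t} g) = integral {0..b+1} (\<lambda>s. (\<phi> (b+1) - \<phi> s) *\<^sub>R g s)"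
    by (rule integral_by_parts_indefinite[OF ga D dc])
  also have "\<dots> = - integral {0..b+1} (\<lambda>s. \<phi> s *\<^sub>R g s)"
    using z(1)[of "b+1"] by simp
  also have "integral {0..b+1} (\<lambda>s. \<phi> s *\<^sub>R g s) = (\<integral>t. \<phi> t *\<^sub>R g t \<partial>lebesgue_on {0<..})"
    by (intro ext[symmetric] absolutely_integrable_continuous_scaleR \<phi>c ga z(1))
  finally show "(\<integral>t. deriv \<phi> t *\<^sub>R f t \<partial>lebesgue_on {0<..}) = - (\<integral>t. \<phi> t *\<^sub>R g t \<partial>lebesgue_on {0<..})"
    by (simp only: add_0_left)
qed

lemma primitive_W11:
  fixes f g :: "real \<Rightarrow> real ^ 'n"
  assumes "r > 0" "primitive r f g" shows "f \<in> W11 r"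
proof -
  have "f \<in> L1 r" "g \<in> L1 r"
    using primitive_L1(1)[OF assms] primitive_integrable[OF assms(2)] by (simp_all add: L1_def)
  then show ?thesis
    using primitive_has_distr_deriv[OF assms] primitive_continuous[OF assms(2)] unfolding W11_def by blast
qed

text \<open>Test functions see only the open half-line, so \<open>f\<close> minus the primitive of
  \<open>g\<close> is first shown to be constant there, by comparison with its value at 1;
  continuity extends this to 0.\<close>

lemma W11_primitive:
  fixes f :: "real \<Rightarrow> real ^ 'n"
  assumes "f \<in> W11 r" obtains g where "primitive r f g"
proof -
  obtain g where g: "integrable (mu r) g" "has_distr_deriv f g" and c: "continuous_on {0..} f"
  proof -
    have "\<exists>g\<in>L1 r. has_distr_deriv f g" "continuous_on {0..} f" using assms unfolding W11_def by simp_all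
    then show ?thesis using that unfolding L1_def by blast
  qed
  let ?h = "\<lambda>t. f t - integral {0..t} g"
  have h1: "?h t = ?h 1" if "t \<in> {0<..}" for t
  proof -
    have *: "?h t = ?h s" if "0 < s" "s \<le> t" for s t
    proof -
      have "f t - f s = integral {s..t} g"
        by (rule has_distr_deriv_imp_integral[OF _ g(2) that]) (rule continuous_on_subset[OF c], auto)
      moreover have "integral {0..s} g + integral {s..t} g = integral {0..t} g"
        using set_lebesgue_integral_eq_integral(1)[OF set_integrable_mu_imp(1)[OF g(1), of 0 t]] that
        by (intro Henstock_Kurzweil_Integration.integral_combine) simp_all
      ultimately show ?thesis by (simp add: algebra_simps)
    qed
    have t: "t > 0" using that by simp
    show ?thesis
    proof (cases "t \<le> 1")
      case True
      then show ?thesis by (intro *[of t 1, symmetric] t)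
    next
      case False
      then show ?thesis by (intro *[of 1 t]) simp_all
    qed
  qed
  have "continuous_on (closure {0<..}) ?h"
    using c continuous_on_integral_mu[OF g(1)] by (auto intro!: continuous_intros)
  then have h: "?h t = ?h 1" if "t \<ge> 0" for t
    by (rule continuous_constant_on_closure[OF _ h1]) (use that in auto)
  have "f t = f 0 + integral {0..t} g" if "t \<ge> 0" for t
  proof -
    have "?h t = ?h 0" using h[OF that] h[OF order_refl] by (rule trans[OF _ sym])
    then show ?thesis by (simp add: algebra_simps)
  qed
  then show thesis using that g(1) unfolding primitive_def by blast
qed

text \<open>The chosen derivative and \<open>g\<close> have the same integral over every interval in
  the open half-line, namely the increment of \<open>f\<close>, so their difference vanishes almost
  everywhere.\<close>

lemma distr_deriv_primitive:
  fixes f g :: "real \<Rightarrow> real ^ 'n"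
  assumes r: "r > 0" and p: "primitive r f g"
  shows "AE t in mu r. distr_deriv f t = g t"
proof -
  let ?d = "distr_deriv f"
  have hd: "has_distr_deriv f ?d"
    unfolding distr_deriv_def by (rule someI[of "has_distr_deriv f", OF primitive_has_distr_deriv[OF r p]])
  have da: "?d absolutely_integrable_on {a..b}" if "0 < a" for a b
  proof -
    have "{a..b} \<subseteq> {0<..}" using that by auto
    then show ?thesis using hd unfolding has_distr_deriv_def locally_integrable_def by (meson compact_Icc)
  qed
  have ga: "g absolutely_integrable_on {a..b}" if "0 < a" for a b
    using set_integrable_mu_imp(1)[OF primitive_integrable[OF p]] that by simp
  have "AE t in lebesgue_on {0..}. ?d t - g t = 0"
  proof (rule AE_eq_0_if_integrals_0)
    fix a b :: real assume ab: "0 < a" "a \<le> b"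
    show "(\<lambda>t. ?d t - g t) absolutely_integrable_on {a..b}" using da[OF ab(1)] ga[OF ab(1)] by (rule set_integral_diff(1))
    have "integral {a..b} (\<lambda>t. ?d t - g t) = integral {a..b} ?d - integral {a..b} g"
      using da[OF ab(1)] ga[OF ab(1)] set_lebesgue_integral_eq_integral(1) by (intro Henstock_Kurzweil_Integration.integral_diff) blast+
    moreover have fc: "continuous_on {0<..} f" by (rule continuous_on_subset[OF primitive_continuous[OF p]]) auto
    ultimately show "integral {a..b} (\<lambda>t. ?d t - g t) = 0"
      using has_distr_deriv_imp_integral[OF fc hd ab] has_distr_deriv_imp_integral[OF fc primitive_has_distr_deriv[OF r p] ab] by simp
  qed
  then show ?thesis unfolding AE_mu_iff by simp
qed

lemma W11_norm_primitive:
  fixes f g :: "real \<Rightarrow> real ^ 'n"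
  assumes r: "r > 0" and p: "primitive r f g"
  shows "W11_norm r f = L1_norm r f + L1_norm r g"
proof -
  have "g \<in> borel_measurable (mu r)" using primitive_integrable[OF p] by auto
  then have m: "g \<in> borel_measurable (lebesgue_on {0..})" by (simp only: measurable_cong_sets[OF sets_mu refl])
  have AE: "AE t in lebesgue_on {0..}. g t = distr_deriv f t"
    using distr_deriv_primitive[OF r p] unfolding AE_mu_iff by (auto elim: eventually_mono)
  have "L1_norm r (distr_deriv f) = L1_norm r g"
    unfolding L1_norm_def
  proof (rule integral_cong_AE)
    show "AE t in mu r. norm (distr_deriv f t) = norm (g t)"
      using distr_deriv_primitive[OF r p] by (auto elim: eventually_mono)
    have "distr_deriv f \<in> borel_measurable (lebesgue_on {0..})"
      by (rule borel_measurable_lebesgue_on_AE[OF m _ AE]) simp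
    then have [measurable]: "distr_deriv f \<in> borel_measurable (mu r)" by (simp only: measurable_cong_sets[OF sets_mu refl])
    show "(\<lambda>t. norm (distr_deriv f t)) \<in> borel_measurable (mu r)" by measurable
    show "(\<lambda>t. norm (g t)) \<in> borel_measurable (mu r)" using primitive_integrable[OF p] by auto
  qed
  then show ?thesis by (simp add: W11_norm_def)
qed

section \<open>The closure of the periodic functions\<close>

lemma W11_add:
  fixes f g :: "real \<Rightarrow> real ^ 'n"
  assumes r: "r > 0" and f: "f \<in> W11 r" and g: "g \<in> W11 r"
  shows "(\<lambda>t. f t + g t) \<in> W11 r" and "W11_norm r (\<lambda>t. f t + g t) \<le> W11_norm r f + W11_norm r g"
proof -
  obtain f' g' where p: "primitive r f f'" "primitive r g g'" using W11_primitive f g by metis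
  note s = primitive_add[OF p]
  show "(\<lambda>t. f t + g t) \<in> W11 r" by (rule primitive_W11[OF r s])
  have tri: "L1_norm r (\<lambda>t. a t + b t) \<le> L1_norm r a + L1_norm r b"
    if "integrable (mu r) a" "integrable (mu r) b" for a b :: "real \<Rightarrow> real ^ 'n"
  proof -
    have "L1_norm r (\<lambda>t. a t + b t) \<le> (\<integral>t. norm (a t) + norm (b t) \<partial>mu r)"
      unfolding L1_norm_def using that by (intro integral_mono) (auto intro: norm_triangle_ineq)
    also have "\<dots> = L1_norm r a + L1_norm r b"
      unfolding L1_norm_def using that by (intro Bochner_Integration.integral_add) auto
    finally show ?thesis .
  qed
  show "W11_norm r (\<lambda>t. f t + g t) \<le> W11_norm r f + W11_norm r g"
    unfolding W11_norm_primitive[OF r s] W11_norm_primitive[OF r p(1)] W11_norm_primitive[OF r p(2)]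
    using tri[OF primitive_L1(1)[OF r p(1)] primitive_L1(1)[OF r p(2)]]
      tri[OF primitive_integrable[OF p(1)] primitive_integrable[OF p(2)]] by linarith
qed

lemma W11_scaleR:
  fixes f :: "real \<Rightarrow> real ^ 'n"
  assumes r: "r > 0" and f: "f \<in> W11 r"
  shows "(\<lambda>t. c *\<^sub>R f t) \<in> W11 r" and "W11_norm r (\<lambda>t. c *\<^sub>R f t) = \<bar>c\<bar> * W11_norm r f"
proof -
  obtain f' where p: "primitive r f f'" using W11_primitive f by metis
  note s = primitive_scaleR[OF p, of c]
  show "(\<lambda>t. c *\<^sub>R f t) \<in> W11 r" by (rule primitive_W11[OF r s])
  show "W11_norm r (\<lambda>t. c *\<^sub>R f t) = \<bar>c\<bar> * W11_norm r f"
    unfolding W11_norm_primitive[OF r s] W11_norm_primitive[OF r p] by (simp add: L1_norm_def distrib_left)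
qed

lemma W11_diff:
  fixes f g :: "real \<Rightarrow> real ^ 'n"
  assumes "r > 0" "f \<in> W11 r" "g \<in> W11 r"
  shows "(\<lambda>t. f t - g t) \<in> W11 r"
  using W11_add(1)[OF assms(1,2) W11_scaleR(1)[OF assms(1,3), of "-1"]] by simp

text \<open>Compactness on one period, then induction on the number of periods. Applied to
  derivatives, it makes periodic functions of class \<open>C^1\<close> elements of
  \<open>W11\<close>, as \<open>mu r\<close> is finite.\<close>

lemma periodic_bounded:
  fixes f :: "real \<Rightarrow> real ^ 'n"
  assumes "T > 0" "periodic T f" "continuous_on {0..} f"
  obtains B where "\<And>t. t \<ge> 0 \<Longrightarrow> norm (f t) \<le> B"
proof -
  have "bounded (f ` {0..T})"
    by (intro compact_imp_bounded compact_continuous_image compact_Icc continuous_on_subset[OF assms(3)]) auto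
  then obtain B where B: "\<And>t. t \<in> {0..T} \<Longrightarrow> norm (f t) \<le> B" unfolding bounded_iff by (meson imageI)
  have *: "norm (f t) \<le> B" if "0 \<le> t" "t \<le> real k * T" for k t
    using that
  proof (induction k arbitrary: t)
    case 0
    then show ?case using B[of t] assms(1) by auto
  next
    case (Suc k)
    show ?case
    proof (cases "t \<le> T")
      case False
      then have "norm (f (t - T)) \<le> B" using Suc.prems by (intro Suc.IH) (auto simp: algebra_simps)
      moreover have "f (t - T + T) = f (t - T)" using assms(2)[unfolded periodic_def, rule_format, of "t - T"] False by simp
      ultimately show ?thesis by simp
    qed (use B Suc.prems in auto)
  qed
  have "norm (f t) \<le> B" if "t \<ge> 0" for t
  proof -
    obtain k where "t / T < real k" using reals_Archimedean2 by blast
    then show ?thesis using *[OF that, of k] assms(1) by (simp add: field_simps)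
  qed
  then show thesis using that by blast
qed

text \<open>Translation by \<open>T\<close> maps the half-line into itself, so the derivative at
  \<open>t + T\<close> restricts to the translated half-line and can be compared with the one at
  \<open>t\<close>. A right neighbourhood of \<open>t\<close> suffices for uniqueness, which covers
  \<open>t = 0\<close>.\<close>

lemma periodic_derivative:
  fixes u u' :: "real \<Rightarrow> real ^ 'n"
  assumes T: "T > 0" and u: "periodic T u"
    and D: "\<And>t. t \<ge> 0 \<Longrightarrow> (u has_vector_derivative u' t) (at t within {0..})"
  shows "periodic T u'"
  unfolding periodic_def
proof (intro allI impI)
  fix t :: real assume t: "t \<ge> 0"
  have "(u has_vector_derivative u' (t + T)) (at (t + T) within (\<lambda>s. s + T) ` {0..})"
    using D[of "t + T"] t T by (intro has_vector_derivative_within_subset[OF D]) auto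
  then have "((u \<circ> (\<lambda>s. s + T)) has_vector_derivative 1 *\<^sub>R u' (t + T)) (at t within {0..})"
    by (intro vector_diff_chain_within) (auto intro!: derivative_eq_intros)
  then have "(u has_vector_derivative u' (t + T)) (at t within {0..})"
    using u t by (auto simp: periodic_def elim!: has_vector_derivative_transform[rotated 2])
  then show "u' (t + T) = u' t"
  proof (rule vector_derivative_unique_within[rotated])
    have "at_right t \<le> at t within {0..}" using t by (intro at_le) auto
    then show "at t within {0..} \<noteq> bot" using trivial_limit_at_right_real[of t] by (metis le_bot)
  qed (rule D[OF t])
qed

lemma P1_0_W11:
  fixes u :: "real \<Rightarrow> real ^ 'n"
  assumes r: "r > 0" and T: "T > 0" and u: "u \<in> P1_0 T"
  shows "u \<in> W11 r"
proof -
  obtain u' where c: "continuous_on {0..} u'" and D: "\<And>t. t \<ge> 0 \<Longrightarrow> (u has_vector_derivative u' t) (at t within {0..})"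
    and per: "periodic T u"
    using u unfolding P1_0_def C1_halfline_def by auto
  obtain B where B: "\<And>t. t \<ge> 0 \<Longrightarrow> norm (u' t) \<le> B"
    using periodic_bounded[OF T periodic_derivative[OF T per D] c] by blast
  interpret finite_measure "mu r" by (rule finite_measure_mu[OF r])
  have "integrable (mu r) u'"
    using B by (intro integrable_const_bound[of _ B] continuous_on_measurable_mu c) auto
  moreover have "u t = u 0 + integral {0..t} u'" if "t \<ge> 0" for t
  proof -
    have "(u' has_integral (u t - u 0)) {0..t}"
      using that by (intro fundamental_theorem_of_calculus has_vector_derivative_within_subset[OF D]) auto
    then show ?thesis by (simp add: integral_unique)
  qed
  ultimately have "primitive r u u'" unfolding primitive_def by blast
  then show ?thesis by (rule primitive_W11[OF r])
qed

text \<open>The approximating functions vanish at 0, and evaluation at 0 is continuous. All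
  admissible functions therefore share one initial value.\<close>

lemma W11_0_at_0:
  fixes h :: "real \<Rightarrow> real ^ 'n"
  assumes r: "r > 0" and T: "T > 0" and h: "h \<in> W11_0 r T"
  shows "h 0 = 0"
proof (rule ccontr)
  assume "h 0 \<noteq> 0"
  \<comment> \<open>\<open>r + 1\<close> dominates both coefficients, \<open>r\<close> and 1, in the
    bound for the value at 0.\<close>
  define e where "e = norm (h 0) / (r + 1)"
  have "e > 0" using \<open>h 0 \<noteq> 0\<close> r by (simp add: e_def)
  then obtain u where u: "u \<in> P1_0 T" "W11_norm r (\<lambda>t. h t - u t) < e" and hW: "h \<in> W11 r"
    using h unfolding W11_0_def by auto
  obtain g where g: "primitive r (\<lambda>t. h t - u t) g"
    using W11_primitive[OF W11_diff[OF r hW P1_0_W11[OF r T u(1)]]] by blast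
  have n: "L1_norm r (\<lambda>t. h t - u t) + L1_norm r g < e" using u(2) W11_norm_primitive[OF r g] by simp
  have nn: "L1_norm r (\<lambda>t. h t - u t) \<ge> 0" "L1_norm r g \<ge> 0" by (simp_all add: L1_norm_def)
  have "u 0 = 0" using u(1) by (simp add: P1_0_def)
  then have "norm (h 0) \<le> r * L1_norm r (\<lambda>t. h t - u t) + L1_norm r g"
    using primitive_norm_0[OF r g] by (simp add: L1_norm_def)
  also have "\<dots> \<le> (r + 1) * (L1_norm r (\<lambda>t. h t - u t) + L1_norm r g)"
    using nn r by (simp add: algebra_simps)
  also have "\<dots> < (r + 1) * e" using n r by simp
  also have "\<dots> = norm (h 0)" using r by (simp add: e_def)
  finally show False by simp
qed

lemma P1_0_midpoint:
  fixes u v :: "real \<Rightarrow> real ^ 'n"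
  assumes "u \<in> P1_0 T" "v \<in> P1_0 T"
  shows "(\<lambda>t. (1/2) *\<^sub>R u t + (1/2) *\<^sub>R v t) \<in> P1_0 T"
proof -
  obtain u' v' where "continuous_on {0..} u'" "\<And>t. t \<ge> 0 \<Longrightarrow> (u has_vector_derivative u' t) (at t within {0..})"
     "continuous_on {0..} v'" "\<And>t. t \<ge> 0 \<Longrightarrow> (v has_vector_derivative v' t) (at t within {0..})"
    using assms unfolding P1_0_def C1_halfline_def by auto
  then have "C1_halfline (\<lambda>t. (1/2) *\<^sub>R u t + (1/2) *\<^sub>R v t)"
    unfolding C1_halfline_def
    by (intro exI[of _ "\<lambda>t. (1/2) *\<^sub>R u' t + (1/2) *\<^sub>R v' t"] conjI allI impI continuous_intros
        has_vector_derivative_add bounded_linear.has_vector_derivative[OF bounded_linear_scaleR_right])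
  then show ?thesis using assms by (auto simp: P1_0_def periodic_def)
qed

lemma W11_0_midpoint:
  fixes h k :: "real \<Rightarrow> real ^ 'n"
  assumes r: "r > 0" and T: "T > 0" and h: "h \<in> W11_0 r T" and k: "k \<in> W11_0 r T"
  shows "(\<lambda>t. (1/2) *\<^sub>R h t + (1/2) *\<^sub>R k t) \<in> W11_0 r T"
proof -
  have W: "h \<in> W11 r" "k \<in> W11 r" using h k by (auto simp: W11_0_def)
  have "\<exists>u\<in>P1_0 T. W11_norm r (\<lambda>t. ((1/2) *\<^sub>R h t + (1/2) *\<^sub>R k t) - u t) < e" if "e > 0" for e
  proof -
    obtain u v where u: "u \<in> P1_0 T" "W11_norm r (\<lambda>t. h t - u t) < e"
      and v: "v \<in> P1_0 T" "W11_norm r (\<lambda>t. k t - v t) < e"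
      using h k \<open>e > 0\<close> unfolding W11_0_def by blast
    note hu = W11_diff[OF r W(1) P1_0_W11[OF r T u(1)]] and kv = W11_diff[OF r W(2) P1_0_W11[OF r T v(1)]]
    have "W11_norm r (\<lambda>t. (1/2) *\<^sub>R (h t - u t) + (1/2) *\<^sub>R (k t - v t))
        \<le> \<bar>1/2\<bar> * W11_norm r (\<lambda>t. h t - u t) + \<bar>1/2\<bar> * W11_norm r (\<lambda>t. k t - v t)"
      using W11_add(2)[OF r W11_scaleR(1)[OF r hu, of "1/2"] W11_scaleR(1)[OF r kv, of "1/2"]]
      unfolding W11_scaleR(2)[OF r hu] W11_scaleR(2)[OF r kv] .
    also have "\<dots> < e" using u(2) v(2) by simp
    also have "(\<lambda>t. (1/2) *\<^sub>R (h t - u t) + (1/2) *\<^sub>R (k t - v t))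
        = (\<lambda>t. ((1/2) *\<^sub>R h t + (1/2) *\<^sub>R k t) - ((1/2) *\<^sub>R u t + (1/2) *\<^sub>R v t))"
      by (rule ext) (simp add: algebra_simps)
    finally show ?thesis by (intro bexI[OF _ P1_0_midpoint[OF u(1) v(1)]])
  qed
  then show ?thesis
    using W11_add(1)[OF r W11_scaleR(1)[OF r W(1)] W11_scaleR(1)[OF r W(2)]] unfolding W11_0_def by blast
qed

lemma W11_0_closed:
  fixes x :: "real \<Rightarrow> real ^ 'n"
  assumes r: "r > 0" and T: "T > 0" and x: "x \<in> W11 r"
    and approx: "\<And>e. e > 0 \<Longrightarrow> \<exists>h\<in>W11_0 r T. W11_norm r (\<lambda>t. x t - h t) < e"
  shows "x \<in> W11_0 r T"
proof -
  have "\<exists>u\<in>P1_0 T. W11_norm r (\<lambda>t. x t - u t) < e" if "e > 0" for e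
  proof -
    obtain h where h: "h \<in> W11_0 r T" "W11_norm r (\<lambda>t. x t - h t) < e / 2" using approx[of "e/2"] \<open>e > 0\<close> by auto
    then obtain u where u: "u \<in> P1_0 T" "W11_norm r (\<lambda>t. h t - u t) < e / 2" and hW: "h \<in> W11 r"
      using \<open>e > 0\<close> unfolding W11_0_def by (auto dest: spec[of _ "e/2"])
    have "W11_norm r (\<lambda>t. (x t - h t) + (h t - u t)) \<le> W11_norm r (\<lambda>t. x t - h t) + W11_norm r (\<lambda>t. h t - u t)"
      by (intro W11_add(2) W11_diff r x hW P1_0_W11[OF r T u(1)])
    then have "W11_norm r (\<lambda>t. x t - u t) < e" using h u by simp
    then show ?thesis using u(1) by blast
  qed
  then show ?thesis using x unfolding W11_0_def by blast
qed

section \<open>Convergence of convex combinations\<close>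

text \<open>\<open>s y\<close> is the norm of the vector \<open>(1, y)\<close>, and \<open>D\<close>
  is the deficit in the triangle inequality for \<open>(1, a)\<close> and \<open>(1, b)\<close>.
  Quantitative strict convexity follows because these two vectors are parallel only if
  \<open>a = b\<close>.\<close>

lemma hyperboloid_midpoint_deficit:
  fixes a b :: "'a::real_inner"
  defines "s \<equiv> \<lambda>y::'a. sqrt (1 + (norm y)\<^sup>2)"
  defines "D \<equiv> s a + s b - 2 * s ((1/2) *\<^sub>R a + (1/2) *\<^sub>R b)"
  shows "0 \<le> D" and "s a \<le> R \<Longrightarrow> s b \<le> R \<Longrightarrow> (norm (a - b))\<^sup>2 \<le> 4 * R ^ 3 * D"
proof -
  define m where "m = 2 * s ((1/2) *\<^sub>R a + (1/2) *\<^sub>R b)"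
  define c where "c = a \<bullet> b"
  have p: "(s a)\<^sup>2 = 1 + a \<bullet> a" "s a \<ge> 0" and q: "(s b)\<^sup>2 = 1 + b \<bullet> b" "s b \<ge> 0"
    by (simp_all add: s_def power2_norm_eq_inner[symmetric] add_nonneg_nonneg)
  have m0: "m \<ge> 0" by (simp add: m_def s_def)
  have "m\<^sup>2 = 4 * (1 + ((1/2) *\<^sub>R (a + b)) \<bullet> ((1/2) *\<^sub>R (a + b)))"
    by (simp add: m_def s_def power_mult_distrib power2_norm_eq_inner[symmetric] scaleR_add_right add_nonneg_nonneg)
  then have m2: "m\<^sup>2 = 4 + a \<bullet> a + b \<bullet> b + 2 * c"
    by (simp add: c_def inner_add_left inner_add_right inner_commute algebra_simps)
  have diff: "(norm (a - b))\<^sup>2 = a \<bullet> a + b \<bullet> b - 2 * c"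
    by (simp add: power2_norm_eq_inner c_def inner_diff_left inner_diff_right inner_commute)
  have cs: "c\<^sup>2 \<le> (a \<bullet> a) * (b \<bullet> b)" unfolding c_def by (rule Cauchy_Schwarz_ineq)
  have pq2: "(s a * s b)\<^sup>2 = (1 + a \<bullet> a) * (1 + b \<bullet> b)" by (simp add: power_mult_distrib p q)
  \<comment> \<open>The right side is the gap in the Cauchy-Schwarz inequality for
    \<open>(1, a)\<close> and \<open>(1, b)\<close>. It equals \<open>(norm (a - b))\<^sup>2\<close>
    plus the corresponding gap for \<open>a\<close> and \<open>b\<close>.\<close>
  have lag: "(norm (a - b))\<^sup>2 \<le> (s a * s b - (1 + c)) * (s a * s b + (1 + c))"
    using cs pq2 unfolding diff by (simp add: algebra_simps power2_eq_square)
  have "(1 + c)\<^sup>2 \<le> (s a * s b)\<^sup>2"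
    using lag order_trans[OF zero_le_power2[of "norm (a - b)"] lag] by (simp add: algebra_simps power2_eq_square)
  then have cpq: "1 + c \<le> s a * s b" by (rule power2_le_imp_le) (intro mult_nonneg_nonneg p q)
  have factor: "2 * (s a * s b - (1 + c)) = (s a + s b - m) * (s a + s b + m)"
    using p q m2 by (simp add: algebra_simps power2_eq_square)
  have "m\<^sup>2 \<le> (s a + s b)\<^sup>2" using factor cpq by (simp add: algebra_simps power2_eq_square)
  then have mle: "m \<le> s a + s b" by (rule power2_le_imp_le) (intro add_nonneg_nonneg p q)
  then show D0: "0 \<le> D" by (simp add: D_def m_def)
  assume R: "s a \<le> R" "s b \<le> R"
  have R0: "R \<ge> 0" using R p by simp
  have pqR: "s a * s b \<le> R * R" using R p q R0 by (intro mult_mono) auto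
  have "(norm (a - b))\<^sup>2 \<le> (s a * s b - (1 + c)) * (2 * (R * R))"
    using cpq pqR by (intro order_trans[OF lag] mult_left_mono) auto
  also have "\<dots> = (2 * (s a * s b - (1 + c))) * (R * R)" by simp
  also have "\<dots> = D * (s a + s b + m) * (R * R)" unfolding factor by (simp add: D_def m_def)
  \<comment> \<open>\<open>m\<close> is at most \<open>s a + s b\<close>, hence the sum of the three
    is at most \<open>4 * R\<close>.\<close>
  also have "\<dots> \<le> D * (4 * R) * (R * R)"
    using D0 mle R R0 by (intro mult_right_mono mult_left_mono) auto
  also have "\<dots> = 4 * R ^ 3 * D" by (simp add: power3_eq_cube)
  finally show "(norm (a - b))\<^sup>2 \<le> 4 * R ^ 3 * D" .
qed

text \<open>A subsequence is Cauchy almost everywhere and defines \<open>g\<close>. Norm convergence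
  then follows from Fatou's lemma in the second index of the Cauchy condition, with the first one
  fixed.\<close>

lemma (in finite_measure) L1_Cauchy_limit:
  fixes G :: "nat \<Rightarrow> 'a \<Rightarrow> 'b::euclidean_space"
  assumes int: "\<And>n. integrable M (G n)"
    and Cauchy: "\<And>e. e > 0 \<Longrightarrow> \<exists>N. \<forall>i\<ge>N. \<forall>j\<ge>N. (\<integral>x. norm (G i x - G j x) \<partial>M) < e"
  obtains r g where "strict_mono r" "integrable M g" "(\<lambda>n. \<integral>x. norm (G (r n) x - g x) \<partial>M) \<longlonglongrightarrow> 0"
    "AE x in M. (\<lambda>n. G (r n) x) \<longlonglongrightarrow> g x"
proof -
  obtain r where r: "strict_mono r" and C: "AE x in M. Cauchy (\<lambda>i. G (r i) x)"
    using cauchy_L1_AE_cauchy_subseq[OF int Cauchy] by blast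
  define g where "g = (\<lambda>x. lim (\<lambda>i. G (r i) x))"
  have lim: "AE x in M. (\<lambda>n. G (r n) x) \<longlonglongrightarrow> g x"
    using C by (auto elim!: eventually_mono simp: g_def Cauchy_convergent_iff convergent_LIMSEQ_iff)
  have [measurable]: "G n \<in> borel_measurable M" for n using int by auto
  have [measurable]: "g \<in> borel_measurable M" unfolding g_def by (rule borel_measurable_lim_metric) measurable
  have bound: "\<exists>N. \<forall>n\<ge>N. (\<integral>\<^sup>+x. norm (G (r n) x - g x) \<partial>M) \<le> ennreal e" if e: "e > 0" for e
  proof -
    obtain N where N: "\<And>i j. i \<ge> N \<Longrightarrow> j \<ge> N \<Longrightarrow> (\<integral>x. norm (G i x - G j x) \<partial>M) < e" using Cauchy[OF e] by blast
    have "(\<integral>\<^sup>+x. norm (G (r n) x - g x) \<partial>M) \<le> ennreal e" if "n \<ge> N" for n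
    proof -
      have rn: "r k \<ge> N" if "k \<ge> N" for k using seq_suble[OF r, of k] that by linarith
      have "(\<integral>\<^sup>+x. norm (G (r n) x - g x) \<partial>M) = (\<integral>\<^sup>+x. liminf (\<lambda>i. ennreal (norm (G (r n) x - G (r i) x))) \<partial>M)"
      proof (intro nn_integral_cong_AE)
        show "AE x in M. ennreal (norm (G (r n) x - g x)) = liminf (\<lambda>i. ennreal (norm (G (r n) x - G (r i) x)))"
          using lim
        proof eventually_elim
          case (elim x)
          then have "(\<lambda>i. ennreal (norm (G (r n) x - G (r i) x))) \<longlonglongrightarrow> ennreal (norm (G (r n) x - g x))"
            by (intro tendsto_intros)
          then show ?case by (rule lim_imp_Liminf[symmetric, OF sequentially_bot])
        qed
      qed
      also have "\<dots> \<le> liminf (\<lambda>i. \<integral>\<^sup>+x. norm (G (r n) x - G (r i) x) \<partial>M)"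
        by (rule nn_integral_liminf) measurable
      also have "\<dots> \<le> liminf (\<lambda>i::nat. ennreal e)"
      proof (rule Liminf_mono)
        show "\<forall>\<^sub>F i in sequentially. (\<integral>\<^sup>+x. norm (G (r n) x - G (r i) x) \<partial>M) \<le> ennreal e"
        proof (rule eventually_sequentiallyI[of N])
          fix i assume "i \<ge> N"
          have "(\<integral>\<^sup>+x. norm (G (r n) x - G (r i) x) \<partial>M) = ennreal (\<integral>x. norm (G (r n) x - G (r i) x) \<partial>M)"
            by (rule nn_integral_eq_integral) (use int in auto)
          also have "\<dots> \<le> ennreal e" using N[OF rn[OF \<open>n \<ge> N\<close>] rn[OF \<open>i \<ge> N\<close>]] by (intro ennreal_leI) simp
          finally show "(\<integral>\<^sup>+x. norm (G (r n) x - G (r i) x) \<partial>M) \<le> ennreal e" .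
        qed
      qed
      also have "\<dots> = ennreal e" by (simp add: Liminf_const)
      finally show ?thesis .
    qed
    then show ?thesis by blast
  qed
  have gint: "integrable M g"
  proof -
    obtain n where n: "(\<integral>\<^sup>+x. norm (G (r n) x - g x) \<partial>M) \<le> ennreal 1" using bound[of 1] by auto
    have "integrable M (\<lambda>x. G (r n) x - g x)"
      by (rule integrableI_bounded) (use n in \<open>auto intro: le_less_trans\<close>)
    from Bochner_Integration.integrable_diff[OF int[of "r n"] this] show ?thesis by simp
  qed
  have "(\<lambda>n. \<integral>x. norm (G (r n) x - g x) \<partial>M) \<longlonglongrightarrow> 0"
  proof (rule LIMSEQ_I)
    fix e :: real assume "e > 0"
    then obtain N where N: "\<And>n. n \<ge> N \<Longrightarrow> (\<integral>\<^sup>+x. norm (G (r n) x - g x) \<partial>M) \<le> ennreal (e/2)" using bound[of "e/2"] by auto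
    have "norm ((\<integral>x. norm (G (r n) x - g x) \<partial>M) - 0) < e" if "n \<ge> N" for n
    proof -
      have "ennreal (\<integral>x. norm (G (r n) x - g x) \<partial>M) = (\<integral>\<^sup>+x. norm (G (r n) x - g x) \<partial>M)"
        by (rule nn_integral_eq_integral[symmetric]) (use int gint in auto)
      then have "(\<integral>x. norm (G (r n) x - g x) \<partial>M) \<le> e / 2"
        using N[OF that] \<open>e > 0\<close> by (metis ennreal_le_iff half_gt_zero less_eq_real_def)
      then show ?thesis using \<open>e > 0\<close> by simp
    qed
    then show "\<exists>no. \<forall>n\<ge>no. norm ((\<integral>x. norm (G (r n) x - g x) \<partial>M) - 0) < e" by blast
  qed
  then show thesis using that r gint lim by blast
qed

text \<open>The infima \<open>a n\<close> of \<open>J\<close> over \<open>H n\<close> increase to a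
  finite limit. Near-minimizers \<open>G i\<close> and \<open>G j\<close> with
  \<open>i, j \<ge> N\<close> have their midpoint in \<open>H N\<close>, where \<open>J\<close> is
  at least \<open>a N\<close>; so the integrated midpoint deficit is small. It controls the
  difference where both functions are moderate, and uniform integrability controls the rest.\<close>

lemma (in finite_measure) midpoint_convex_L1_convergent:
  fixes H :: "nat \<Rightarrow> ('a \<Rightarrow> 'b::euclidean_space) set"
  assumes ne: "\<And>n. H n \<noteq> {}" and dec: "\<And>m n. m \<le> n \<Longrightarrow> H n \<subseteq> H m"
    and mid: "\<And>n f g. f \<in> H n \<Longrightarrow> g \<in> H n \<Longrightarrow> (\<lambda>x. (1/2) *\<^sub>R f x + (1/2) *\<^sub>R g x) \<in> H n"
    and int: "\<And>f. f \<in> H 0 \<Longrightarrow> integrable M f"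
    and UI: "\<And>e. e > 0 \<Longrightarrow> \<exists>K. \<forall>f\<in>H 0. \<forall>A\<in>sets M. (\<integral>x. indicator A x * norm (f x) \<partial>M) \<le> e + K * measure M A"
  obtains G g where "\<And>n. G n \<in> H n" "integrable M g" "(\<lambda>n. \<integral>x. norm (G n x - g x) \<partial>M) \<longlonglongrightarrow> 0"
    "AE x in M. (\<lambda>n. G n x) \<longlonglongrightarrow> g x"
proof -
  define s where "s = (\<lambda>y::'b. sqrt (1 + (norm y)\<^sup>2))"
  define J where "J = (\<lambda>f. \<integral>x. s (f x) \<partial>M)"
  have H0: "f \<in> H 0" if "f \<in> H n" for f n using dec[of 0 n] that by auto
  have [measurable]: "f \<in> borel_measurable M" if "f \<in> H 0" for f using int[OF that] by auto
  have s1: "1 \<le> s y" "norm y \<le> s y" "s y \<le> 1 + norm y" for y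
    unfolding s_def by (auto intro!: real_le_rsqrt real_le_lsqrt simp: power2_eq_square algebra_simps)
  have sint: "integrable M (\<lambda>x. s (f x))" if "f \<in> H 0" for f
  proof (rule Bochner_Integration.integrable_bound[of _ "\<lambda>x. 1 + norm (f x)"])
    show "integrable M (\<lambda>x. 1 + norm (f x))" using int[OF that] by simp
    show "(\<lambda>x. s (f x)) \<in> borel_measurable M" using that unfolding s_def by measurable
    show "AE x in M. norm (s (f x)) \<le> norm (1 + norm (f x))"
      using s1 by (intro AE_I2) (metis abs_ge_self abs_of_nonneg order_trans real_norm_def zero_le_one)
  qed
  obtain K1 where K1: "\<And>f A. f \<in> H 0 \<Longrightarrow> A \<in> sets M \<Longrightarrow> (\<integral>x. indicator A x * norm (f x) \<partial>M) \<le> 1 + K1 * measure M A"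
    using UI[of 1] by auto
  \<comment> \<open>The uniform integrability bound at level 1, with the whole space as the set,
    bounds \<open>J\<close> on \<open>H 0\<close>.\<close>
  define C where "C = measure M (space M) + (1 + K1 * measure M (space M))"
  have JC: "J f \<le> C" if "f \<in> H 0" for f
  proof -
    have "J f \<le> (\<integral>x. 1 + norm (f x) \<partial>M)" unfolding J_def
      by (rule integral_mono) (use sint int that s1 in auto)
    also have "\<dots> = measure M (space M) + (\<integral>x. norm (f x) \<partial>M)" using int[OF that] by simp
    also have "(\<integral>x. norm (f x) \<partial>M) = (\<integral>x. indicator (space M) x * norm (f x) \<partial>M)"
      by (intro Bochner_Integration.integral_cong) auto
    also have "\<dots> \<le> 1 + K1 * measure M (space M)" by (rule K1[OF that sets.top])
    finally show ?thesis by (simp add: C_def)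
  qed
  have J0: "0 \<le> J f" for f unfolding J_def using s1(1) by (intro integral_nonneg_AE AE_I2) (meson order_trans zero_le_one)
  have bdd: "bdd_below (J ` H n)" for n by (rule bdd_belowI[of _ 0]) (use J0 in auto)
  define a where "a = (\<lambda>n. Inf (J ` H n))"
  have aJ: "a n \<le> J f" if "f \<in> H n" for f n unfolding a_def using bdd that by (intro cInf_lower) auto
  have "incseq a" unfolding a_def incseq_def
    using dec ne bdd by (intro allI impI cInf_superset_mono image_mono) auto
  moreover have "a n \<le> C" for n
  proof -
    obtain f where "f \<in> H n" using ne[of n] by auto
    then show ?thesis using aJ[of f n] JC[OF H0[of f n]] by linarith
  qed
  ultimately obtain al where al: "a \<longlonglongrightarrow> al" "\<And>n. a n \<le> al"
    using incseq_convergent[of a C] by blast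
  have "\<exists>f\<in>H n. J f < a n + 1 / real (Suc n)" for n
  proof -
    have "Inf (J ` H n) < a n + 1 / real (Suc n)" by (simp add: a_def)
    then show ?thesis using cInf_lessD[of "J ` H n"] ne[of n] by blast
  qed
  then obtain G where G: "\<And>n. G n \<in> H n" "\<And>n. J (G n) < a n + 1 / real (Suc n)" by metis
  have "\<exists>N. \<forall>i\<ge>N. \<forall>j\<ge>N. (\<integral>x. norm (G i x - G j x) \<partial>M) < e" if e: "e > 0" for e
  proof -
    obtain K0 where K0: "\<And>f A. f \<in> H 0 \<Longrightarrow> A \<in> sets M \<Longrightarrow> (\<integral>x. indicator A x * norm (f x) \<partial>M) \<le> e / 8 + K0 * measure M A"
      using UI[of "e/8"] e by auto
    \<comment> \<open>\<open>K0\<close> may be negative; a positive constant keeps the bound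
      monotone in the measure of the set.\<close>
    define K where "K = max K0 1"
    have K: "(\<integral>x. indicator A x * norm (f x) \<partial>M) \<le> e / 8 + K * measure M A" if "f \<in> H 0" "A \<in> sets M" for f A
      using K0[OF that] mult_right_mono[of K0 K "measure M A"] by (simp add: K_def)
    have K1': "K \<ge> 1" by (simp add: K_def)
    have C0: "C \<ge> 0" using JC[OF H0[OF G(1)]] J0 order_trans by blast
    \<comment> \<open>By Markov's inequality one of the two functions is large on a set of measure
      at most \<open>2 * C / R\<close>, and \<open>K\<close> times this is to be at most
      \<open>e / 8\<close>.\<close>
    define R where "R = max 1 (16 * K * C / e)"
    have R: "R \<ge> 1" "K * (2 * C / R) \<le> e / 8"
    proof -
      show "R \<ge> 1" by (simp add: R_def)
      have "16 * K * C / e \<le> R" by (simp add: R_def)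
      then show "K * (2 * C / R) \<le> e / 8" using e \<open>R \<ge> 1\<close> by (simp add: field_simps)
    qed
    \<comment> \<open>The summand 1 keeps the denominator positive when the measure is zero.\<close>
    define d where "d = e / (8 * (measure M (space M) + 1))"
    have d: "d > 0" "d * measure M (space M) \<le> e / 8"
    proof -
      have 0: "(0::real) \<le> measure M (space M)" by simp
      have "8 * (measure M (space M) + 1) > 0" by (intro mult_pos_pos add_nonneg_pos 0) simp_all
      then show "d > 0" using e unfolding d_def by (intro divide_pos_pos)
      have "d * measure M (space M) \<le> d * (measure M (space M) + 1)" using \<open>d > 0\<close> by simp
      also have "\<dots> = e / 8" using 0 unfolding d_def by (simp add: field_simps add_nonneg_eq_0_iff)
      finally show "d * measure M (space M) \<le> e / 8" .
    qed
    \<comment> \<open>The inequality \<open>u \<le> d + u\<^sup>2 / d\<close> converts the quadratic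
      deficit estimate, with constant \<open>4 * R ^ 3\<close>, into a linear bound on the
      difference.\<close>
    define L where "L = 4 * R ^ 3 / d"
    have L: "L > 0" using R d by (simp add: L_def)
    have "(\<lambda>N. 2 * (al - a N) + 2 / real (Suc N)) \<longlonglongrightarrow> 2 * (al - al) + 0"
      by (intro tendsto_intros al(1) LIMSEQ_Suc[OF lim_const_over_n])
    then have "(\<lambda>N. 2 * (al - a N) + 2 / real (Suc N)) \<longlonglongrightarrow> 0" by simp
    then have "\<forall>\<^sub>F N in sequentially. 2 * (al - a N) + 2 / real (Suc N) < e / (8 * L)"
      by (rule order_tendstoD) (use e L in simp)
    then obtain N where N: "2 * (al - a N) + 2 / real (Suc N) < e / (8 * L)"
      unfolding eventually_sequentially by blast
    have "(\<integral>x. norm (G i x - G j x) \<partial>M) < e" if ij: "i \<ge> N" "j \<ge> N" for i j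
    proof -
      have GN: "G i \<in> H N" "G j \<in> H N" using G(1) dec ij by blast+
      have Gz: "G i \<in> H 0" "G j \<in> H 0" using GN H0 by blast+
      define m where "m = (\<lambda>x. (1/2) *\<^sub>R G i x + (1/2) *\<^sub>R G j x)"
      have m: "m \<in> H N" unfolding m_def using mid GN by blast
      define D where "D = (\<lambda>x. s (G i x) + s (G j x) - 2 * s (m x))"
      have Dint: "integrable M D" unfolding D_def using sint Gz m H0 by (intro Bochner_Integration.integrable_diff Bochner_Integration.integrable_add integrable_mult_right) blast+
      have D0: "D x \<ge> 0" and DR: "s (G i x) \<le> R \<Longrightarrow> s (G j x) \<le> R \<Longrightarrow> (norm (G i x - G j x))\<^sup>2 \<le> 4 * R ^ 3 * D x" for x
        using hyperboloid_midpoint_deficit(1)[of "G i x" "G j x"]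
          hyperboloid_midpoint_deficit(2)[where a="G i x" and b="G j x" and R=R] unfolding D_def s_def m_def by auto
      have "(\<integral>x. D x \<partial>M) = J (G i) + J (G j) - 2 * J m"
        unfolding D_def J_def using sint Gz m H0 by simp
      also have "\<dots> \<le> (al + 1 / real (Suc N)) + (al + 1 / real (Suc N)) - 2 * a N"
      proof -
        have "J (G k) \<le> al + 1 / real (Suc N)" if "k \<ge> N" for k
        proof -
          have "1 / real (Suc k) \<le> 1 / real (Suc N)" using that by (simp add: frac_le)
          then show ?thesis using G(2)[of k] al(2)[of k] by linarith
        qed
        from this[OF ij(1)] this[OF ij(2)] aJ[OF m] show ?thesis by linarith
      qed
      also have "\<dots> = 2 * (al - a N) + 2 / real (Suc N)" by (simp flip: add_divide_distrib)
      also note N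
      finally have ID: "L * (\<integral>x. D x \<partial>M) < e / 8" using L by (simp add: field_simps)
      define B where "B = {x \<in> space M. R \<le> s (G i x)} \<union> {x \<in> space M. R \<le> s (G j x)}"
      have [measurable]: "G i \<in> borel_measurable M" "G j \<in> borel_measurable M" using Gz int by auto
      have sm [measurable]: "s \<in> borel_measurable borel" unfolding s_def by measurable
      have B: "B \<in> sets M" unfolding B_def by measurable
      have markov: "measure M {x \<in> space M. R \<le> s (f x)} \<le> C / R" if "f \<in> H 0" for f
      proof -
        have "measure M {x \<in> space M. R \<le> s (f x)} \<le> (\<integral>x. s (f x) \<partial>M) / R"
          by (rule integral_Markov_inequality_measure[OF sint[OF that] sets.top])
             (use R s1(1) in \<open>auto intro!: AE_I2 order_trans[OF zero_le_one]\<close>)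
        also have "\<dots> \<le> C / R" using JC[OF that] R unfolding J_def by (intro divide_right_mono) auto
        finally show ?thesis .
      qed
      have "measure M B \<le> measure M {x \<in> space M. R \<le> s (G i x)} + measure M {x \<in> space M. R \<le> s (G j x)}"
        unfolding B_def by (rule measure_Un_le) measurable
      also have "\<dots> \<le> 2 * C / R" using markov[OF Gz(1)] markov[OF Gz(2)] by simp
      finally have mB: "measure M B \<le> 2 * C / R" .
      have IB: "(\<integral>x. indicator B x * norm (f x) \<partial>M) \<le> e / 4" if "f \<in> H 0" for f
      proof -
        have "K * measure M B \<le> K * (2 * C / R)" using mB K1' by (intro mult_left_mono) auto
        then show ?thesis using K[OF that B] R(2) by linarith
      qed
      have iB: "integrable M (\<lambda>x. indicator B x * norm (f x))" if "f \<in> H 0" for f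
        using integrable_real_mult_indicator[OF B integrable_norm[OF int[OF that]]] by (simp add: mult.commute)
      have pt: "norm (G i x - G j x) \<le> d + L * D x + (indicator B x * norm (G i x) + indicator B x * norm (G j x))"
        if x: "x \<in> space M" for x
      proof (cases "x \<in> B")
        case True
        then show ?thesis using d L D0[of x] norm_triangle_ineq4[of "G i x" "G j x"] by (simp add: add_increasing)
      next
        case False
        then have sq: "(norm (G i x - G j x))\<^sup>2 \<le> 4 * R ^ 3 * D x" using x by (intro DR) (auto simp: B_def)
        have "norm (G i x - G j x) \<le> d + (norm (G i x - G j x))\<^sup>2 / d"
        proof (cases "norm (G i x - G j x) \<le> d")
          case False
          then have "norm (G i x - G j x) * d \<le> (norm (G i x - G j x))\<^sup>2"
            unfolding power2_eq_square by (intro mult_left_mono) auto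
          then have "norm (G i x - G j x) \<le> (norm (G i x - G j x))\<^sup>2 / d" using d by (simp add: field_simps)
          then show ?thesis using d by simp
        qed (use d in \<open>simp add: add_increasing2\<close>)
        also have "\<dots> \<le> d + (4 * R ^ 3 * D x) / d" using sq d by (simp add: divide_right_mono)
        finally show ?thesis using False by (simp add: L_def)
      qed
      have "(\<integral>x. norm (G i x - G j x) \<partial>M) \<le> (\<integral>x. d + L * D x + (indicator B x * norm (G i x) + indicator B x * norm (G j x)) \<partial>M)"
        by (rule integral_mono) (use int Gz Dint iB pt in auto)
      also have "\<dots> = d * measure M (space M) + L * (\<integral>x. D x \<partial>M)
          + ((\<integral>x. indicator B x * norm (G i x) \<partial>M) + (\<integral>x. indicator B x * norm (G j x) \<partial>M))"
        using Dint iB[OF Gz(1)] iB[OF Gz(2)] by simp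
      also have "\<dots> < e / 8 + e / 8 + (e / 4 + e / 4)"
        using d(2) ID IB[OF Gz(1)] IB[OF Gz(2)] by linarith
      finally show ?thesis using e by simp
    qed
    then show ?thesis by blast
  qed
  then obtain r g where rg: "strict_mono r" "integrable M g" "(\<lambda>n. \<integral>x. norm (G (r n) x - g x) \<partial>M) \<longlonglongrightarrow> 0"
    "AE x in M. (\<lambda>n. G (r n) x) \<longlonglongrightarrow> g x"
    using L1_Cauchy_limit[of G, OF int[OF H0[OF G(1)]]] by blast
  \<comment> \<open>Passing to a subsequence only moves further into the decreasing families, since
    \<open>r n \<ge> n\<close>.\<close>
  have "G (r n) \<in> H n" for n using G(1)[of "r n"] dec[OF seq_suble[OF rg(1)]] by blast
  then show thesis using that[of "\<lambda>n. G (r n)" g] rg by blast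
qed

section \<open>Convex integrands\<close>

text \<open>Approximate the pair \<open>(x, v)\<close> by simple functions. Each approximation uses
  finitely many sections of \<open>L\<close>, which are measurable; continuity gives the limit for
  almost every \<open>t\<close>, and completeness does the rest.\<close>

lemma caratheodory_borel_measurable:
  fixes L :: "real \<Rightarrow> real ^ 'n \<Rightarrow> real ^ 'n \<Rightarrow> real" and x v :: "real \<Rightarrow> real ^ 'n"
  assumes L: "caratheodory L"
    and [measurable]: "x \<in> borel_measurable (lebesgue_on {0..})" "v \<in> borel_measurable (lebesgue_on {0..})"
  shows "(\<lambda>t. L t (x t) (v t)) \<in> borel_measurable (lebesgue_on {0..})"
proof -
  let ?M = "lebesgue_on {0::real..}"
  define w where "w = (\<lambda>t. (x t, v t))"
  have "w \<in> borel_measurable ?M" unfolding w_def by measurable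
  then obtain F where F: "\<And>i. simple_function ?M (F i)" "\<And>t. t \<in> space ?M \<Longrightarrow> (\<lambda>i. F i t) \<longlonglongrightarrow> w t"
    using borel_measurable_implies_sequence_metric[of w ?M "(0, 0)"] by metis
  have [measurable]: "(\<lambda>t. L t (fst (F i t)) (snd (F i t))) \<in> borel_measurable ?M" for i
  proof (rule measurable_compose_countable'[where I="F i ` space ?M" and f="\<lambda>p t. L t (fst p) (snd p)"])
    have fin: "finite (F i ` space ?M)" using F(1) by (rule simple_functionD)
    then show "countable (F i ` space ?M)" by (rule countable_finite)
    show "F i \<in> measurable ?M (count_space (F i ` space ?M))"
      unfolding measurable_count_space_eq2[OF fin] using simple_functionD(2)[OF F(1)[of i]] by auto
    show "(\<lambda>t. L t (fst p) (snd p)) \<in> borel_measurable ?M" for p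
      using L unfolding caratheodory_def by blast
  qed
  have lim: "AE t in ?M. lim (\<lambda>i. L t (fst (F i t)) (snd (F i t))) = L t (x t) (v t)"
  proof -
    have "AE t in ?M. t \<in> space ?M \<and> continuous_on UNIV (\<lambda>(x, y). L t x y)"
      by (intro eventually_conj AE_space L[unfolded caratheodory_def, THEN conjunct2])
    then show ?thesis
    proof eventually_elim
      case (elim t)
      then have "isCont (\<lambda>(x, y). L t x y) (w t)" by (simp add: continuous_on_eq_continuous_at w_def)
      then have "(\<lambda>i. (\<lambda>(x, y). L t x y) (F i t)) \<longlonglongrightarrow> (\<lambda>(x, y). L t x y) (w t)"
        by (rule isCont_tendsto_compose[OF _ F(2)[OF elim[THEN conjunct1]]])
      then show ?case by (intro limI) (simp add: w_def case_prod_beta)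
    qed
  qed
  have "(\<lambda>t. lim (\<lambda>i. L t (fst (F i t)) (snd (F i t)))) \<in> borel_measurable ?M"
    by (rule borel_measurable_lim_metric) measurable
  then show ?thesis by (rule borel_measurable_lebesgue_on_AE[OF _ _ lim]) simp
qed

text \<open>Separate the closed convex epigraph from the point \<open>(v, F v - e)\<close> strictly
  below it. The gap \<open>e\<close> makes the separation strict, and comparison with
  \<open>(v, F v)\<close> shows that the hyperplane is not vertical.\<close>

lemma convex_affine_minorant:
  fixes F :: "'a::euclidean_space \<Rightarrow> real"
  assumes F: "convex_on UNIV F" "continuous_on UNIV F" and e: "e > 0"
  obtains p where "\<And>y. F v - e + p \<bullet> (y - v) \<le> F y"
proof -
  have "convex (epigraph UNIV F)" using F(1) by (simp add: convex_epigraph)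
  moreover have "closed (epigraph UNIV F)"
    unfolding epigraph_def using F(2)
    by (auto intro!: closed_Collect_le continuous_intros continuous_on_compose2[OF F(2)])
  moreover have "(v, F v - e) \<notin> epigraph UNIV F" using e by (simp add: epigraph_def)
  ultimately obtain a q b where ab: "(a, q) \<bullet> (v, F v - e) < b" "\<And>z. z \<in> epigraph UNIV F \<Longrightarrow> (a, q) \<bullet> z > b"
    using separating_hyperplane_closed_point[of "epigraph UNIV F" "(v, F v - e)"] by (metis surj_pair)
  have sep: "a \<bullet> v + q * (F v - e) < a \<bullet> y + q * F y" for y
    using ab(1) ab(2)[of "(y, F y)"] by (simp add: epigraph_def)
  have q: "q > 0" using sep[of v] e by (simp add: algebra_simps zero_less_mult_iff)
  have "F v - e + (- (1 / q) *\<^sub>R a) \<bullet> (y - v) \<le> F y" for y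
    using sep[of y] q by (simp add: field_simps inner_diff_right)
  then show thesis using that by blast
qed

text \<open>Superlinear growth takes care of large \<open>y\<close>, uniform continuity of the remaining compact set.\<close>

lemma affine_minorant_stable:
  fixes F :: "'a::euclidean_space \<Rightarrow> 'a \<Rightarrow> real"
  assumes cont: "continuous_on UNIV (\<lambda>(x, y). F x y)"
    and growth: "\<And>m. \<exists>R. \<forall>x y. m * norm y \<le> R + F x y"
    and minor: "\<And>y. c + p \<bullet> y \<le> F x y" and e: "e > 0"
  obtains d where "d > 0" "\<And>x' y. dist x' x < d \<Longrightarrow> c + p \<bullet> y - e \<le> F x' y"
proof -
  \<comment> \<open>Growth with slope \<open>norm p + 1\<close> exceeds that of the affine function
    by \<open>norm y\<close>, which outweighs the constants once \<open>norm y\<close> is larger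
    than \<open>\<bar>R + c\<bar>\<close>. The compact set \<open>?K\<close> contains all remaining
    \<open>y\<close>.\<close>
  obtain R where R: "\<And>x y. (norm p + 1) * norm y \<le> R + F x y" using growth by blast
  let ?K = "cball x 1 \<times> cball (0::'a) \<bar>R + c\<bar>"
  have "uniformly_continuous_on ?K (\<lambda>(x, y). F x y)"
    by (intro compact_uniformly_continuous continuous_on_subset[OF cont] compact_Times compact_cball) auto
  then obtain d where d: "d > 0"
    "\<And>z z'. z \<in> ?K \<Longrightarrow> z' \<in> ?K \<Longrightarrow> dist z' z < d \<Longrightarrow> dist (case z' of (x, y) \<Rightarrow> F x y) (case z of (x, y) \<Rightarrow> F x y) < e"
    unfolding uniformly_continuous_on_def using e by blast
  have "c + p \<bullet> y - e \<le> F x' y" if x': "dist x' x < min d 1" for x' y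
  proof (cases "norm y \<le> \<bar>R + c\<bar>")
    case True
    then have "dist (F x' y) (F x y) < e"
      using d(2)[of "(x, y)" "(x', y)"] x' by (auto simp: dist_Pair_Pair dist_commute)
    then show ?thesis using minor[of y] by (auto simp: dist_real_def)
  next
    case False
    have "p \<bullet> y \<le> norm p * norm y" by (rule norm_cauchy_schwarz)
    moreover have "norm p * norm y + norm y \<le> R + F x' y" using R[of y x'] by (simp add: algebra_simps)
    ultimately show ?thesis using False e by linarith
  qed
  then show thesis using that[of "min d 1"] d(1) by simp
qed

text \<open>The last hypothesis is all that is retained of \<open>V n\<close> and
  \<open>\<Phi> n\<close> being the same convex combination of velocities and values from the tail.
  An almost exact affine minorant at \<open>(x, v)\<close> holds, slightly lowered, along a whole
  tail, so it transfers to \<open>\<Phi> n\<close>. The three thirds of \<open>e\<close> pay for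
  separation, stability and the convergence of \<open>V\<close>.\<close>

lemma convex_integrand_liminf:
  fixes F :: "'a::euclidean_space \<Rightarrow> 'a \<Rightarrow> real" and \<Phi> :: "nat \<Rightarrow> real"
  assumes cont: "continuous_on UNIV (\<lambda>(x, y). F x y)" and convex: "convex_on UNIV (F x)"
    and growth: "\<And>m. \<exists>R. \<forall>x y. m * norm y \<le> R + F x y"
    and xi: "xi \<longlonglongrightarrow> x" and V: "V \<longlonglongrightarrow> v"
    and \<Phi>: "\<And>n c p. (\<And>i. i \<ge> n \<Longrightarrow> c + p \<bullet> vi i \<le> F (xi i) (vi i)) \<Longrightarrow> c + p \<bullet> V n \<le> \<Phi> n"
  shows "ennreal (F x v) \<le> liminf (\<lambda>n. ennreal (\<Phi> n))"
proof -
  have ev: "\<forall>\<^sub>F n in sequentially. F x v - e \<le> \<Phi> n" if e: "e > 0" for e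
  proof -
    have "continuous_on UNIV (F x)"
      using continuous_on_compose2[OF cont, of UNIV "\<lambda>y. (x, y)"] by (simp add: continuous_on_Pair)
    then obtain p where "\<And>y. F x v - e / 3 + p \<bullet> (y - v) \<le> F x y"
      using convex_affine_minorant[OF convex, of "e / 3" v] e by auto
    then have p: "F x v - e / 3 - p \<bullet> v + p \<bullet> y \<le> F x y" for y by (simp add: inner_diff_right add_diff_eq diff_add_eq)
    obtain d where d: "d > 0" "\<And>x' y. dist x' x < d \<Longrightarrow> F x v - e / 3 - p \<bullet> v + p \<bullet> y - e / 3 \<le> F x' y"
      using affine_minorant_stable[OF cont growth p, of "e / 3"] e by auto
    obtain N where N: "\<And>i. i \<ge> N \<Longrightarrow> dist (xi i) x < d" using metric_LIMSEQ_D[OF xi d(1)] by blast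
    have low: "F x v - 2 * e / 3 - p \<bullet> v + p \<bullet> V n \<le> \<Phi> n" if "n \<ge> N" for n
    proof (rule \<Phi>)
      fix i assume "i \<ge> n"
      then show "F x v - 2 * e / 3 - p \<bullet> v + p \<bullet> vi i \<le> F (xi i) (vi i)"
        using d(2)[OF N[of i], of "vi i"] that by simp
    qed
    have "(\<lambda>n. p \<bullet> V n) \<longlonglongrightarrow> p \<bullet> v" by (intro tendsto_intros V)
    then have "\<forall>\<^sub>F n in sequentially. p \<bullet> V n > p \<bullet> v - e / 3" by (rule order_tendstoD) (use e in simp)
    with eventually_ge_at_top[of N] show ?thesis
    proof eventually_elim
      case (elim n)
      then show ?case using low[of n] by simp
    qed
  qed
  have "ennreal (F x v) \<le> liminf (\<lambda>n. ennreal (\<Phi> n)) + ennreal e" if e: "e > 0" for e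
  proof -
    have "ennreal (F x v - e) \<le> liminf (\<lambda>n. ennreal (\<Phi> n))"
      by (rule Liminf_bounded) (use ev[OF e] in \<open>auto elim!: eventually_mono intro: ennreal_leI\<close>)
    then have "ennreal (F x v - e) + ennreal e \<le> liminf (\<lambda>n. ennreal (\<Phi> n)) + ennreal e"
      by (rule add_right_mono)
    moreover have "ennreal (F x v) \<le> ennreal (F x v - e) + ennreal e"
      \<comment> \<open>If \<open>F x v\<close> is below \<open>e\<close>, the truncated difference
        is 0 and \<open>e\<close> alone suffices.\<close>
      using e by (cases "F x v \<ge> e") (simp_all add: ennreal_plus[symmetric] ennreal_leI ennreal_neg del: ennreal_plus)
    ultimately show ?thesis by (rule order_trans[rotated])
  qed
  then show ?thesis by (rule ennreal_le_epsilon)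
qed

section \<open>Minimizing sequences\<close>

lemma norm_integral_le_mu:
  fixes v :: "real \<Rightarrow> 'b::euclidean_space"
  assumes v: "integrable (mu r) v" and r: "r > 0" and ab: "0 \<le> a"
  shows "norm (integral {a..b} v) \<le> exp (r * b) * (\<integral>t. indicator {a..b} t * norm (v t) \<partial>mu r)"
proof -
  have i: "integrable (mu r) (\<lambda>t. indicator {a..b} t * norm (v t))"
    using integrable_real_mult_indicator[of "{a..b}" "mu r", OF _ integrable_norm[OF v]] ab
    by (simp add: sets_restrict_space_iff mult.commute)
  have "norm (integral {a..b} v) \<le> integral {a..b} (\<lambda>t. norm (v t))"
    using set_integrable_mu_imp(1)[OF v ab, of b]
    by (intro integral_norm_bound_integral) (auto simp: absolutely_integrable_on_def)
  also have "\<dots> = (\<integral>t. indicator {a..b} t * (exp (r * t) * norm (v t)) \<partial>mu r)"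
    by (rule set_integrable_mu_imp(2)[OF v ab])
  also have "\<dots> \<le> (\<integral>t. exp (r * b) * (indicator {a..b} t * norm (v t)) \<partial>mu r)"
  proof (rule integral_mono[OF set_integrable_mu_imp(3)[OF v ab] integrable_mult_right[OF i]])
    fix t
    show "indicator {a..b} t * (exp (r * t) * norm (v t)) \<le> exp (r * b) * (indicator {a..b} t * norm (v t))"
      using r by (cases "t \<in> {a..b}") (auto intro!: mult_right_mono)
  qed
  also have "\<dots> = exp (r * b) * (\<integral>t. indicator {a..b} t * norm (v t) \<partial>mu r)" by simp
  finally show ?thesis .
qed

lemma measure_mu_Icc_le:
  assumes r: "r > 0" and ab: "0 \<le> a" "a \<le> b"
  shows "measure (mu r) {a..b} \<le> b - a"
proof -
  have s: "{a..b} \<in> sets (mu r)" using ab by (simp add: sets_restrict_space_iff)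
  then have "emeasure (mu r) {a..b} = (\<integral>\<^sup>+t. ennreal (exp (- r * t)) * indicator {a..b} t \<partial>lebesgue_on {0..})"
    using exp_measurable_lebesgue_on[of r] unfolding mu_def by (subst emeasure_density) auto
  also have "\<dots> \<le> (\<integral>\<^sup>+t. indicator {a..b} t \<partial>lebesgue_on {0..})"
    using r by (intro nn_integral_mono) (auto simp: indicator_def)
  also have "\<dots> = emeasure (lebesgue_on {0..}) {a..b}"
    using s by (subst nn_integral_indicator) auto
  also have "\<dots> = ennreal (b - a)" using ab by (subst emeasure_restrict_space) auto
  finally have "emeasure (mu r) {a..b} \<le> ennreal (b - a)" .
  then show ?thesis using ab by (simp add: measure_def enn2real_leI)
qed

text \<open>Uniform integrability of the derivatives makes the \<open>x k\<close> equicontinuous, so it is enough to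
  extract a subsequence that converges at all rational times.\<close>

lemma pointwise_convergent_subsequence:
  fixes x v :: "nat \<Rightarrow> real \<Rightarrow> 'b::euclidean_space"
  assumes r: "r > 0" and p: "\<And>k. primitive r (x k) (v k)" and x0: "\<And>k. x k 0 = \<eta>"
    and UI: "\<And>e. e > 0 \<Longrightarrow> \<exists>K. \<forall>k. \<forall>A\<in>sets (mu r). (\<integral>t. indicator A t * norm (v k t) \<partial>mu r) \<le> e + K * measure (mu r) A"
  obtains \<sigma> :: "nat \<Rightarrow> nat" and \<xi> where "strict_mono \<sigma>" "\<And>t. t \<ge> 0 \<Longrightarrow> (\<lambda>k. x (\<sigma> k) t) \<longlonglongrightarrow> \<xi> t"
proof -
  interpret finite_measure "mu r" by (rule finite_measure_mu[OF r])
  have ab_sets: "{a..b} \<in> sets (mu r)" if "0 \<le> a" for a b using that by (simp add: sets_restrict_space_iff)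
  have inc: "x k t - x k s = integral {s..t} (v k)" if "0 \<le> s" "s \<le> t" for k s t
  proof -
    have "integral {0..s} (v k) + integral {s..t} (v k) = integral {0..t} (v k)"
      by (rule Henstock_Kurzweil_Integration.integral_combine[OF that primitive_integrable_on[OF p]]) simp
    moreover have "x k t = x k 0 + integral {0..t} (v k)" "x k s = x k 0 + integral {0..s} (v k)"
      using that by (auto intro!: primitive_eq[OF p])
    ultimately show ?thesis by (metis add_diff_cancel_left add_diff_cancel_left')
  qed
  obtain K1 where K1: "\<And>k A. A \<in> sets (mu r) \<Longrightarrow> (\<integral>t. indicator A t * norm (v k t) \<partial>mu r) \<le> 1 + K1 * measure (mu r) A"
    using UI[of 1] by auto
  define C where "C = norm \<eta> + (1 + \<bar>K1\<bar> * measure (mu r) (space (mu r)))"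
  \<comment> \<open>The diagonal extraction asks for one bound valid at all times. The factor
    \<open>exp (- r * t)\<close> provides it, cancelling the growth of the estimate for the
    increment over \<open>{0..t}\<close>; it is removed again at each fixed time.\<close>
  have bound: "norm (exp (- r * t) *\<^sub>R x k t) \<le> C" if t: "t \<ge> 0" for k t
  proof -
    have "K1 * measure (mu r) {0..t} \<le> \<bar>K1\<bar> * measure (mu r) (space (mu r))"
      by (intro mult_mono bounded_measure) auto
    then have I: "(\<integral>s. indicator {0..t} s * norm (v k s) \<partial>mu r) \<le> 1 + \<bar>K1\<bar> * measure (mu r) (space (mu r))"
      using K1[OF ab_sets[of 0 t], of k] by simp
    have "norm (x k t - \<eta>) \<le> exp (r * t) * (\<integral>s. indicator {0..t} s * norm (v k s) \<partial>mu r)"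
      using inc[of 0 t k] t x0[of k] norm_integral_le_mu[OF primitive_integrable[OF p[of k]] r, of 0 t] by simp
    also have "\<dots> \<le> exp (r * t) * (1 + \<bar>K1\<bar> * measure (mu r) (space (mu r)))"
      using I by (intro mult_left_mono) auto
    finally have "exp (- r * t) * norm (x k t - \<eta>) \<le> exp (- r * t) * (exp (r * t) * (1 + \<bar>K1\<bar> * measure (mu r) (space (mu r))))"
      by (intro mult_left_mono) auto
    also have "\<dots> = (exp (- r * t) * exp (r * t)) * (1 + \<bar>K1\<bar> * measure (mu r) (space (mu r)))"
      by (rule mult.assoc[symmetric])
    also have "exp (- r * t) * exp (r * t) = 1" by (simp flip: exp_add)
    finally have 1: "exp (- r * t) * norm (x k t - \<eta>) \<le> 1 + \<bar>K1\<bar> * measure (mu r) (space (mu r))" by simp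
    have 2: "exp (- r * t) * norm \<eta> \<le> norm \<eta>" using r t by (simp add: mult_left_le_one_le)
    have "exp (- r * t) * norm (x k t) \<le> exp (- r * t) * (norm \<eta> + norm (x k t - \<eta>))"
      using norm_triangle_sub[of "x k t" \<eta>] by (intro mult_left_mono) auto
    then show ?thesis using 1 2 by (simp add: C_def distrib_left)
  qed
  obtain \<sigma> where \<sigma>: "strict_mono \<sigma>"
    "\<And>t. t \<in> \<rat> \<inter> {0..} \<Longrightarrow> \<exists>l. (\<lambda>k. exp (- r * t) *\<^sub>R x (\<sigma> k) t) \<longlonglongrightarrow> l"
    by (rule function_convergent_subsequence[of "\<rat> \<inter> {0..}" "\<lambda>k t. exp (- r * t) *\<^sub>R x k t" C])
       (use bound countable_rat in auto)
  have "convergent (\<lambda>k. x (\<sigma> k) t)" if t: "t \<ge> 0" for t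
  proof (rule Cauchy_convergent, rule metric_CauchyI)
    fix e :: real assume e: "e > 0"
    \<comment> \<open>\<open>E\<close> bounds \<open>exp (r * q)\<close> for every \<open>q\<close>
      up to \<open>t + 1\<close>, hence the restriction \<open>d \<le> 1\<close> below.\<close>
    define E where "E = exp (r * (t + 1))"
    have E: "E > 0" by (simp add: E_def)
    obtain K0 where K0: "\<And>k A. A \<in> sets (mu r) \<Longrightarrow> (\<integral>s. indicator A s * norm (v k s) \<partial>mu r) \<le> e / (6 * E) + K0 * measure (mu r) A"
      using UI[of "e / (6 * E)"] e E by (metis divide_pos_pos mult_pos_pos zero_less_numeral)
    define K where "K = max K0 1"
    have K: "K \<ge> 1" "K0 \<le> K" by (simp_all add: K_def)
    define d where "d = min 1 (e / (6 * E * K))"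
    have d: "d > 0" "d \<le> 1" "E * (K * d) \<le> e / 6"
    proof -
      have "E * (K * d) \<le> E * (K * (e / (6 * E * K)))" using E K by (intro mult_left_mono) (auto simp: d_def)
      also have "\<dots> = e / 6" using E K by simp
      finally show "E * (K * d) \<le> e / 6" .
    qed (use e E K in \<open>auto simp: d_def\<close>)
    \<comment> \<open>A rational time to the right of \<open>t\<close> exists also for
      \<open>t = 0\<close>.\<close>
    obtain q where q: "q \<in> \<rat>" "t < q" "q < t + d" using Rats_dense_in_real[of t "t + d"] d by auto
    have near: "norm (x k q - x k t) \<le> e / 3" for k
    proof -
      have "norm (x k q - x k t) \<le> exp (r * q) * (\<integral>s. indicator {t..q} s * norm (v k s) \<partial>mu r)"
        using inc[of t q k] t q norm_integral_le_mu[OF primitive_integrable[OF p[of k]] r t, of q] by simp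
      also have "\<dots> \<le> E * (e / (6 * E) + K * d)"
      proof (rule mult_mono)
        show "exp (r * q) \<le> E" using q d r by (simp add: E_def)
        have "K0 * measure (mu r) {t..q} \<le> K * measure (mu r) {t..q}" using K by (intro mult_right_mono) auto
        also have "\<dots> \<le> K * d" using measure_mu_Icc_le[OF r t, of q] q K by (intro mult_left_mono) auto
        finally show "(\<integral>s. indicator {t..q} s * norm (v k s) \<partial>mu r) \<le> e / (6 * E) + K * d"
          using K0[OF ab_sets[OF t, of q], of k] by simp
        show "0 \<le> (\<integral>s. indicator {t..q} s * norm (v k s) \<partial>mu r)" by simp
      qed (use E in simp)
      also have "\<dots> = e / 6 + E * (K * d)" using E by (simp add: distrib_left)
      also have "\<dots> \<le> e / 3" using d(3) by simp
      finally show ?thesis .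
    qed
    have "q \<in> \<rat> \<inter> {0..}" using q t by simp
    then obtain l where "(\<lambda>k. exp (- r * q) *\<^sub>R x (\<sigma> k) q) \<longlonglongrightarrow> l" using \<sigma>(2) by blast
    then have "(\<lambda>k. exp (r * q) *\<^sub>R exp (- r * q) *\<^sub>R x (\<sigma> k) q) \<longlonglongrightarrow> exp (r * q) *\<^sub>R l" by (intro tendsto_intros)
    then have "(\<lambda>k. x (\<sigma> k) q) \<longlonglongrightarrow> exp (r * q) *\<^sub>R l" by (simp flip: exp_add)
    then have "Cauchy (\<lambda>k. x (\<sigma> k) q)" by (rule LIMSEQ_imp_Cauchy)
    then obtain N where N: "\<And>m n. m \<ge> N \<Longrightarrow> n \<ge> N \<Longrightarrow> dist (x (\<sigma> m) q) (x (\<sigma> n) q) < e / 3"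
      using e metric_CauchyD[of "\<lambda>k. x (\<sigma> k) q" "e / 3"] by auto
    have "dist (x (\<sigma> m) t) (x (\<sigma> n) t) < e" if "m \<ge> N" "n \<ge> N" for m n
    proof -
      have "dist (x (\<sigma> m) t) (x (\<sigma> n) t) \<le> dist (x (\<sigma> m) q) (x (\<sigma> m) t) + dist (x (\<sigma> m) q) (x (\<sigma> n) q) + dist (x (\<sigma> n) q) (x (\<sigma> n) t)"
        using dist_triangle[of "x (\<sigma> m) t" "x (\<sigma> n) t" "x (\<sigma> m) q"] dist_triangle[of "x (\<sigma> m) q" "x (\<sigma> n) t" "x (\<sigma> n) q"]
        by (simp add: dist_commute)
      also have "\<dots> < e" using near[of "\<sigma> m"] near[of "\<sigma> n"] N[OF that] by (simp add: dist_norm)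
      finally show ?thesis .
    qed
    then show "\<exists>M. \<forall>m\<ge>M. \<forall>n\<ge>M. dist (x (\<sigma> m) t) (x (\<sigma> n) t) < e" by blast
  qed
  then have "(\<lambda>k. x (\<sigma> k) t) \<longlonglongrightarrow> lim (\<lambda>k. x (\<sigma> k) t)" if "t \<ge> 0" for t
    using that by (simp add: convergent_LIMSEQ_iff)
  then show thesis using that[OF \<sigma>(1), of "\<lambda>t. lim (\<lambda>k. x (\<sigma> k) t)"] by blast
qed

section \<open>Coercivity, costs and admissible functions\<close>

lemma superlinear_growth:
  fixes \<rho> :: "'a::real_normed_vector \<Rightarrow> real" and L :: "real \<Rightarrow> 'b \<Rightarrow> 'a \<Rightarrow> real"
  assumes \<rho>: "filterlim (\<lambda>y. \<rho> y / norm y) at_top at_infinity"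
    and L0: "\<And>t x y. t \<ge> 0 \<Longrightarrow> L t x y \<ge> 0" and L: "\<And>t x y. t \<ge> 0 \<Longrightarrow> L t x y \<ge> \<rho> y"
  shows "\<exists>R\<ge>0. \<forall>t\<ge>0. \<forall>x y. m * norm y \<le> R + L t x y"
proof -
  have "\<forall>\<^sub>F y in at_infinity. m \<le> \<rho> y / norm y" using \<rho> by (simp add: filterlim_at_top)
  then obtain b where b: "\<And>y. norm y \<ge> b \<Longrightarrow> m \<le> \<rho> y / norm y" unfolding eventually_at_infinity by blast
  have "m * norm y \<le> \<bar>m\<bar> * \<bar>b\<bar> + L t x y" if t: "t \<ge> 0" for t x y
  \<comment> \<open>\<open>b\<close> may be nonpositive, and at \<open>y = 0\<close> the quotient is
    0 by convention; the nonnegativity of \<open>L\<close> settles that point.\<close>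
  proof (cases "norm y \<ge> b \<and> y \<noteq> 0")
    case True
    then have "m * norm y \<le> \<rho> y" using b[of y] by (simp add: field_simps)
    also have "\<dots> \<le> L t x y" by (rule L[OF t])
    finally show ?thesis by (simp add: add_increasing)
  next
    case False
    then have "m * norm y \<le> \<bar>m\<bar> * \<bar>b\<bar>" by (intro mult_mono) auto
    then show ?thesis using L0[OF t, of x y] by simp
  qed
  then show ?thesis by (intro exI[of _ "\<bar>m\<bar> * \<bar>b\<bar>"]) auto
qed

text \<open>Moves the weight into the measure and replaces the chosen derivative by the explicit
  one, which changes the integrand only on a null set.\<close>

lemma cost_primitive:
  fixes x v :: "real \<Rightarrow> real ^ 'n"
  assumes r: "r > 0" and p: "primitive r x v" and L: "caratheodory L"
  shows "cost r L x = (\<integral>\<^sup>+t. ennreal (L t (x t) (v t)) \<partial>mu r)"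
    and "(\<lambda>t. L t (x t) (v t)) \<in> borel_measurable (mu r)"
proof -
  have "x \<in> borel_measurable (mu r)" "v \<in> borel_measurable (mu r)"
    using continuous_on_measurable_mu[OF primitive_continuous[OF p]] primitive_integrable[OF p] by auto
  then show m: "(\<lambda>t. L t (x t) (v t)) \<in> borel_measurable (mu r)"
    using caratheodory_borel_measurable[OF L] by (simp only: measurable_cong_sets[OF sets_mu refl])
  have "cost r L x = (\<integral>\<^sup>+t. ennreal (exp (- r * t)) * ennreal (L t (x t) (v t)) \<partial>lebesgue_on {0..})"
    unfolding cost_def
  proof (rule nn_integral_cong_AE)
    show "AE t in lebesgue_on {0..}. ennreal (exp (- r * t) * L t (x t) (distr_deriv x t))
        = ennreal (exp (- r * t)) * ennreal (L t (x t) (v t))"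
      using distr_deriv_primitive[OF r p] unfolding AE_mu_iff
      by (auto elim!: eventually_mono simp: ennreal_mult')
  qed
  also have "\<dots> = (\<integral>\<^sup>+t. ennreal (L t (x t) (v t)) \<partial>mu r)"
    by (rule nn_integral_mu[symmetric]) (use m in measurable)
  finally show "cost r L x = (\<integral>\<^sup>+t. ennreal (L t (x t) (v t)) \<partial>mu r)" .
qed

lemma admissibleE:
  fixes x0 y :: "real \<Rightarrow> real ^ 'n"
  assumes r: "r > 0" and T: "T > 0" and x0: "x0 \<in> W11 r" and y: "y \<in> admissible r T x0"
  obtains v where "primitive r y v" "y 0 = x0 0" "(\<lambda>t. y t - x0 t) \<in> W11_0 r T"
proof -
  obtain h where h: "h \<in> W11_0 r T" "y = (\<lambda>t. x0 t + h t)" using y unfolding admissible_def by blast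
  then have "h \<in> W11 r" by (simp add: W11_0_def)
  then have "y \<in> W11 r" using W11_add(1)[OF r x0] h(2) by simp
  moreover have "y 0 = x0 0" using W11_0_at_0[OF r T h(1)] h(2) by simp
  moreover have "(\<lambda>t. y t - x0 t) \<in> W11_0 r T" using h by simp
  ultimately show thesis using that W11_primitive by metis
qed

lemma half_sum: "(1/2) *\<^sub>R a + (1/2) *\<^sub>R a = (a :: 'a::real_vector)"
  by (simp flip: scaleR_add_left)

text \<open>The de la Vallee-Poussin argument: integrating
  \<open>m * norm (v t) \<le> R + L t (x t) (v t)\<close> over \<open>A\<close> and dividing by
  \<open>m\<close> leaves \<open>C / m\<close> plus a multiple of the measure of \<open>A\<close>.
  The resulting \<open>K\<close> depends on neither \<open>x\<close> nor \<open>v\<close>.\<close>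

lemma uniformly_integrable_if_coercive:
  fixes L :: "real \<Rightarrow> real ^ 'n \<Rightarrow> real ^ 'n \<Rightarrow> real"
  assumes r: "r > 0" and L0: "\<And>t x y. t \<ge> 0 \<Longrightarrow> L t x y \<ge> 0"
    and growth: "\<And>m. \<exists>R\<ge>0. \<forall>t\<ge>0. \<forall>x y. m * norm y \<le> R + L t x y"
    and C: "C \<ge> 0" and e: "e > 0"
  shows "\<exists>K. \<forall>x v. \<forall>A\<in>sets (mu r). integrable (mu r) v \<longrightarrow> (\<lambda>t. L t (x t) (v t)) \<in> borel_measurable (mu r) \<longrightarrow>
     (\<integral>\<^sup>+t. ennreal (L t (x t) (v t)) \<partial>mu r) \<le> ennreal C \<longrightarrow>
     (\<integral>t. indicator A t * norm (v t) \<partial>mu r) \<le> e + K * measure (mu r) A"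
proof -
  interpret finite_measure "mu r" by (rule finite_measure_mu[OF r])
  \<comment> \<open>Large enough for \<open>C / m \<le> e\<close>, and positive even when
    \<open>C = 0\<close>.\<close>
  define m where "m = (C + 1) / e"
  have m: "m > 0" "C / m \<le> e" using C e by (simp_all add: m_def field_simps)
  obtain R where R: "R \<ge> 0" "\<And>t x y. t \<ge> 0 \<Longrightarrow> m * norm y \<le> R + L t x y" using growth by blast
  show ?thesis
  proof (intro exI[of _ "R / m"] allI ballI impI)
    fix x v A assume A: "A \<in> sets (mu r)" and v: "integrable (mu r) v"
      and Lm: "(\<lambda>t. L t (x t) (v t)) \<in> borel_measurable (mu r)"
      and LC: "(\<integral>\<^sup>+t. ennreal (L t (x t) (v t)) \<partial>mu r) \<le> ennreal C"
    have Ae: "AE t in mu r. 0 \<le> L t (x t) (v t)" using L0 by (intro AE_I2) simp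
    have Li: "integrable (mu r) (\<lambda>t. L t (x t) (v t))"
      by (rule integrableI_nonneg[OF Lm Ae]) (use LC in \<open>auto intro: le_less_trans\<close>)
    have "ennreal (\<integral>t. L t (x t) (v t) \<partial>mu r) \<le> ennreal C"
      using LC nn_integral_eq_integral[OF Li Ae] by simp
    then have LI: "(\<integral>t. L t (x t) (v t) \<partial>mu r) \<le> C" using C by simp
    have iA: "integrable (mu r) (\<lambda>t. indicator A t * norm (v t))"
      using integrable_real_mult_indicator[OF A integrable_norm[OF v]] by (simp add: mult.commute)
    have iR: "integrable (mu r) (\<lambda>t. (R / m) * indicator A t)"
      by (intro integrable_mult_right integrable_real_indicator A) (metis emeasure_finite infinity_ennreal_def less_top)
    have "(\<integral>t. indicator A t * norm (v t) \<partial>mu r) \<le> (\<integral>t. (R / m) * indicator A t + (1 / m) * L t (x t) (v t) \<partial>mu r)"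
    proof (rule integral_mono[OF iA])
      show "integrable (mu r) (\<lambda>t. (R / m) * indicator A t + (1 / m) * L t (x t) (v t))"
        by (intro Bochner_Integration.integrable_add iR integrable_mult_right Li)
      fix t assume "t \<in> space (mu r)"
      then have t: "t \<ge> 0" by simp
      have "norm (v t) \<le> R / m + (1 / m) * L t (x t) (v t)"
        using R(2)[OF t, of "v t" "x t"] m by (simp add: field_simps)
      moreover have "0 \<le> (1 / m) * L t (x t) (v t)" using L0[OF t] m by simp
      ultimately show "indicator A t * norm (v t) \<le> (R / m) * indicator A t + (1 / m) * L t (x t) (v t)"
        by (cases "t \<in> A") simp_all
    qed
    also have "\<dots> = (\<integral>t. (R / m) * indicator A t \<partial>mu r) + (\<integral>t. (1 / m) * L t (x t) (v t) \<partial>mu r)"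
      by (intro Bochner_Integration.integral_add iR integrable_mult_right Li)
    also have "\<dots> = (R / m) * measure (mu r) A + (1 / m) * (\<integral>t. L t (x t) (v t) \<partial>mu r)"
      using sets.sets_into_space[OF A] by (simp add: Int_absorb1 Int_absorb2)
    also have "(1 / m) * (\<integral>t. L t (x t) (v t) \<partial>mu r) \<le> (1 / m) * C" using LI m by (intro mult_left_mono) auto
    also have "(1 / m) * C \<le> e" using m(2) by simp
    finally show "(\<integral>t. indicator A t * norm (v t) \<partial>mu r) \<le> e + R / m * measure (mu r) A" by simp
  qed
qed

section \<open>Existence of a minimizer\<close>

theorem theorem4p2:
  fixes r T :: real
    and \<eta> :: "real ^ 'n"
    and x0 :: "real \<Rightarrow> real ^ 'n"
    and L :: "real \<Rightarrow> real ^ 'n \<Rightarrow> real ^ 'n \<Rightarrow> real"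
  assumes "r > 0" and "T > 0"
    and "x0 \<in> W11 r \<inter> P0_closure r T" and "x0 0 = \<eta>"
    and "\<And>t x y. t \<ge> 0 \<Longrightarrow> L t x y \<ge> 0"
    and "caratheodory L"
    and "AE t in lebesgue_on {0..}. \<forall>x. convex_on UNIV (L t x)"
    and "\<exists>\<rho> :: real ^ 'n \<Rightarrow> real.
           (\<forall>y. \<rho> y \<ge> 0) \<and>
           filterlim (\<lambda>y. \<rho> y / norm y) at_top at_infinity \<and>
           (\<forall>t\<ge>0. \<forall>x y. L t x y \<ge> \<rho> y)"
    and "\<exists>x \<in> admissible r T x0. cost r L x < \<infinity>"
  shows "\<exists>x \<in> admissible r T x0. \<forall>y \<in> admissible r T x0. cost r L x \<le> cost r L y"
proof -
  note r = \<open>r > 0\<close> and T = \<open>T > 0\<close> and L0 = assms(5) and car = \<open>caratheodory L\<close>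
  have x0W: "x0 \<in> W11 r" using assms(3) by simp
  interpret finite_measure "mu r" by (rule finite_measure_mu[OF r])
  have growth: "\<exists>R\<ge>0. \<forall>t\<ge>0. \<forall>x y. m * norm y \<le> R + L t x y" for m
    using assms(8) by (elim exE conjE) (rule superlinear_growth, assumption, rule L0, assumption, blast)
  define I where "I = (INF y\<in>admissible r T x0. cost r L y)"
  have Ifin: "I < \<infinity>" using assms(9) unfolding I_def by (auto simp: INF_less_iff)
  \<comment> \<open>A decreasing cost allowance with limit \<open>I\<close>. A bound by
    \<open>c n\<close> is preserved by averaging over the tail from \<open>n\<close>, and
    \<open>c 0\<close> caps all costs.\<close>
  define c where "c = (\<lambda>n. I + ennreal (1 / real (Suc n)))"
  have "\<exists>y\<in>admissible r T x0. cost r L y < c n" for n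
  proof -
    have "I < c n" using Ifin unfolding c_def by (cases I) (auto simp: ennreal_plus[symmetric] ennreal_less_iff simp del: ennreal_plus)
    then show ?thesis by (simp add: I_def INF_less_iff)
  qed
  then obtain Y where Y: "\<And>n. Y n \<in> admissible r T x0" "\<And>n. cost r L (Y n) < c n" by metis
  have "\<exists>v. primitive r (Y n) v \<and> Y n 0 = \<eta> \<and> (\<lambda>t. Y n t - x0 t) \<in> W11_0 r T" for n
    using admissibleE[OF r T x0W Y(1)[of n]] assms(4) by metis
  then obtain w where w: "\<And>n. primitive r (Y n) (w n)" "\<And>n. Y n 0 = \<eta>" "\<And>n. (\<lambda>t. Y n t - x0 t) \<in> W11_0 r T"
    by metis
  have c_mono: "c n \<le> c m" if "m \<le> n" for m n
    unfolding c_def using that by (intro add_left_mono ennreal_leI) (simp add: frac_le)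
  have c_lim: "c \<longlonglongrightarrow> I"
  proof -
    have "(\<lambda>n. ennreal (1 / real (Suc n))) \<longlonglongrightarrow> ennreal 0"
      by (intro tendsto_ennrealI LIMSEQ_Suc[OF lim_const_over_n])
    then have "(\<lambda>n. I + ennreal (1 / real (Suc n))) \<longlonglongrightarrow> I + ennreal 0"
      by (intro tendsto_add tendsto_const)
    then show ?thesis by (simp add: c_def[abs_def])
  qed
  obtain C where C: "C \<ge> 0" "c 0 = ennreal C"
  proof
    show "c 0 = ennreal (enn2real (c 0))" using Ifin unfolding c_def by simp
  qed simp
  \<comment> \<open>Named so that \<open>K\<close> can be chosen as a function of \<open>e\<close>
    alone; the same \<open>K\<close> must serve the sequence and all its combinations.\<close>
  define UI where "UI = (\<lambda>e K. \<forall>x v. \<forall>A\<in>sets (mu r). integrable (mu r) v \<longrightarrow> (\<lambda>t. L t (x t) (v t)) \<in> borel_measurable (mu r) \<longrightarrow>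
     (\<integral>\<^sup>+t. ennreal (L t (x t) (v t)) \<partial>mu r) \<le> ennreal C \<longrightarrow>
     (\<integral>t. indicator A t * norm (v t) \<partial>mu r) \<le> e + K * measure (mu r) A)"
  have "\<exists>K. UI e K" if "e > 0" for e
    unfolding UI_def by (rule uniformly_integrable_if_coercive[OF r L0 growth C(1) that])
  then obtain K where UI: "\<And>e. e > 0 \<Longrightarrow> UI e (K e)" by metis
  have K: "(\<integral>t. indicator A t * norm (v t) \<partial>mu r) \<le> e + K e * measure (mu r) A"
    if "e > 0" "A \<in> sets (mu r)" "integrable (mu r) v" "(\<lambda>t. L t (x t) (v t)) \<in> borel_measurable (mu r)"
     "(\<integral>\<^sup>+t. ennreal (L t (x t) (v t)) \<partial>mu r) \<le> ennreal C" for e x v A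
    using UI[OF that(1), unfolded UI_def, rule_format, OF that(2-5)] .
  have wK: "(\<integral>t. indicator A t * norm (w n t) \<partial>mu r) \<le> e + K e * measure (mu r) A"
    if "e > 0" "A \<in> sets (mu r)" for e A n
  proof (rule K[OF that primitive_integrable[OF w(1)] cost_primitive(2)[OF r w(1) car]])
    show "(\<integral>\<^sup>+t. ennreal (L t (Y n t) (w n t)) \<partial>mu r) \<le> ennreal C"
      using Y(2)[of n] c_mono[of 0 n] unfolding cost_primitive(1)[OF r w(1) car] C(2)[symmetric] by simp
  qed
  then have wUI: "\<exists>K. \<forall>n. \<forall>A\<in>sets (mu r). (\<integral>t. indicator A t * norm (w n t) \<partial>mu r) \<le> e + K * measure (mu r) A"
    if "e > 0" for e using that by blast
  obtain \<sigma> \<xi> where \<sigma>: "strict_mono \<sigma>" and \<xi>: "\<And>t. t \<ge> 0 \<Longrightarrow> (\<lambda>k. Y (\<sigma> k) t) \<longlonglongrightarrow> \<xi> t"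
    by (rule pointwise_convergent_subsequence[of r Y w \<eta>, OF r w(1) w(2) wUI]) (assumption, rule that)
  define \<phi> where "\<phi> = (\<lambda>k t. L t (Y (\<sigma> k) t) (w (\<sigma> k) t))"
  \<comment> \<open>A stand-in for the convex hull of the tail from \<open>n\<close>, on triples of
    state, derivative and value. The last two clauses are what remains of common weights: affine
    inequalities valid along the tail hold for \<open>V\<close> and \<open>\<Phi>\<close>, and balls
    containing the tail of states contain \<open>X t\<close>. Every clause is stable under
    midpoints.\<close>
  define Q where "Q = (\<lambda>n X V (\<Phi> :: real \<Rightarrow> real). primitive r X V \<and> (\<lambda>t. X t - x0 t) \<in> W11_0 r T
    \<and> (\<Phi> \<in> borel_measurable (mu r) \<and> (\<forall>t\<ge>0. 0 \<le> \<Phi> t) \<and> (\<integral>\<^sup>+t. ennreal (\<Phi> t) \<partial>mu r) \<le> c n)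
    \<and> (\<forall>e>0. \<forall>A\<in>sets (mu r). (\<integral>t. indicator A t * norm (V t) \<partial>mu r) \<le> e + K e * measure (mu r) A)
    \<and> (\<forall>t\<ge>0. \<forall>b p. (\<forall>i\<ge>n. b + p \<bullet> w (\<sigma> i) t \<le> \<phi> i t) \<longrightarrow> b + p \<bullet> V t \<le> \<Phi> t)
    \<and> (\<forall>t\<ge>0. \<forall>b e. (\<forall>i\<ge>n. norm (Y (\<sigma> i) t - b) \<le> e) \<longrightarrow> norm (X t - b) \<le> e))"
  have QD: "primitive r X V" "(\<lambda>t. X t - x0 t) \<in> W11_0 r T" "\<Phi> \<in> borel_measurable (mu r)"
      "\<forall>t\<ge>0. 0 \<le> \<Phi> t" "(\<integral>\<^sup>+t. ennreal (\<Phi> t) \<partial>mu r) \<le> c n"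
      "\<forall>e>0. \<forall>A\<in>sets (mu r). (\<integral>t. indicator A t * norm (V t) \<partial>mu r) \<le> e + K e * measure (mu r) A"
      "\<forall>t\<ge>0. \<forall>b p. (\<forall>i\<ge>n. b + p \<bullet> w (\<sigma> i) t \<le> \<phi> i t) \<longrightarrow> b + p \<bullet> V t \<le> \<Phi> t"
      "\<forall>t\<ge>0. \<forall>b e. (\<forall>i\<ge>n. norm (Y (\<sigma> i) t - b) \<le> e) \<longrightarrow> norm (X t - b) \<le> e"
    if "Q n X V \<Phi>" for n X V \<Phi>
  proof -
    note q = that[unfolded Q_def]
    show "primitive r X V" using q by (elim conjE)
    show "(\<lambda>t. X t - x0 t) \<in> W11_0 r T" using q by (elim conjE)
    show "\<Phi> \<in> borel_measurable (mu r)" using q by (elim conjE)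
    show "\<forall>t\<ge>0. 0 \<le> \<Phi> t" using q by (elim conjE)
    show "(\<integral>\<^sup>+t. ennreal (\<Phi> t) \<partial>mu r) \<le> c n" using q by (elim conjE)
    show "\<forall>e>0. \<forall>A\<in>sets (mu r). (\<integral>t. indicator A t * norm (V t) \<partial>mu r) \<le> e + K e * measure (mu r) A"
      using q by (elim conjE)
    show "\<forall>t\<ge>0. \<forall>b p. (\<forall>i\<ge>n. b + p \<bullet> w (\<sigma> i) t \<le> \<phi> i t) \<longrightarrow> b + p \<bullet> V t \<le> \<Phi> t"
      using q by (elim conjE)
    show "\<forall>t\<ge>0. \<forall>b e. (\<forall>i\<ge>n. norm (Y (\<sigma> i) t - b) \<le> e) \<longrightarrow> norm (X t - b) \<le> e"
      using q by (elim conjE)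
  qed
  have Q_ne: "Q n (Y (\<sigma> n)) (w (\<sigma> n)) (\<phi> n)" for n
    unfolding Q_def
  proof (intro conjI)
    show "\<phi> n \<in> borel_measurable (mu r)" unfolding \<phi>_def by (rule cost_primitive(2)[OF r w(1) car])
    show "\<forall>t\<ge>0. 0 \<le> \<phi> n t" unfolding \<phi>_def using L0 by blast
    have "(\<integral>\<^sup>+t. ennreal (\<phi> n t) \<partial>mu r) = cost r L (Y (\<sigma> n))"
      unfolding \<phi>_def by (rule cost_primitive(1)[OF r w(1) car, symmetric])
    also have "\<dots> \<le> c (\<sigma> n)" using Y(2) by (rule less_imp_le)
    also have "\<dots> \<le> c n" by (rule c_mono[OF seq_suble[OF \<sigma>]])
    finally show "(\<integral>\<^sup>+t. ennreal (\<phi> n t) \<partial>mu r) \<le> c n" .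
    show "\<forall>e>0. \<forall>A\<in>sets (mu r). (\<integral>t. indicator A t * norm (w (\<sigma> n) t) \<partial>mu r) \<le> e + K e * measure (mu r) A"
      using wK by blast
  qed (use w in blast)+
  have Q_dec: "Q m X V \<Phi>" if q: "Q n X V \<Phi>" and mn: "m \<le> n" for m n X V \<Phi>
    unfolding Q_def
  proof (intro conjI)
    show "(\<integral>\<^sup>+t. ennreal (\<Phi> t) \<partial>mu r) \<le> c m" using QD(5)[OF q] c_mono[OF mn] by (rule order_trans)
    show "\<forall>t\<ge>0. \<forall>b p. (\<forall>i\<ge>m. b + p \<bullet> w (\<sigma> i) t \<le> \<phi> i t) \<longrightarrow> b + p \<bullet> V t \<le> \<Phi> t"
      using QD(7)[OF q] order_trans[OF mn] by blast
    show "\<forall>t\<ge>0. \<forall>b e. (\<forall>i\<ge>m. norm (Y (\<sigma> i) t - b) \<le> e) \<longrightarrow> norm (X t - b) \<le> e"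
      using QD(8)[OF q] order_trans[OF mn] by blast
  qed (fact QD(1)[OF q] QD(2)[OF q] QD(3)[OF q] QD(4)[OF q] QD(6)[OF q])+
  \<comment> \<open>All three components are averaged with the same weights, so the affine
    inequalities coupling \<open>V\<close> and \<open>\<Phi>\<close> survive.\<close>
  have Q_mid: "Q n (\<lambda>t. (1/2) *\<^sub>R X t + (1/2) *\<^sub>R X' t) (\<lambda>t. (1/2) *\<^sub>R V t + (1/2) *\<^sub>R V' t) (\<lambda>t. (1/2) * \<Phi> t + (1/2) * \<Phi>' t)"
    if q: "Q n X V \<Phi>" and q': "Q n X' V' \<Phi>'" for n X V \<Phi> X' V' \<Phi>'
    unfolding Q_def
  proof (intro conjI allI impI ballI)
    note p = QD(1)[OF q] QD(1)[OF q']
    show "primitive r (\<lambda>t. (1/2) *\<^sub>R X t + (1/2) *\<^sub>R X' t) (\<lambda>t. (1/2) *\<^sub>R V t + (1/2) *\<^sub>R V' t)"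
      by (intro primitive_add primitive_scaleR p)
    have "(\<lambda>t. (1/2) *\<^sub>R (X t - x0 t) + (1/2) *\<^sub>R (X' t - x0 t)) \<in> W11_0 r T"
      by (intro W11_0_midpoint[OF r T] QD(2)[OF q] QD(2)[OF q'])
    moreover have "(1/2) *\<^sub>R (X t - x0 t) + (1/2) *\<^sub>R (X' t - x0 t)
        = (1/2) *\<^sub>R X t + (1/2) *\<^sub>R X' t - ((1/2) *\<^sub>R x0 t + (1/2) *\<^sub>R x0 t)" for t
      by (simp only: scaleR_diff_right) (simp add: algebra_simps)
    ultimately show "(\<lambda>t. (1/2) *\<^sub>R X t + (1/2) *\<^sub>R X' t - x0 t) \<in> W11_0 r T" by (simp only: half_sum)
    note m = QD(3)[OF q] QD(3)[OF q']
    from m show "(\<lambda>t. (1/2) * \<Phi> t + (1/2) * \<Phi>' t) \<in> borel_measurable (mu r)"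
      by (intro borel_measurable_add borel_measurable_times borel_measurable_const)
    note nn = QD(4)[OF q, rule_format] QD(4)[OF q', rule_format]
    show "0 \<le> (1/2) * \<Phi> t + (1/2) * \<Phi>' t" if "t \<ge> 0" for t
      by (intro add_nonneg_nonneg mult_nonneg_nonneg nn that) simp_all
    have "(\<integral>\<^sup>+t. ennreal ((1/2) * \<Phi> t + (1/2) * \<Phi>' t) \<partial>mu r)
        = (\<integral>\<^sup>+t. ennreal (1/2) * ennreal (\<Phi> t) + ennreal (1/2) * ennreal (\<Phi>' t) \<partial>mu r)"
    proof (rule nn_integral_cong)
      fix t assume "t \<in> space (mu r)"
      then have "0 \<le> \<Phi> t" "0 \<le> \<Phi>' t" by (auto intro: nn)
      then have "ennreal ((1/2) * \<Phi> t + (1/2) * \<Phi>' t) = ennreal ((1/2) * \<Phi> t) + ennreal ((1/2) * \<Phi>' t)"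
        by (intro ennreal_plus) auto
      also have "\<dots> = ennreal (1/2) * ennreal (\<Phi> t) + ennreal (1/2) * ennreal (\<Phi>' t)"
        by (intro arg_cong2[where f="(+)"] ennreal_mult') auto
      finally show "ennreal ((1/2) * \<Phi> t + (1/2) * \<Phi>' t) = ennreal (1/2) * ennreal (\<Phi> t) + ennreal (1/2) * ennreal (\<Phi>' t)" .
    qed
    also have "\<dots> = ennreal (1/2) * (\<integral>\<^sup>+t. ennreal (\<Phi> t) \<partial>mu r) + ennreal (1/2) * (\<integral>\<^sup>+t. ennreal (\<Phi>' t) \<partial>mu r)"
      using m by (simp add: nn_integral_add nn_integral_cmult)
    also have "\<dots> \<le> ennreal (1/2) * c n + ennreal (1/2) * c n"
      by (intro add_mono mult_left_mono QD(5)[OF q] QD(5)[OF q']) simp_all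
    also have "\<dots> = c n"
    proof -
      have "ennreal (1/2) + ennreal (1/2) = 1" using ennreal_plus[of "1/2" "1/2"] by simp
      then show ?thesis by (simp only: distrib_right[symmetric] mult_1_left)
    qed
    finally show "(\<integral>\<^sup>+t. ennreal ((1/2) * \<Phi> t + (1/2) * \<Phi>' t) \<partial>mu r) \<le> c n" .
  next
    fix e :: real and A assume e: "e > 0" and A: "A \<in> sets (mu r)"
    note p = QD(1)[OF q] QD(1)[OF q']
    have iA: "integrable (mu r) (\<lambda>t. indicator A t * norm (f t))" if "integrable (mu r) f" for f :: "real \<Rightarrow> real ^ 'n"
      using integrable_real_mult_indicator[OF A integrable_norm[OF that]] by (simp add: mult.commute)
    note i = primitive_integrable[OF p(1)] primitive_integrable[OF p(2)]
    have "(\<integral>t. indicator A t * norm ((1/2) *\<^sub>R V t + (1/2) *\<^sub>R V' t) \<partial>mu r)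
       \<le> (\<integral>t. (1/2) * (indicator A t * norm (V t)) + (1/2) * (indicator A t * norm (V' t)) \<partial>mu r)"
    proof (rule integral_mono)
      show "integrable (mu r) (\<lambda>t. indicator A t * norm ((1/2) *\<^sub>R V t + (1/2) *\<^sub>R V' t))"
        by (intro iA Bochner_Integration.integrable_add integrable_scaleR_right i)
      show "integrable (mu r) (\<lambda>t. (1/2) * (indicator A t * norm (V t)) + (1/2) * (indicator A t * norm (V' t)))"
        by (intro Bochner_Integration.integrable_add integrable_mult_right iA i)
      fix t
      show "indicator A t * norm ((1/2) *\<^sub>R V t + (1/2) *\<^sub>R V' t) \<le> (1/2) * (indicator A t * norm (V t)) + (1/2) * (indicator A t * norm (V' t))"
        using norm_triangle_ineq[of "(1/2) *\<^sub>R V t" "(1/2) *\<^sub>R V' t"] by (cases "t \<in> A") simp_all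
    qed
    also have "\<dots> = (1/2) * (\<integral>t. indicator A t * norm (V t) \<partial>mu r) + (1/2) * (\<integral>t. indicator A t * norm (V' t) \<partial>mu r)"
      using iA[OF i(1)] iA[OF i(2)] by simp
    also have "\<dots> \<le> (1/2) * (e + K e * measure (mu r) A) + (1/2) * (e + K e * measure (mu r) A)"
      by (intro add_mono mult_left_mono QD(6)[OF q, rule_format] QD(6)[OF q', rule_format] e A) simp_all
    finally show "(\<integral>t. indicator A t * norm ((1/2) *\<^sub>R V t + (1/2) *\<^sub>R V' t) \<partial>mu r) \<le> e + K e * measure (mu r) A"
      by simp
  next
    fix t :: real and b :: real and p assume t: "0 \<le> t" and b: "\<forall>i\<ge>n. b + p \<bullet> w (\<sigma> i) t \<le> \<phi> i t"
    have "b + p \<bullet> V t \<le> \<Phi> t" "b + p \<bullet> V' t \<le> \<Phi>' t" by (rule QD(7)[OF q, rule_format, OF t b[rule_format]], assumption)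
      (rule QD(7)[OF q', rule_format, OF t b[rule_format]], assumption)
    then show "b + p \<bullet> ((1/2) *\<^sub>R V t + (1/2) *\<^sub>R V' t) \<le> (1/2) * \<Phi> t + (1/2) * \<Phi>' t"
      by (simp add: inner_add_right)
  next
    fix t e :: real and b assume t: "0 \<le> t" and b: "\<forall>i\<ge>n. norm (Y (\<sigma> i) t - b) \<le> e"
    have "norm (X t - b) \<le> e" "norm (X' t - b) \<le> e" by (rule QD(8)[OF q, rule_format, OF t b[rule_format]], assumption)
      (rule QD(8)[OF q', rule_format, OF t b[rule_format]], assumption)
    moreover have "(1/2) *\<^sub>R X t + (1/2) *\<^sub>R X' t - ((1/2) *\<^sub>R b + (1/2) *\<^sub>R b) = (1/2) *\<^sub>R (X t - b) + (1/2) *\<^sub>R (X' t - b)"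
      by (simp only: scaleR_diff_right) (simp add: algebra_simps)
    ultimately show "norm ((1/2) *\<^sub>R X t + (1/2) *\<^sub>R X' t - b) \<le> e"
      using norm_triangle_ineq[of "(1/2) *\<^sub>R (X t - b)" "(1/2) *\<^sub>R (X' t - b)"] unfolding half_sum by simp
  qed
  \<comment> \<open>The families are the projections of \<open>Q n\<close> to the derivatives, the
    component whose strong convergence is sought; matching states and values are recovered from
    membership afterwards.\<close>
  obtain G g where G: "\<And>n. G n \<in> {V. \<exists>X \<Phi>. Q n X V \<Phi>}" and g: "integrable (mu r) g"
    and Gg: "(\<lambda>n. \<integral>t. norm (G n t - g t) \<partial>mu r) \<longlonglongrightarrow> 0" and GgAE: "AE t in mu r. (\<lambda>n. G n t) \<longlonglongrightarrow> g t"
  proof (rule midpoint_convex_L1_convergent[of "\<lambda>n. {V. \<exists>X \<Phi>. Q n X V \<Phi>}"])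
    show "{V. \<exists>X \<Phi>. Q n X V \<Phi>} \<noteq> {}" for n using Q_ne by blast
    show "{V. \<exists>X \<Phi>. Q n X V \<Phi>} \<subseteq> {V. \<exists>X \<Phi>. Q m X V \<Phi>}" if "m \<le> n" for m n using Q_dec that by blast
    show "(\<lambda>t. (1/2) *\<^sub>R f t + (1/2) *\<^sub>R h t) \<in> {V. \<exists>X \<Phi>. Q n X V \<Phi>}"
      if "f \<in> {V. \<exists>X \<Phi>. Q n X V \<Phi>}" "h \<in> {V. \<exists>X \<Phi>. Q n X V \<Phi>}" for n f h
      using that Q_mid by blast
    show "integrable (mu r) f" if "f \<in> {V. \<exists>X \<Phi>. Q 0 X V \<Phi>}" for f
      using that primitive_integrable QD(1) by blast
    show "\<exists>K. \<forall>f\<in>{V. \<exists>X \<Phi>. Q 0 X V \<Phi>}. \<forall>A\<in>sets (mu r). (\<integral>t. indicator A t * norm (f t) \<partial>mu r) \<le> e + K * measure (mu r) A"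
      if "e > 0" for e
      using that QD(6) by (intro exI[of _ "K e"]) blast
  qed (rule that)
  from G have "\<exists>X \<Phi>. Q n X (G n) \<Phi>" for n by blast
  then obtain X \<Phi> where XQ: "\<And>n. Q n (X n) (G n) (\<Phi> n)" by metis
  note X = QD(1)[OF XQ] and XW = QD(2)[OF XQ] and \<Phi> = QD(3)[OF XQ] QD(5)[OF XQ]
  have \<Phi>w: "b + p \<bullet> G n t \<le> \<Phi> n t" if "t \<ge> 0" "\<And>i. i \<ge> n \<Longrightarrow> b + p \<bullet> w (\<sigma> i) t \<le> \<phi> i t" for n t b p
    using QD(7)[OF XQ, rule_format, OF that(1), of n b p] that(2) by simp
  have Xb: "norm (X n t - b) \<le> e" if "t \<ge> 0" "\<And>i. i \<ge> n \<Longrightarrow> norm (Y (\<sigma> i) t - b) \<le> e" for n t b e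
    using QD(8)[OF XQ, rule_format, OF that(1), of n b e] that(2) by simp
  \<comment> \<open>The ball clause with radius 0.\<close>
  have X_0: "X n 0 = \<eta>" for n using Xb[of 0 n \<eta> 0] w(2) by simp
  define x where "x = (\<lambda>t. \<eta> + integral {0..t} g)"
  have x_0: "x 0 = \<eta>" by (simp add: x_def)
  have xp: "primitive r x g" unfolding primitive_def x_0 using g by (simp add: x_def)
  have d: "primitive r (\<lambda>t. x t - X n t) (\<lambda>t. g t - G n t)" for n by (rule primitive_diff[OF xp X])
  have dG: "(\<integral>t. norm (g t - G n t) \<partial>mu r) = (\<integral>t. norm (G n t - g t) \<partial>mu r)" for n
    by (simp add: norm_minus_commute)
  \<comment> \<open>\<open>X n t\<close> has two limits: \<open>\<xi> t\<close>, since small balls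
    around it contain the tail of states, and \<open>x t\<close>, since increments are controlled by
    the \<open>L^1\<close> distance of the derivatives.\<close>
  have \<xi>x: "\<xi> t = x t" if t: "t \<ge> 0" for t
  proof (rule LIMSEQ_unique)
    show "(\<lambda>n. X n t) \<longlonglongrightarrow> \<xi> t"
    proof (rule metric_LIMSEQ_I)
      fix e :: real assume "e > 0"
      then obtain N where "\<And>i. i \<ge> N \<Longrightarrow> dist (Y (\<sigma> i) t) (\<xi> t) < e / 2"
        using metric_LIMSEQ_D[OF \<xi>[OF t], of "e / 2"] by auto
      then have "norm (X n t - \<xi> t) \<le> e / 2" if "n \<ge> N" for n
        using that by (intro Xb[OF t]) (auto simp: dist_norm intro: less_imp_le)
      then show "\<exists>no. \<forall>n\<ge>no. dist (X n t) (\<xi> t) < e" using \<open>e > 0\<close> by (intro exI[of _ N]) (force simp: dist_norm)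
    qed
    have "(\<lambda>n. x t - X n t) \<longlonglongrightarrow> 0"
    proof (rule Lim_null_comparison)
      show "\<forall>\<^sub>F n in sequentially. norm (x t - X n t) \<le> exp (r * t) * (\<integral>s. norm (G n s - g s) \<partial>mu r)"
      proof (intro always_eventually allI)
        fix n
        have "x t - X n t = integral {0..t} (\<lambda>s. g s - G n s)"
          using primitive_eq[OF d t, of n] x_0 X_0 by simp
        then have "norm (x t - X n t) \<le> exp (r * t) * (\<integral>s. indicator {0..t} s * norm (g s - G n s) \<partial>mu r)"
          using norm_integral_le_mu[OF primitive_integrable[OF d[of n]] r order_refl, of t] by simp
        also have "\<dots> \<le> exp (r * t) * (\<integral>s. norm (g s - G n s) \<partial>mu r)"
        proof (intro mult_left_mono integral_mono)
          show n: "integrable (mu r) (\<lambda>s. norm (g s - G n s))" by (intro integrable_norm primitive_integrable[OF d])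
          show "integrable (mu r) (\<lambda>s. indicator {0..t} s * norm (g s - G n s))"
            using integrable_real_mult_indicator[OF _ n, of "{0..t}"] by (simp add: sets_restrict_space_iff mult.commute)
        qed (auto simp: indicator_def)
        finally show "norm (x t - X n t) \<le> exp (r * t) * (\<integral>s. norm (G n s - g s) \<partial>mu r)" by (simp only: dG)
      qed
      show "(\<lambda>n. exp (r * t) * (\<integral>s. norm (G n s - g s) \<partial>mu r)) \<longlonglongrightarrow> 0"
        using tendsto_mult_right_zero[OF Gg] by simp
    qed
    then have "(\<lambda>n. x t - (x t - X n t)) \<longlonglongrightarrow> x t - 0" by (intro tendsto_intros)
    then show "(\<lambda>n. X n t) \<longlonglongrightarrow> x t" by simp
  qed
  have "(\<lambda>t. x t - x0 t) \<in> W11_0 r T"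
  proof (rule W11_0_closed[OF r T W11_diff[OF r primitive_W11[OF r xp] x0W]])
    fix e :: real assume e: "e > 0"
    \<comment> \<open>The derivative error enters the \<open>W11\<close> norm once directly and
      once, with factor \<open>1 / r\<close>, through its primitive, which starts at 0.\<close>
    have "(\<lambda>n. (1 / r + 1) * (\<integral>t. norm (G n t - g t) \<partial>mu r)) \<longlonglongrightarrow> 0"
      using tendsto_mult_right_zero[OF Gg] by simp
    then have "\<forall>\<^sub>F n in sequentially. (1 / r + 1) * (\<integral>t. norm (G n t - g t) \<partial>mu r) < e"
      by (rule order_tendstoD) (rule e)
    then obtain n where n: "(1 / r + 1) * (\<integral>t. norm (G n t - g t) \<partial>mu r) < e" unfolding eventually_sequentially by blast
    have "W11_norm r (\<lambda>t. x t - X n t) = L1_norm r (\<lambda>t. x t - X n t) + L1_norm r (\<lambda>t. g t - G n t)"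
      by (rule W11_norm_primitive[OF r d])
    also have "L1_norm r (\<lambda>t. x t - X n t) \<le> (\<integral>t. norm (g t - G n t) \<partial>mu r) / r"
      using primitive_L1(2)[OF r d[of n]] x_0 X_0[of n] by (simp add: L1_norm_def)
    also have "(\<integral>t. norm (g t - G n t) \<partial>mu r) / r + L1_norm r (\<lambda>t. g t - G n t) = (1 / r + 1) * (\<integral>t. norm (G n t - g t) \<partial>mu r)"
      unfolding L1_norm_def dG by (simp add: algebra_simps)
    also note n
    finally have "W11_norm r (\<lambda>t. (x t - x0 t) - (X n t - x0 t)) < e" by simp
    then show "\<exists>h\<in>W11_0 r T. W11_norm r (\<lambda>t. x t - x0 t - h t) < e" by (rule bexI[OF _ XW])
  qed
  then have xadm: "x \<in> admissible r T x0"
    unfolding admissible_def by (intro image_eqI[of _ _ "\<lambda>t. x t - x0 t"]) auto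
  \<comment> \<open>The states used here are the uncombined \<open>Y (\<sigma> k) t\<close>, which
    converge to \<open>x t\<close>; only derivatives and values are combined.\<close>
  have pt: "AE t in mu r. ennreal (L t (x t) (g t)) \<le> liminf (\<lambda>n. ennreal (\<Phi> n t))"
  proof -
    have 1: "AE t in mu r. continuous_on UNIV (\<lambda>(x, y). L t x y)"
      unfolding AE_mu_iff using car by (simp add: caratheodory_def)
    have 2: "AE t in mu r. \<forall>x. convex_on UNIV (L t x)" unfolding AE_mu_iff by (rule assms(7))
    from 1 2 GgAE AE_space show ?thesis
    proof eventually_elim
      case (elim t)
      then have t: "t \<ge> 0" by simp
      show ?case
      proof (rule convex_integrand_liminf[where F="L t" and xi="\<lambda>k. Y (\<sigma> k) t" and V="\<lambda>n. G n t" and vi="\<lambda>i. w (\<sigma> i) t"])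
        show "continuous_on UNIV (\<lambda>(x, y). L t x y)" by (rule elim(1))
        show "convex_on UNIV (L t (x t))" using elim(2) by blast
        show "\<exists>R. \<forall>x y. m * norm y \<le> R + L t x y" for m using growth[of m] t by blast
        show "(\<lambda>k. Y (\<sigma> k) t) \<longlonglongrightarrow> x t" using \<xi>[OF t] \<xi>x[OF t] by simp
        show "(\<lambda>n. G n t) \<longlonglongrightarrow> g t" by (rule elim(3))
        show "b + p \<bullet> G n t \<le> \<Phi> n t" if "\<And>i. i \<ge> n \<Longrightarrow> b + p \<bullet> w (\<sigma> i) t \<le> L t (Y (\<sigma> i) t) (w (\<sigma> i) t)" for n b p
          by (rule \<Phi>w[OF t]) (use that in \<open>simp add: \<phi>_def\<close>)
      qed
    qed
  qed
  have "cost r L x = (\<integral>\<^sup>+t. ennreal (L t (x t) (g t)) \<partial>mu r)" by (rule cost_primitive(1)[OF r xp car])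
  also have "\<dots> \<le> (\<integral>\<^sup>+t. liminf (\<lambda>n. ennreal (\<Phi> n t)) \<partial>mu r)" by (rule nn_integral_mono_AE[OF pt])
  also have "\<dots> \<le> liminf (\<lambda>n. \<integral>\<^sup>+t. ennreal (\<Phi> n t) \<partial>mu r)"
    by (rule nn_integral_liminf) (use \<Phi>(1) in measurable)
  \<comment> \<open>The values \<open>\<Phi> n\<close> need not be costs of the states
    \<open>X n\<close>; their integrals stay within the allowance \<open>c n\<close>, which
    suffices.\<close>
  also have "\<dots> \<le> liminf c" by (rule Liminf_mono) (use \<Phi>(2) in simp)
  also have "liminf c = I" using c_lim by (rule lim_imp_Liminf[OF sequentially_bot])
  finally have "cost r L x \<le> I" .
  then have "cost r L x \<le> cost r L y" if "y \<in> admissible r T x0" for y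
    using INF_lower[OF that, of "cost r L"] unfolding I_def by (rule order_trans)
  then show ?thesis using xadm by blast
qed

end
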